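(* Let $\mathcal{C}_1\subseteq\mathcal{C}_2$ be idempotent equational classes of Boolean functions, and let $[\mathcal{C}_1,\mathcal{C}_2]=\{\mathcal{K}\in{\bf E}_{\mathbb{B}}:\mathcal{C}_1\subseteq\mathcal{K}\subseteq\mathcal{C}_2\}$. Then $[\mathcal{C}_1,\mathcal{C}_2]$ is countable if and only if one of the following holds: (a) $\mathcal{C}_2\subseteq V$; (b) $\mathcal{C}_2\subseteq\Lambda$; (c) $\mathcal{C}_2\subseteq L$; (d) there is a clone $\mathcal{C}\in\{U_m:m\ge2\}\cup\{W_m:m\ge2\}\cup\{\Omega,U_\infty,W_\infty\}$ such that $\mathcal{C}\cap M_c\subseteq\mathcal{C}_1$ and $\mathcal{C}_2\subseteq\mathcal{C}\cap M$.
   Context: $\mathbb{B}=\{0,1\}$, $\Omega$ is the set of all Boolean functions $\mathbb{B}^n\to\mathbb{B}$ ($n\ge1$). Composition $f(g_1,\dots,g_n)({\bf a})=f(g_1({\bf a}),\dots,g_n({\bf a}))$; class composition $\mathcal{I}\mathcal{J}=\{f(g_1,\dots,g_n): f\ n\text{-ary in }\mathcal{I},\ g_i\ m\text{-ary in }\mathcal{J}\}$; a class $\mathcal{C}$ is idempotent if $\mathcal{C}\mathcal{C}=\mathcal{C}$. An equational class is a class $\mathcal{K}$ with $\mathcal{K}I_c=\mathcal{K}$, where $I_c$ is the class of all projections (equivalently, closed under $f\mapsto f(p_1,\dots,p_n)$ for projections $p_i$); ${\bf E}_{\mathbb{B}}$ is the set of equational classes. $\mathbb{B}^n$ is ordered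 componentwise. Classes: $T_0=\{f:f(0,\dots,0)=0\}$, $T_1=\{f:f(1,\dots,1)=1\}$, $T_c=T_0\cap T_1$; $M$ = monotone functions, $M_c=M\cap T_c$; $L$ = functions of the form $c_0\oplus c_1x_1\oplus\cdots\oplus c_nx_n$ ($c_i\in\mathbb{B}$, $\oplus$ addition mod 2); $\Lambda$ = constant functions ${\bf 0},{\bf 1}$ together with all conjunctions $x_{i_1}\wedge\cdots\wedge x_{i_k}$ (of any arity); $V$ = constants together with all disjunctions $x_{i_1}\vee\cdots\vee x_{i_k}$. For $a\in\mathbb{B}$, a set $B\subseteq\mathbb{B}^n$ is $a$-separating if there is $i$ with $b_i=a$ for all $(b_1,\dots,b_n)\in B$; $f$ is $a$-separating if $f^{-1}(a)$ is $a$-separating, and $a$-separating of rank $k\ge2$ if every subset of $f^{-1}(a)$ of size at most $k$ is $a$-separating. $U_m$ (resp. $W_m$), $m\ge2$, is the class of $1$-separating (resp. $0$-separating) functions of rank $m$; $U_\infty=\bigcap_{k\ge2}U_k$, $W_\infty=\bigcap_{k\ge2}W_k$.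
   Formalization: The inclusion of C1 in C2 is taken to be proper: for C1 = C2 = Ω the interval is the single class Ω, hence countable, although none of (a)–(d) holds. *)

theory Defs
  imports Complex_Main "HOL-Library.FuncSet" "HOL-Library.Countable_Set"
begin

definition cube :: "nat \<Rightarrow> bool list set" where
  "cube n = {a. length a = n}"

text \<open>
  A Boolean function is a pair of its arity and a map on bit tuples (\<^const>\<open>False\<close> is 0,
  \<^const>\<open>True\<close> is 1). The map is required to be extensional on the cube, so that equality of
  pairs is equality of functions, and functions of different arity are always distinct.
\<close>

type_synonym bfun = "nat \<times> (bool list \<Rightarrow> bool)"

definition Omega :: "bfun set" where
  "Omega = {(n, f) | n f. 1 \<le> n \<and> f \<in> cube n \<rightarrow>\<^sub>E UNIV}"

definition compose_bfun ::
    "nat \<Rightarrow> (bool list \<Rightarrow> bool) \<Rightarrow> (bool list \<Rightarrow> bool) list \<Rightarrow> bfun" where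
  "compose_bfun m f gs = (m, \<lambda>a\<in>cube m. f (map (\<lambda>g. g a) gs))"

definition class_comp :: "bfun set \<Rightarrow> bfun set \<Rightarrow> bfun set" where
  "class_comp I J = {compose_bfun m f gs | m n f gs.
     (n, f) \<in> I \<and> length gs = n \<and> (\<forall>g\<in>set gs. (m, g) \<in> J)}"

definition idempotent_class :: "bfun set \<Rightarrow> bool" where
  "idempotent_class C \<longleftrightarrow> class_comp C C = C"

definition projections :: "bfun set" where
  "projections = {(n, \<lambda>a\<in>cube n. a ! i) | n i. i < n}"

definition equational_class :: "bfun set \<Rightarrow> bool" where
  "equational_class K \<longleftrightarrow> K \<subseteq> Omega \<and> class_comp K projections = K"

definition class_interval :: "bfun set \<Rightarrow> bfun set \<Rightarrow> bfun set set" where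
  "class_interval C1 C2 = {K. equational_class K \<and> C1 \<subseteq> K \<and> K \<subseteq> C2}"

definition T0_class :: "bfun set" where
  "T0_class = {(n, f) | n f. (n, f) \<in> Omega \<and> f (replicate n False) = False}"

definition T1_class :: "bfun set" where
  "T1_class = {(n, f) | n f. (n, f) \<in> Omega \<and> f (replicate n True) = True}"

definition Tc_class :: "bfun set" where
  "Tc_class = T0_class \<inter> T1_class"

definition M_class :: "bfun set" where
  "M_class = {(n, f) | n f. (n, f) \<in> Omega \<and>
     (\<forall>a\<in>cube n. \<forall>b\<in>cube n. list_all2 (\<le>) a b \<longrightarrow> f a \<le> f b)}"

definition Mc_class :: "bfun set" where
  "Mc_class = M_class \<inter> Tc_class"

definition L_class :: "bfun set" where
  "L_class = {(n, f) | n f. (n, f) \<in> Omega \<and>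
     (\<exists>(c0 :: nat) (c :: nat \<Rightarrow> nat). c0 \<in> {0, 1} \<and> (\<forall>i. c i \<in> {0, 1}) \<and>
       (\<forall>a\<in>cube n. of_bool (f a) = (c0 + (\<Sum>i<n. c i * of_bool (a ! i))) mod 2))}"

definition constant_functions :: "bfun set" where
  "constant_functions = {(n, \<lambda>a\<in>cube n. c) | n c. 1 \<le> n}"

definition Lambda_class :: "bfun set" where
  "Lambda_class = constant_functions \<union>
     {(n, \<lambda>a\<in>cube n. \<forall>i\<in>I. a ! i) | n I. I \<subseteq> {..<n} \<and> I \<noteq> {}}"

definition V_class :: "bfun set" where
  "V_class = constant_functions \<union>
     {(n, \<lambda>a\<in>cube n. \<exists>i\<in>I. a ! i) | n I. I \<subseteq> {..<n} \<and> I \<noteq> {}}"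

definition separating_set :: "bool \<Rightarrow> nat \<Rightarrow> bool list set \<Rightarrow> bool" where
  "separating_set a n B \<longleftrightarrow> (\<exists>i<n. \<forall>b\<in>B. b ! i = a)"

definition separating_of_rank :: "bool \<Rightarrow> nat \<Rightarrow> bfun set" where
  "separating_of_rank a k = {(n, f) | n f. (n, f) \<in> Omega \<and>
     (\<forall>B. B \<subseteq> {b \<in> cube n. f b = a} \<and> card B \<le> k \<longrightarrow> separating_set a n B)}"

definition U_class :: "nat \<Rightarrow> bfun set" where
  "U_class m = separating_of_rank True m"

definition W_class :: "nat \<Rightarrow> bfun set" where
  "W_class m = separating_of_rank False m"

definition U_inf :: "bfun set" where
  "U_inf = (\<Inter>k\<in>{2..}. U_class k)"

definition W_inf :: "bfun set" where
  "W_inf = (\<Inter>k\<in>{2..}. W_class k)"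

end

theory Submission
  imports Defs
begin

text \<open>
  Countable intervals: inside V, Lambda and L a function is determined up to minors by a constant and its number
  of essential variables, and an equational class by three sets of numbers closed under subtracting 2;
  in case (d) only constants can be added to \<^term>\<open>C1\<close>.

  Uncountable intervals: it suffices to find infinitely many functions in \<^term>\<open>C2 - C1\<close> none of which is a
  minor of another. If \<^term>\<open>C2\<close> is a clone outside V, Lambda and L, then it contains the majority function,
  \<open>x \<and> (y \<or> z)\<close>, or its dual. Substituting for the variables of a nonconstant \<open>f\<close> in \<^term>\<open>C2 - C1\<close> suitable
  idempotent monotone functions of disjoint sets of variables gives functions that have \<open>f\<close> as a minor, and the number
  of variables that must be set to 1 to make them constant distinguishes them. If \<^term>\<open>C2 - C1\<close> consists of
  constants, then \<^term>\<open>C2\<close> must be monotone, and a Baker-Pixley argument leads to case (d).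

  Idempotent classes need not contain the projections (the functions with \<open>f(0,...,0) = f(1,...,1) = 0\<close>
  form one). In such a class \<^term>\<open>C2\<close> an antichain is obtained by removing from a function in
  \<^term>\<open>C2 - C1\<close> guarded copies of Pippenger's functions, which are 1 on the points of weight 1 and \<open>n - 1\<close>.
\<close>

section \<open>Functions of finitely many variables and minors\<close>

text \<open>Two obstacles shape the uncountable part. The first is constants: substituting into the
  arguments of a constant produces nothing new. So below a clone outside V, Lambda and L,
  countability means that every nonconstant member of \<open>C2\<close> already lies in
  \<open>C1\<close>, and it remains to compute the nonconstant part of \<open>C2\<close>. This is
  the origin of the parameter \<open>m\<close> in case (d): if a monotone clone without the constant
  1 is not contained in \<open>U_class (k + 1)\<close>, then at most k + 1 true points without a
  common coordinate give, by identifying variables, a function of k + 1 variables that is 1 as soon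
  as k of them are 1. With it, interpolation needs to treat only k true points at a time, and rank k
  supplies a common coordinate of those. The second obstacle is the lack of projections in some
  classes: there a variable enters only together with a second one that plays the part of 0, and
  complements exist only relative to a guard.\<close>

definition supported :: "nat \<Rightarrow> ((nat \<Rightarrow> bool) \<Rightarrow> bool) \<Rightarrow> bool" where
  "supported n F \<longleftrightarrow> (\<forall>x y. (\<forall>i<n. x i = y i) \<longrightarrow> F x = F y)"

definition bfun_of :: "nat \<Rightarrow> ((nat \<Rightarrow> bool) \<Rightarrow> bool) \<Rightarrow> bfun" where
  "bfun_of n F = (n, \<lambda>a\<in>cube n. F (\<lambda>i. a ! i))"

text \<open>Functions of all arities live on infinite sequences, so that minors and compositions are
  plain substitutions in one type. Being \<open>supported\<close> makes \<open>F\<close> unique for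
  its \<open>bfun\<close>, see \<open>bfun_of_inject\<close>.\<close>

definition mem :: "bfun set \<Rightarrow> nat \<Rightarrow> ((nat \<Rightarrow> bool) \<Rightarrow> bool) \<Rightarrow> bool" where
  "mem C n F \<longleftrightarrow> supported n F \<and> bfun_of n F \<in> C"

definition minor_closed :: "bfun set \<Rightarrow> bool" where
  "minor_closed C \<longleftrightarrow> C \<subseteq> Omega \<and>
     (\<forall>m n F \<sigma>. mem C n F \<longrightarrow> (\<forall>i<n. \<sigma> i < m) \<longrightarrow> mem C m (\<lambda>x. F (\<lambda>i. x (\<sigma> i))))"

definition comp_closed :: "bfun set \<Rightarrow> bool" where
  "comp_closed C \<longleftrightarrow>
     (\<forall>m n F G. mem C n F \<longrightarrow> (\<forall>i<n. mem C m (G i)) \<longrightarrow> mem C m (\<lambda>x. F (\<lambda>i. G i x)))"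

lemma supportedD: "supported n F \<Longrightarrow> (\<And>i. i < n \<Longrightarrow> x i = y i) \<Longrightarrow> F x = F y"
  by (auto simp: supported_def)

lemma supported_comp:
  assumes "supported n F" "\<And>i. i < n \<Longrightarrow> supported m (G i)"
  shows "supported m (\<lambda>x. F (\<lambda>i. G i x))"
  unfolding supported_def
proof (intro allI impI)
  fix x y :: "nat \<Rightarrow> bool" assume "\<forall>i<m. x i = y i"
  then have "\<And>i. i < n \<Longrightarrow> G i x = G i y" using assms(2) by (auto simp: supported_def)
  then show "F (\<lambda>i. G i x) = F (\<lambda>i. G i y)" using assms(1) by (auto simp: supported_def)
qed

lemma supported_proj: "i < n \<Longrightarrow> supported n (\<lambda>x. x i)"
  by (auto simp: supported_def)

lemma map_nth_cube: "a \<in> cube n \<Longrightarrow> map ((!) a) [0..<n] = a"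
  by (auto simp: cube_def intro: nth_equalityI)

lemma bfun_of_inject:
  assumes "supported n F" "supported n G" "bfun_of n F = bfun_of n G"
  shows "F = G"
proof
  fix x :: "nat \<Rightarrow> bool"
  define a where "a = map x [0..<n]"
  have a: "a \<in> cube n" by (simp add: cube_def a_def)
  have "(\<lambda>a\<in>cube n. F (\<lambda>i. a ! i)) a = (\<lambda>a\<in>cube n. G (\<lambda>i. a ! i)) a"
    using assms(3) by (simp add: bfun_of_def)
  then have "F (\<lambda>i. a ! i) = G (\<lambda>i. a ! i)" using a by simp
  moreover have "F (\<lambda>i. a ! i) = F x" by (rule supportedD[OF assms(1)]) (simp add: a_def)
  moreover have "G (\<lambda>i. a ! i) = G x" by (rule supportedD[OF assms(2)]) (simp add: a_def)
  ultimately show "F x = G x" by simp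
qed

lemma bfun_of_Omega: "bfun_of n F \<in> Omega \<longleftrightarrow> 1 \<le> n"
  by (auto simp: bfun_of_def Omega_def)

lemma bfun_cases:
  assumes "u \<in> Omega"
  obtains n F where "1 \<le> n" "supported n F" "u = bfun_of n F"
proof -
  obtain n f where u: "u = (n, f)" "1 \<le> n" "f \<in> cube n \<rightarrow>\<^sub>E UNIV"
    using assms by (auto simp: Omega_def)
  have "f = (\<lambda>a\<in>cube n. f (map (\<lambda>i. a ! i) [0..<n]))"
    using u(3) map_nth_cube by (fastforce simp: PiE_def extensional_def restrict_def fun_eq_iff)
  then have "u = bfun_of n (\<lambda>x. f (map x [0..<n]))" by (simp add: u bfun_of_def)
  moreover have "supported n (\<lambda>x. f (map x [0..<n]))"
  proof -
    have "map x [0..<n] = map y [0..<n]" if "\<forall>i<n. x i = y i" for x y :: "nat \<Rightarrow> bool"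
      using that by auto
    then show ?thesis unfolding supported_def by metis
  qed
  ultimately show ?thesis using that u(2) by blast
qed

lemma mem_pos: "C \<subseteq> Omega \<Longrightarrow> mem C n F \<Longrightarrow> 1 \<le> n"
  by (metis bfun_of_Omega mem_def subsetD)

lemma mem_supported: "mem C n F \<Longrightarrow> supported n F"
  by (simp add: mem_def)

lemma mem_mono: "C \<subseteq> D \<Longrightarrow> mem C n F \<Longrightarrow> mem D n F"
  by (auto simp: mem_def)

lemma subset_via_mem:
  assumes "C \<subseteq> Omega" "\<And>n F. mem C n F \<Longrightarrow> mem D n F"
  shows "C \<subseteq> D"
proof
  fix u assume "u \<in> C"
  moreover then obtain n F where "supported n F" "u = bfun_of n F"
    using assms(1) bfun_cases by blast
  ultimately show "u \<in> D" using assms(2)[of n F] by (simp add: mem_def)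
qed

lemma not_subset_mem:
  assumes "C \<subseteq> Omega" "\<not> C \<subseteq> D"
  obtains n F where "mem C n F" "\<not> mem D n F"
  using assms subset_via_mem by blast

lemma bfun_of_eq_fst: "bfun_of n F = bfun_of m G \<Longrightarrow> n = m"
  by (simp add: bfun_of_def)

lemma compose_bfun_of:
  assumes "supported n F" "length gs = n" "\<And>i. i < n \<Longrightarrow> gs ! i = (\<lambda>a\<in>cube m. G i (\<lambda>j. a ! j))"
  shows "compose_bfun m (\<lambda>a\<in>cube n. F (\<lambda>i. a ! i)) gs = bfun_of m (\<lambda>x. F (\<lambda>i. G i x))"
proof -
  have "(\<lambda>a\<in>cube n. F (\<lambda>i. a ! i)) (map (\<lambda>g. g a) gs) = F (\<lambda>i. G i (\<lambda>j. a ! j))"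
    if "a \<in> cube m" for a
  proof -
    have "map (\<lambda>g. g a) gs \<in> cube n" using assms(2) by (simp add: cube_def)
    moreover have "F (\<lambda>i. map (\<lambda>g. g a) gs ! i) = F (\<lambda>i. G i (\<lambda>j. a ! j))"
      by (rule supportedD[OF assms(1)]) (use assms(2,3) that in simp)
    ultimately show ?thesis by simp
  qed
  then show ?thesis by (auto simp: compose_bfun_def bfun_of_def restrict_def fun_eq_iff)
qed

lemma mem_class_comp:
  assumes "C \<subseteq> Omega" "J \<subseteq> Omega"
  shows "mem (class_comp C J) m H \<longleftrightarrow>
    (\<exists>n F G. mem C n F \<and> (\<forall>i<n. mem J m (G i)) \<and> H = (\<lambda>x. F (\<lambda>i. G i x)))"
proof
  assume H: "mem (class_comp C J) m H"
  then obtain n f gs where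
    1: "(n, f) \<in> C" "length gs = n" "\<forall>g\<in>set gs. (m, g) \<in> J" "bfun_of m H = compose_bfun m f gs"
    by (auto simp: mem_def class_comp_def bfun_of_def compose_bfun_def)
  obtain n' F where 2: "supported n' F" "(n, f) = bfun_of n' F"
    using 1(1) assms(1) bfun_cases by blast
  then have n: "n' = n" and f: "f = (\<lambda>a\<in>cube n. F (\<lambda>i. a ! i))" by (auto simp: bfun_of_def)
  have "\<exists>G. supported m G \<and> gs ! i = (\<lambda>a\<in>cube m. G (\<lambda>j. a ! j))" if "i < n" for i
  proof -
    have "(m, gs ! i) \<in> J" using 1 that by auto
    then obtain m' G where "supported m' G" "(m, gs ! i) = bfun_of m' G"
      using assms(2) bfun_cases by blast
    then show ?thesis by (auto simp: bfun_of_def)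
  qed
  then obtain G where G: "\<And>i. i < n \<Longrightarrow> supported m (G i)"
    "\<And>i. i < n \<Longrightarrow> gs ! i = (\<lambda>a\<in>cube m. G i (\<lambda>j. a ! j))" by metis
  have "mem C n F" using 1 2 n by (simp add: mem_def)
  moreover have "\<forall>i<n. mem J m (G i)"
  proof (intro allI impI)
    fix i assume i: "i < n"
    then have "(m, gs ! i) \<in> J" using 1(2,3) nth_mem by blast
    then show "mem J m (G i)" using G i by (simp add: mem_def bfun_of_def)
  qed
  moreover have "H = (\<lambda>x. F (\<lambda>i. G i x))"
  proof (rule bfun_of_inject)
    show "supported m H" using H by (simp add: mem_def)
    show "supported m (\<lambda>x. F (\<lambda>i. G i x))" using supported_comp 2 n G by blast
    show "bfun_of m H = bfun_of m (\<lambda>x. F (\<lambda>i. G i x))"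
      using 1(4) compose_bfun_of[of n F gs G m] 2 n f 1(2) G by simp
  qed
  ultimately show "\<exists>n F G. mem C n F \<and> (\<forall>i<n. mem J m (G i)) \<and> H = (\<lambda>x. F (\<lambda>i. G i x))" by blast
next
  assume "\<exists>n F G. mem C n F \<and> (\<forall>i<n. mem J m (G i)) \<and> H = (\<lambda>x. F (\<lambda>i. G i x))"
  then obtain n F G where 1: "mem C n F" "\<forall>i<n. mem J m (G i)" "H = (\<lambda>x. F (\<lambda>i. G i x))" by blast
  define gs where "gs = map (\<lambda>i. (\<lambda>a\<in>cube m. G i (\<lambda>j. a ! j))) [0..<n]"
  have "supported m H" unfolding 1(3) by (rule supported_comp) (use 1 in \<open>auto simp: mem_def\<close>)
  moreover have "bfun_of m H \<in> class_comp C J"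
  proof -
    have "bfun_of m H = compose_bfun m (\<lambda>a\<in>cube n. F (\<lambda>i. a ! i)) gs"
      unfolding 1(3) by (rule compose_bfun_of[symmetric]) (use 1 in \<open>auto simp: gs_def mem_def\<close>)
    moreover have "(n, \<lambda>a\<in>cube n. F (\<lambda>i. a ! i)) \<in> C" "length gs = n" "\<forall>g\<in>set gs. (m, g) \<in> J"
      using 1 by (auto simp: mem_def bfun_of_def gs_def)
    ultimately show ?thesis unfolding class_comp_def mem_Collect_eq
      by (intro exI[of _ m] exI[of _ n] exI[of _ "\<lambda>a\<in>cube n. F (\<lambda>i. a ! i)"] exI[of _ gs]) simp
  qed
  ultimately show "mem (class_comp C J) m H" by (simp add: mem_def)
qed

lemma projections_Omega: "projections \<subseteq> Omega"
  by (auto simp: projections_def Omega_def)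

lemma mem_projections: "mem projections n F \<longleftrightarrow> (\<exists>i<n. F = (\<lambda>x. x i))"
proof
  assume F: "mem projections n F"
  then obtain i where "i < n" "bfun_of n F = bfun_of n (\<lambda>x. x i)"
    by (auto simp: mem_def projections_def bfun_of_def)
  then show "\<exists>i<n. F = (\<lambda>x. x i)" using F bfun_of_inject supported_proj mem_def by metis
next
  assume "\<exists>i<n. F = (\<lambda>x. x i)"
  then show "mem projections n F"
    by (auto simp: mem_def supported_proj) (auto simp: projections_def bfun_of_def)
qed

lemma class_comp_Omega: "J \<subseteq> Omega \<Longrightarrow> C \<subseteq> Omega \<Longrightarrow> class_comp C J \<subseteq> Omega"
proof
  fix u assume J: "J \<subseteq> Omega" "C \<subseteq> Omega" and "u \<in> class_comp C J"
  then obtain m n f gs where 1: "u = compose_bfun m f gs" "(n, f) \<in> C" "length gs = n" "\<forall>g\<in>set gs. (m, g) \<in> J"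
    by (auto simp: class_comp_def)
  have "n \<ge> 1" using 1(2) J(2) by (auto simp: Omega_def)
  then have "(m, gs ! 0) \<in> J" using 1(3,4) by auto
  then have "1 \<le> m" using J(1) by (auto simp: Omega_def)
  then show "u \<in> Omega" by (auto simp: 1(1) Omega_def compose_bfun_def)
qed

lemma mem_class_comp_projections:
  assumes "C \<subseteq> Omega"
  shows "mem (class_comp C projections) m H \<longleftrightarrow>
    (\<exists>n F \<sigma>. mem C n F \<and> (\<forall>i<n. \<sigma> i < m) \<and> H = (\<lambda>x. F (\<lambda>i. x (\<sigma> i))))"
proof
  assume "mem (class_comp C projections) m H"
  then obtain n F G where 1: "mem C n F" "\<forall>i<n. \<exists>j<m. G i = (\<lambda>x. x j)" "H = (\<lambda>x. F (\<lambda>i. G i x))"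
    by (auto simp: mem_class_comp[OF assms projections_Omega] mem_projections)
  then obtain \<sigma> where \<sigma>: "\<forall>i<n. \<sigma> i < m \<and> G i = (\<lambda>x. x (\<sigma> i))" by metis
  have "H x = F (\<lambda>i. x (\<sigma> i))" for x
    unfolding 1(3) by (rule supportedD[OF mem_supported[OF 1(1)]]) (use \<sigma> in auto)
  then show "\<exists>n F \<sigma>. mem C n F \<and> (\<forall>i<n. \<sigma> i < m) \<and> H = (\<lambda>x. F (\<lambda>i. x (\<sigma> i)))"
    using 1 \<sigma> by blast
next
  assume "\<exists>n F \<sigma>. mem C n F \<and> (\<forall>i<n. \<sigma> i < m) \<and> H = (\<lambda>x. F (\<lambda>i. x (\<sigma> i)))"
  then obtain n F \<sigma> where 1: "mem C n F" "\<forall>i<n. \<sigma> i < m" "H = (\<lambda>x. F (\<lambda>i. x (\<sigma> i)))" by blast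
  have "\<forall>i<n. mem projections m (\<lambda>x. x (\<sigma> i))" using 1(2) mem_projections by blast
  then show "mem (class_comp C projections) m H"
    unfolding mem_class_comp[OF assms projections_Omega]
    using 1(1,3) by (intro exI[of _ n] exI[of _ F] exI[of _ "\<lambda>i x. x (\<sigma> i)"]) auto
qed

lemma minor_closed_Omega: "minor_closed C \<Longrightarrow> C \<subseteq> Omega"
  by (simp add: minor_closed_def)

lemma minorI:
  "minor_closed C \<Longrightarrow> mem C n F \<Longrightarrow> (\<And>i. i < n \<Longrightarrow> \<sigma> i < m) \<Longrightarrow> mem C m (\<lambda>x. F (\<lambda>i. x (\<sigma> i)))"
  unfolding minor_closed_def by blast

lemma compI:
  "comp_closed C \<Longrightarrow> mem C n F \<Longrightarrow> (\<And>i. i < n \<Longrightarrow> mem C m (G i)) \<Longrightarrow> mem C m (\<lambda>x. F (\<lambda>i. G i x))"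
  unfolding comp_closed_def by blast

lemma equational_class_iff: "equational_class C \<longleftrightarrow> minor_closed C"
proof
  assume C: "equational_class C"
  then have O: "C \<subseteq> Omega" and eq: "class_comp C projections = C" by (auto simp: equational_class_def)
  have "mem C m (\<lambda>x. F (\<lambda>i. x (\<sigma> i)))" if "mem C n F" "\<forall>i<n. \<sigma> i < m" for m n F \<sigma>
    using mem_class_comp_projections[OF O, of m "\<lambda>x. F (\<lambda>i. x (\<sigma> i))", unfolded eq] that by blast
  then show "minor_closed C" using O unfolding minor_closed_def by blast
next
  assume C: "minor_closed C"
  then have O: "C \<subseteq> Omega" by (simp add: minor_closed_def)
  have "class_comp C projections \<subseteq> C"
  proof (rule subset_via_mem[OF class_comp_Omega[OF projections_Omega O]])
    fix m H assume "mem (class_comp C projections) m H"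
    then obtain n F \<sigma> where F: "mem C n F" "\<forall>i<n. \<sigma> i < m" "H = (\<lambda>x. F (\<lambda>i. x (\<sigma> i)))"
      unfolding mem_class_comp_projections[OF O] by blast
    show "mem C m H" unfolding F(3) by (rule minorI[OF C F(1)]) (use F(2) in simp)
  qed
  moreover have "C \<subseteq> class_comp C projections"
  proof (rule subset_via_mem[OF O])
    fix n F assume "mem C n F"
    then show "mem (class_comp C projections) n F"
      unfolding mem_class_comp_projections[OF O]
      by - (rule exI[of _ n], rule exI[of _ F], rule exI[of _ "\<lambda>i. i"], simp)
  qed
  ultimately show "equational_class C" using O by (simp add: equational_class_def)
qed

lemma idempotent_comp_closed:
  assumes "C \<subseteq> Omega" "idempotent_class C"
  shows "comp_closed C"
proof -
  have "mem C m (\<lambda>x. F (\<lambda>i. G i x))" if "mem C n F" "\<forall>i<n. mem C m (G i)" for m n F G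
    using mem_class_comp[OF assms(1) assms(1), of m "\<lambda>x. F (\<lambda>i. G i x)",
        unfolded assms(2)[unfolded idempotent_class_def]] that by blast
  then show ?thesis unfolding comp_closed_def by blast
qed

lemma class_interval_iff:
  "K \<in> class_interval C1 C2 \<longleftrightarrow> minor_closed K \<and> C1 \<subseteq> K \<and> K \<subseteq> C2"
  by (simp add: class_interval_def equational_class_iff)

text \<open>
  If no \<^term>\<open>H i\<close> is a minor of another \<^term>\<open>H j\<close>, the minors of the \<^term>\<open>H i\<close> with
  \<^term>\<open>i \<in> S\<close> can be adjoined to \<^term>\<open>C1\<close> for each set \<^term>\<open>S\<close> of natural numbers separately.
\<close>

lemma antichain_uncountable:
  fixes H :: "nat \<Rightarrow> (nat \<Rightarrow> bool) \<Rightarrow> bool"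
  assumes "minor_closed C1" "minor_closed C2" "C1 \<subseteq> C2"
    and H2: "\<And>i. mem C2 (N i) (H i)" and H1: "\<And>i. \<not> mem C1 (N i) (H i)"
    and anti: "\<And>i j \<sigma>. i \<noteq> j \<Longrightarrow> (\<And>l. l < N j \<Longrightarrow> \<sigma> l < N i) \<Longrightarrow>
       H i = (\<lambda>x. H j (\<lambda>l. x (\<sigma> l))) \<Longrightarrow> False"
  shows "\<not> countable (class_interval C1 C2)"
proof
  assume cnt: "countable (class_interval C1 C2)"
  define K where "K S = C1 \<union> {bfun_of m (\<lambda>x. H i (\<lambda>l. x (\<sigma> l))) | m i \<sigma>. i \<in> S \<and> (\<forall>l<N i. \<sigma> l < m)}" for S
  have O1: "C1 \<subseteq> Omega" and O2: "C2 \<subseteq> Omega" using assms minor_closed_Omega by auto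
  have sup: "supported m (\<lambda>x. H i (\<lambda>l. x (\<sigma> l)))" if "\<forall>l<N i. \<sigma> l < m" for m i \<sigma>
    by (rule supported_comp[where F = "H i" and G = "\<lambda>i x. x (\<sigma> i)"])
      (use H2 mem_supported that supported_proj in auto)
  have memK: "mem (K S) m F \<longleftrightarrow> mem C1 m F \<or>
      (\<exists>i \<sigma>. i \<in> S \<and> (\<forall>l<N i. \<sigma> l < m) \<and> F = (\<lambda>x. H i (\<lambda>l. x (\<sigma> l))))" for S m F
  proof
    assume F: "mem (K S) m F"
    show "mem C1 m F \<or> (\<exists>i \<sigma>. i \<in> S \<and> (\<forall>l<N i. \<sigma> l < m) \<and> F = (\<lambda>x. H i (\<lambda>l. x (\<sigma> l))))"
    proof (cases "mem C1 m F")
      case False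
      then obtain i \<sigma> where "i \<in> S" "\<forall>l<N i. \<sigma> l < m" "bfun_of m F = bfun_of m (\<lambda>x. H i (\<lambda>l. x (\<sigma> l)))"
        using F bfun_of_eq_fst unfolding mem_def K_def by blast
      then show ?thesis using F sup bfun_of_inject mem_supported by metis
    qed simp
  next
    assume "mem C1 m F \<or> (\<exists>i \<sigma>. i \<in> S \<and> (\<forall>l<N i. \<sigma> l < m) \<and> F = (\<lambda>x. H i (\<lambda>l. x (\<sigma> l))))"
    then show "mem (K S) m F"
    proof
      assume "\<exists>i \<sigma>. i \<in> S \<and> (\<forall>l<N i. \<sigma> l < m) \<and> F = (\<lambda>x. H i (\<lambda>l. x (\<sigma> l)))"
      then show ?thesis using sup unfolding mem_def K_def by blast
    qed (simp add: mem_def K_def)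
  qed
  have K: "K S \<in> class_interval C1 C2" for S
  proof -
    have sub: "K S \<subseteq> C2"
    proof -
      have "mem C2 m (\<lambda>x. H i (\<lambda>l. x (\<sigma> l)))" if "\<forall>l<N i. \<sigma> l < m" for m i \<sigma>
        using minorI[OF assms(2) H2] that by blast
      then show ?thesis using assms(3) by (auto simp: K_def mem_def)
    qed
    have "mem (K S) m (\<lambda>x. F (\<lambda>i. x (\<sigma> i)))" if F: "mem (K S) n F" and \<sigma>: "\<forall>i<n. \<sigma> i < m" for m n F \<sigma>
    proof (cases "mem C1 n F")
      case True
      then show ?thesis using minorI[OF assms(1) True] \<sigma> memK by blast
    next
      case False
      then obtain i \<tau> where "i \<in> S" "\<forall>l<N i. \<tau> l < n" "F = (\<lambda>x. H i (\<lambda>l. x (\<tau> l)))"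
        using F memK by blast
      then show ?thesis unfolding memK using \<sigma>
        by (intro disjI2 exI[of _ i] exI[of _ "\<lambda>l. \<sigma> (\<tau> l)"]) auto
    qed
    then have "minor_closed (K S)" using subset_trans[OF sub O2] unfolding minor_closed_def by blast
    then show ?thesis using sub by (auto simp: class_interval_iff K_def)
  qed
  have "countable (range K)" by (rule countable_subset[OF _ cnt]) (use K in auto)
  moreover have "inj K"
  proof (rule injI)
    have sub: "S \<subseteq> S'" if KS: "K S = K S'" for S S'
    proof
      fix i assume "i \<in> S"
      then have "mem (K S) (N i) (H i)" unfolding memK
        by - (rule disjI2, rule exI[of _ i], rule exI[of _ "\<lambda>l. l"], simp)
      then have "mem (K S') (N i) (H i)" using KS by simp
      \<comment> \<open>Membership through \<open>C1\<close> is excluded by \<open>H1\<close>, so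
        \<open>H i\<close> is a minor of some \<open>H j\<close> with \<open>j\<close> in
        \<open>S'\<close>, and the antichain condition forces \<open>i = j\<close>.\<close>
      then obtain j \<sigma> where j: "j \<in> S'" "\<forall>l<N j. \<sigma> l < N i" "H i = (\<lambda>x. H j (\<lambda>l. x (\<sigma> l)))"
        using memK H1 by blast
      then have "i = j" using anti[of i j \<sigma>] by blast
      then show "i \<in> S'" using j(1) by simp
    qed
    show "S = S'" if "K S = K S'" for S S'
      using sub[OF that] sub[OF that[symmetric]] by simp
  qed
  ultimately have "countable (UNIV :: nat set set)" by (rule countable_image_inj_on)
  then have "range (from_nat_into (UNIV :: nat set set)) = UNIV"
    by (intro range_from_nat_into) auto
  then show False using Cantors_theorem[of UNIV] by (metis Pow_UNIV)
qed

section \<open>The classes in functional form, and duality\<close>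

lemma supported_list: "supported n F \<Longrightarrow> F (\<lambda>i. map x [0..<n] ! i) = F x"
  by (erule supportedD) simp

lemma list_in_cube: "map x [0..<n] \<in> cube n"
  by (simp add: cube_def)

lemma mem_Omega: "mem Omega n F \<longleftrightarrow> 1 \<le> n \<and> supported n F"
  by (auto simp: mem_def bfun_of_Omega)

lemma mem_M_class:
  "mem M_class n F \<longleftrightarrow> 1 \<le> n \<and> supported n F \<and> (\<forall>x y. (\<forall>i. x i \<longrightarrow> y i) \<longrightarrow> F x \<longrightarrow> F y)"
proof -
  have 1: "bfun_of n F \<in> M_class \<longleftrightarrow> 1 \<le> n \<and>
      (\<forall>a\<in>cube n. \<forall>b\<in>cube n. list_all2 (\<le>) a b \<longrightarrow> F (\<lambda>i. a ! i) \<longrightarrow> F (\<lambda>i. b ! i))"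
    using bfun_of_Omega[of n F] by (auto simp: M_class_def bfun_of_def)
  have "(\<forall>a\<in>cube n. \<forall>b\<in>cube n. list_all2 (\<le>) a b \<longrightarrow> F (\<lambda>i. a ! i) \<longrightarrow> F (\<lambda>i. b ! i)) \<longleftrightarrow>
      (\<forall>x y. (\<forall>i. x i \<longrightarrow> y i) \<longrightarrow> F x \<longrightarrow> F y)" (is "?L \<longleftrightarrow> ?R") if s: "supported n F"
  proof
    assume L: ?L
    show ?R
    proof (intro allI impI)
      fix x y :: "nat \<Rightarrow> bool" assume "\<forall>i. x i \<longrightarrow> y i" "F x"
      moreover from this have "list_all2 (\<le>) (map x [0..<n]) (map y [0..<n])"
        by (auto simp: list_all2_conv_all_nth)
      ultimately show "F y"
        using L list_in_cube[of x n] list_in_cube[of y n] supported_list[OF s] by metis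
    qed
  next
    assume R: ?R
    show ?L
    proof (intro ballI impI)
      fix a b assume ab: "a \<in> cube n" "b \<in> cube n" "list_all2 (\<le>) a b" "F (\<lambda>i. a ! i)"
      \<comment> \<open>Beyond index \<open>n\<close> the value of \<open>a ! i\<close> is
        unspecified, so both points are cut off to False there before they are compared.\<close>
      have "F (\<lambda>i. i < n \<and> a ! i)" using ab(4) supportedD[OF s, of "\<lambda>i. a ! i" "\<lambda>i. i < n \<and> a ! i"] by simp
      then have "F (\<lambda>i. i < n \<and> b ! i)"
        by (rule R[rule_format, rotated]) (use ab in \<open>auto simp: list_all2_conv_all_nth cube_def\<close>)
      then show "F (\<lambda>i. b ! i)" using supportedD[OF s, of "\<lambda>i. b ! i" "\<lambda>i. i < n \<and> b ! i"] by simp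
    qed
  qed
  then show ?thesis using 1 by (auto simp: mem_def)
qed

lemma mem_Tc_class:
  "mem Tc_class n F \<longleftrightarrow> 1 \<le> n \<and> supported n F \<and> \<not> F (\<lambda>i. False) \<and> F (\<lambda>i. True)"
proof -
  have "F (\<lambda>i. replicate n c ! i) = F (\<lambda>i. c)" if "supported n F" for c
    by (rule supportedD[OF that]) simp
  moreover have "replicate n c \<in> cube n" for c by (simp add: cube_def)
  moreover have "bfun_of n F \<in> Tc_class \<longleftrightarrow> 1 \<le> n \<and>
      \<not> (\<lambda>a\<in>cube n. F (\<lambda>i. a ! i)) (replicate n False) \<and> (\<lambda>a\<in>cube n. F (\<lambda>i. a ! i)) (replicate n True)"
    using bfun_of_Omega[of n F] by (auto simp: Tc_class_def T0_class_def T1_class_def bfun_of_def)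
  ultimately show ?thesis unfolding mem_def by (metis restrict_apply')
qed

lemma mem_Int: "mem (A \<inter> B) n F \<longleftrightarrow> mem A n F \<and> mem B n F"
  by (auto simp: mem_def)

lemma mem_Un: "mem (A \<union> B) n F \<longleftrightarrow> mem A n F \<or> mem B n F"
  by (auto simp: mem_def)

lemma mem_Mc_class: "mem Mc_class n F \<longleftrightarrow> mem M_class n F \<and> mem Tc_class n F"
  by (auto simp: Mc_class_def mem_Int)

lemma M_class_Omega: "M_class \<subseteq> Omega"
  by (auto simp: M_class_def)

lemma subset_iff_mem: "C \<subseteq> Omega \<Longrightarrow> C \<subseteq> D \<longleftrightarrow> (\<forall>n F. mem C n F \<longrightarrow> mem D n F)"
  using mem_mono subset_via_mem by metis

lemma mem_explicit:
  assumes "\<And>n G. P n G \<Longrightarrow> supported n G"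
  shows "mem {bfun_of n G | n G. P n G} n F \<longleftrightarrow> P n F"
proof
  assume "mem {bfun_of n G | n G. P n G} n F"
  then obtain m G where mG: "supported n F" "bfun_of n F = bfun_of m G" "P m G" by (auto simp: mem_def)
  then have "m = n" using bfun_of_eq_fst by metis
  then show "P n F" using mG assms bfun_of_inject by metis
qed (use assms in \<open>auto simp: mem_def\<close>)

lemma mem_constant_functions:
  "mem constant_functions n F \<longleftrightarrow> 1 \<le> n \<and> (\<exists>c. F = (\<lambda>x. c))"
proof -
  have "constant_functions = {bfun_of n G | n G. \<exists>c. 1 \<le> n \<and> G = (\<lambda>x. c)}"
    unfolding constant_functions_def bfun_of_def by (auto, rule_tac x = "\<lambda>x. c" in exI, auto)
  moreover have "mem \<dots> n F \<longleftrightarrow> (\<exists>c. 1 \<le> n \<and> F = (\<lambda>x. c))"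
    by (rule mem_explicit) (auto simp: supported_def)
  ultimately show ?thesis by simp
qed

lemma mem_V_class:
  "mem V_class n F \<longleftrightarrow> 1 \<le> n \<and> ((\<exists>c. F = (\<lambda>x. c)) \<or>
     (\<exists>I. I \<subseteq> {..<n} \<and> I \<noteq> {} \<and> F = (\<lambda>x. \<exists>i\<in>I. x i)))"
proof -
  have "{(n, \<lambda>a\<in>cube n. \<exists>i\<in>I. a ! i) | n I. I \<subseteq> {..<n} \<and> I \<noteq> {}} =
      {bfun_of n G | n G. \<exists>I. I \<subseteq> {..<n} \<and> I \<noteq> {} \<and> G = (\<lambda>x. \<exists>i\<in>I. x i)}" (is "?S = ?T")
    unfolding bfun_of_def by blast
  moreover have "mem ?T n F \<longleftrightarrow> (\<exists>I. I \<subseteq> {..<n} \<and> I \<noteq> {} \<and> F = (\<lambda>x. \<exists>i\<in>I. x i))"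
    by (rule mem_explicit) (auto simp: supported_def)
  moreover have "1 \<le> n" if "I \<subseteq> {..<n}" "I \<noteq> {}" for I using that by (cases n) auto
  ultimately show ?thesis unfolding V_class_def mem_Un mem_constant_functions by auto
qed

lemma mem_Lambda_class:
  "mem Lambda_class n F \<longleftrightarrow> 1 \<le> n \<and> ((\<exists>c. F = (\<lambda>x. c)) \<or>
     (\<exists>I. I \<subseteq> {..<n} \<and> I \<noteq> {} \<and> F = (\<lambda>x. \<forall>i\<in>I. x i)))"
proof -
  have "{(n, \<lambda>a\<in>cube n. \<forall>i\<in>I. a ! i) | n I. I \<subseteq> {..<n} \<and> I \<noteq> {}} =
      {bfun_of n G | n G. \<exists>I. I \<subseteq> {..<n} \<and> I \<noteq> {} \<and> G = (\<lambda>x. \<forall>i\<in>I. x i)}" (is "?S = ?T")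
    unfolding bfun_of_def by blast
  moreover have "mem ?T n F \<longleftrightarrow> (\<exists>I. I \<subseteq> {..<n} \<and> I \<noteq> {} \<and> F = (\<lambda>x. \<forall>i\<in>I. x i))"
    by (rule mem_explicit) (auto simp: supported_def)
  moreover have "1 \<le> n" if "I \<subseteq> {..<n}" "I \<noteq> {}" for I using that by (cases n) auto
  ultimately show ?thesis unfolding Lambda_class_def mem_Un mem_constant_functions by auto
qed

lemma supported_parity: "I \<subseteq> {..<n} \<Longrightarrow> supported n (\<lambda>x. c \<noteq> odd (card {i \<in> I. x i}))"
  unfolding supported_def
proof (intro allI impI)
  fix x y :: "nat \<Rightarrow> bool" assume "I \<subseteq> {..<n}" "\<forall>i<n. x i = y i"
  then have "{i \<in> I. x i} = {i \<in> I. y i}" by auto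
  then show "(c \<noteq> odd (card {i \<in> I. x i})) = (c \<noteq> odd (card {i \<in> I. y i}))" by simp
qed

lemma mem_L_class:
  "mem L_class n F \<longleftrightarrow> 1 \<le> n \<and> (\<exists>c I. I \<subseteq> {..<n} \<and> F = (\<lambda>x. c \<noteq> odd (card {i \<in> I. x i})))"
proof -
  have ob: "(of_bool b = (c0 + m) mod 2) \<longleftrightarrow> b = ((c0 = 1) \<noteq> odd m)" if "c0 \<in> {0, 1}" for b and c0 m :: nat
    using that by (auto simp: mod2_eq_if)
  have "L_class = {bfun_of n G | n G. 1 \<le> n \<and> (\<exists>c I. I \<subseteq> {..<n} \<and> G = (\<lambda>x. c \<noteq> odd (card {i \<in> I. x i})))}"
    (is "_ = ?R")
  proof (intro equalityI subsetI)
    fix u assume "u \<in> L_class"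
    then obtain n f c0 c where u: "u = (n, f)" "u \<in> Omega" "c0 \<in> {0, 1 :: nat}" "\<forall>i. c i \<in> {0, 1 :: nat}"
      "\<And>a. a \<in> cube n \<Longrightarrow> of_bool (f a) = (c0 + (\<Sum>i<n. c i * of_bool (a ! i))) mod 2"
      unfolding L_class_def by blast
    define I where "I = {i. i < n \<and> c i = 1}"
    have "(\<Sum>i<n. c i * of_bool (a ! i)) = card {i \<in> I. a ! i}" for a
    proof -
      have "(\<Sum>i<n. c i * of_bool (a ! i)) = (\<Sum>i<n. of_bool (c i = 1 \<and> a ! i))"
      proof (rule sum.cong[OF refl])
        fix i show "c i * of_bool (a ! i) = of_bool (c i = 1 \<and> a ! i)" using u(4)[rule_format, of i] by auto
      qed
      also have "\<dots> = card {i \<in> I. a ! i}" unfolding I_def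
        by (simp add: of_bool_def sum.If_cases) (intro arg_cong[where f = card], auto)
      finally show ?thesis .
    qed
    then have f: "f a = ((c0 = 1) \<noteq> odd (card {i \<in> I. a ! i}))" if "a \<in> cube n" for a
      using u(5)[OF that] ob[OF u(3)] by simp
    have "f = (\<lambda>a\<in>cube n. (c0 = 1) \<noteq> odd (card {i \<in> I. a ! i}))"
      by (rule extensionalityI[of _ "cube n"]) (use f u(1,2) in \<open>auto simp: Omega_def PiE_def\<close>)
    then have "u = bfun_of n (\<lambda>x. (c0 = 1) \<noteq> odd (card {i \<in> I. x i}))" using u(1) by (simp add: bfun_of_def)
    moreover have "1 \<le> n" using u(1,2) by (auto simp: Omega_def)
    moreover have "I \<subseteq> {..<n}" by (auto simp: I_def)
    ultimately show "u \<in> ?R" by blast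
  next
    fix u assume "u \<in> ?R"
    then obtain n c I where u: "1 \<le> n" "I \<subseteq> {..<n}" "u = bfun_of n (\<lambda>x. c \<noteq> odd (card {i \<in> I. x i}))"
      by blast
    define c0 :: nat where "c0 = of_bool c"
    define d :: "nat \<Rightarrow> nat" where "d i = of_bool (i \<in> I)" for i
    have "of_bool (c \<noteq> odd (card {i \<in> I. a ! i})) = (c0 + (\<Sum>i<n. d i * of_bool (a ! i))) mod 2" for a
    proof -
      have "(\<Sum>i<n. d i * of_bool (a ! i)) = (\<Sum>i<n. of_bool (i \<in> I \<and> a ! i))"
        by (rule sum.cong) (auto simp: d_def)
      also have "\<dots> = card {i \<in> I. a ! i}" using u(2)
        by (simp add: of_bool_def sum.If_cases) (intro arg_cong[where f = card], auto)
      finally have s: "(\<Sum>i<n. d i * of_bool (a ! i)) = card {i \<in> I. a ! i}" .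
      have "c0 \<in> {0, 1}" "(c0 = 1) = c" by (auto simp: c0_def)
      then show ?thesis unfolding s using ob[of c0 "c \<noteq> odd (card {i \<in> I. a ! i})" "card {i \<in> I. a ! i}"] by simp
    qed
    moreover have "c0 \<in> {0, 1}" "\<forall>i. d i \<in> {0, 1}" by (auto simp: c0_def d_def)
    moreover have "u \<in> Omega" using u bfun_of_Omega by blast
    ultimately show "u \<in> L_class" unfolding L_class_def u(3) bfun_of_def
      by (auto intro!: exI[of _ c0] exI[of _ d])
  qed
  moreover have "mem \<dots> n F \<longleftrightarrow> 1 \<le> n \<and> (\<exists>c I. I \<subseteq> {..<n} \<and> F = (\<lambda>x. c \<noteq> odd (card {i \<in> I. x i})))"
    by (rule mem_explicit) (use supported_parity in auto)
  ultimately show ?thesis by simp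
qed

text \<open>Sets of sequences can be infinite and then have \<open>card\<close> 0, hence the
  condition \<open>finite S\<close>; subsets of the cube are always finite.\<close>

lemma mem_separating:
  "mem (separating_of_rank c k) n F \<longleftrightarrow> 1 \<le> n \<and> supported n F \<and>
     (\<forall>S. finite S \<longrightarrow> card S \<le> k \<longrightarrow> (\<forall>x\<in>S. F x = c) \<longrightarrow> (\<exists>i<n. \<forall>x\<in>S. x i = c))"
proof -
  have 1: "bfun_of n F \<in> separating_of_rank c k \<longleftrightarrow> 1 \<le> n \<and>
     (\<forall>B. B \<subseteq> {b \<in> cube n. F (\<lambda>i. b ! i) = c} \<and> card B \<le> k \<longrightarrow> separating_set c n B)"
  proof -
    have "{b \<in> cube n. (\<lambda>a\<in>cube n. F (\<lambda>i. a ! i)) b = c} = {b \<in> cube n. F (\<lambda>i. b ! i) = c}" by auto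
    then show ?thesis
      using bfun_of_Omega[of n F] by (auto simp: separating_of_rank_def bfun_of_def)
  qed
  have fin: "finite (cube n)"
  proof -
    have "cube n = {xs. set xs \<subseteq> UNIV \<and> length xs = n}" by (auto simp: cube_def)
    then show ?thesis using finite_lists_length_eq[of "UNIV :: bool set" n] by simp
  qed
  have "(\<forall>B. B \<subseteq> {b \<in> cube n. F (\<lambda>i. b ! i) = c} \<and> card B \<le> k \<longrightarrow> separating_set c n B) \<longleftrightarrow>
     (\<forall>S. finite S \<longrightarrow> card S \<le> k \<longrightarrow> (\<forall>x\<in>S. F x = c) \<longrightarrow> (\<exists>i<n. \<forall>x\<in>S. x i = c))" (is "?L \<longleftrightarrow> ?R")
    if s: "supported n F"
  proof
    assume L: ?L
    show ?R
    proof (intro allI impI)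
      fix S :: "(nat \<Rightarrow> bool) set" assume S: "finite S" "card S \<le> k" "\<forall>x\<in>S. F x = c"
      define B where "B = (\<lambda>x. map x [0..<n]) ` S"
      have "B \<subseteq> {b \<in> cube n. F (\<lambda>i. b ! i) = c}"
        using S(3) supported_list[OF s] by (auto simp: B_def list_in_cube)
      moreover have "card B \<le> k" unfolding B_def using card_image_le[OF S(1)] S(2) le_trans by blast
      ultimately have "separating_set c n B" using L by blast
      then show "\<exists>i<n. \<forall>x\<in>S. x i = c" by (auto simp: separating_set_def B_def)
    qed
  next
    assume R: ?R
    show ?L
    proof (intro allI impI)
      fix B assume B: "B \<subseteq> {b \<in> cube n. F (\<lambda>i. b ! i) = c} \<and> card B \<le> k"
      then have f: "finite B" by (auto intro: finite_subset[OF _ fin])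
      let ?S = "(\<lambda>b i. b ! i) ` B"
      have "card ?S \<le> k" using card_image_le[OF f] B le_trans by blast
      then have "\<exists>i<n. \<forall>x\<in>?S. x i = c" using R[rule_format, of ?S] f B by auto
      then show "separating_set c n B" by (auto simp: separating_set_def)
    qed
  qed
  then show ?thesis using 1 by (auto simp: mem_def)
qed

lemma comp1:
  assumes "comp_closed C" "mem C 1 (\<lambda>x. f (x 0))" "mem C n F"
  shows "mem C n (\<lambda>x. f (F x))"
  using compI[OF assms(1,2), of n "\<lambda>i. F"] assms(3) by simp

lemma comp2:
  assumes "comp_closed C" "mem C 2 (\<lambda>x. f (x 0) (x 1))" "mem C n F" "mem C n G"
  shows "mem C n (\<lambda>x. f (F x) (G x))"
  using compI[OF assms(1,2), of n "\<lambda>i. if i = 0 then F else G"] assms(3,4) by simp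

lemma comp3:
  assumes "comp_closed C" "mem C 3 (\<lambda>x. f (x 0) (x 1) (x 2))" "mem C n F" "mem C n G" "mem C n H"
  shows "mem C n (\<lambda>x. f (F x) (G x) (H x))"
  using compI[OF assms(1,2), of n "\<lambda>i. if i = 0 then F else if i = 1 then G else H"] assms(3-) by simp

text \<open>The substituted point is an arbitrary term \<open>y z\<close>, so points given by case
  distinctions on \<open>i\<close> need not first be rewritten into the shape
  \<open>z (\<sigma> i)\<close>.\<close>

lemma minor_renameI:
  assumes "minor_closed C" "mem C n F" "\<And>i. i < n \<Longrightarrow> \<sigma> i < m" "\<And>z i. y z i = z (\<sigma> i)"
  shows "mem C m (\<lambda>z. F (y z))"
proof -
  have "y = (\<lambda>z i. z (\<sigma> i))" using assms(4) by (simp add: fun_eq_iff)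
  then show ?thesis using minorI[OF assms(1-3)] by simp
qed

lemma minor2:
  assumes "minor_closed C" "mem C n F"
  shows "mem C 2 (\<lambda>z. F (\<lambda>i. if P i then z 0 else z 1))"
  by (rule minor_renameI[OF assms, of "\<lambda>i. if P i then 0 else 1"]) auto

lemma minor3:
  assumes "minor_closed C" "mem C n F"
  shows "mem C 3 (\<lambda>z. F (\<lambda>i. if P i then z 0 else if Q i then z 1 else z 2))"
  by (rule minor_renameI[OF assms, of "\<lambda>i. if P i then 0 else if Q i then 1 else 2"]) auto

lemma mem_diag:
  assumes "minor_closed C" "mem C n F" "j < m"
  shows "mem C m (\<lambda>z. F (\<lambda>_. z j))"
  using minorI[OF assms(1,2), of "\<lambda>_. j" m] assms(3) by simp

lemma mem_const_diag:
  assumes "minor_closed C" "mem C n F" "F (\<lambda>_. False) = c" "F (\<lambda>_. True) = c" "1 \<le> m"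
  shows "mem C m (\<lambda>_. c)"
proof -
  have eq: "(\<lambda>z. F (\<lambda>_. z 0)) = (\<lambda>_. c)" using assms(3,4) by (auto simp: fun_eq_iff) (metis (full_types))+
  have "mem C m (\<lambda>z. F (\<lambda>_. z 0))" using mem_diag[OF assms(1,2), of 0 m] assms(5) by simp
  then show ?thesis by (rule back_subst[of "mem C m", OF _ eq])
qed

section \<open>Duality\<close>

definition dual_op :: "((nat \<Rightarrow> bool) \<Rightarrow> bool) \<Rightarrow> (nat \<Rightarrow> bool) \<Rightarrow> bool" where
  "dual_op F = (\<lambda>x. \<not> F (\<lambda>i. \<not> x i))"

definition dual :: "bfun set \<Rightarrow> bfun set" where
  "dual C = {bfun_of n F | n F. mem C n (dual_op F)}"

lemma dual_op_dual_op [simp]: "dual_op (dual_op F) = F"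
  by (simp add: dual_op_def)

lemma supported_dual_op [simp]: "supported n (dual_op F) = supported n F"
proof -
  have "supported n (dual_op F)" if "supported n F" for F
    using that unfolding supported_def dual_op_def by simp
  from this[of F] this[of "dual_op F"] show ?thesis by auto
qed

lemma mem_dual: "mem (dual C) n F \<longleftrightarrow> mem C n (dual_op F)"
  unfolding dual_def by (rule mem_explicit) (metis mem_supported supported_dual_op)

lemma dual_Omega: "C \<subseteq> Omega \<Longrightarrow> dual C \<subseteq> Omega"
  unfolding dual_def using mem_pos bfun_of_Omega by auto

lemma dual_subset_iff: "C \<subseteq> Omega \<Longrightarrow> dual C \<subseteq> D \<longleftrightarrow> (\<forall>n F. mem C n F \<longrightarrow> mem D n (dual_op F))"
proof
  assume C: "C \<subseteq> Omega" and "dual C \<subseteq> D"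
  then show "\<forall>n F. mem C n F \<longrightarrow> mem D n (dual_op F)"
    using mem_mono[of "dual C" D] mem_dual[of C] by simp
next
  assume C: "C \<subseteq> Omega" and "\<forall>n F. mem C n F \<longrightarrow> mem D n (dual_op F)"
  then show "dual C \<subseteq> D"
    using subset_via_mem[OF dual_Omega[OF C]] by (metis dual_op_dual_op mem_dual)
qed

lemma dual_mono: "C \<subseteq> D \<Longrightarrow> dual C \<subseteq> dual D"
  unfolding dual_def using mem_mono[of C D] by blast

lemma dual_dual: "C \<subseteq> Omega \<Longrightarrow> dual (dual C) = C"
proof
  assume C: "C \<subseteq> Omega"
  show "dual (dual C) \<subseteq> C"
    by (rule subset_via_mem[OF dual_Omega[OF dual_Omega[OF C]]]) (simp add: mem_dual)
  show "C \<subseteq> dual (dual C)"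
    by (rule subset_via_mem[OF C]) (simp add: mem_dual)
qed

lemma minor_closed_dual:
  assumes "minor_closed C" shows "minor_closed (dual C)"
proof -
  have "mem (dual C) m (\<lambda>x. F (\<lambda>i. x (\<sigma> i)))" if "mem (dual C) n F" "\<forall>i<n. \<sigma> i < m" for m n F \<sigma>
    using minorI[OF assms, of n "dual_op F" \<sigma> m] that unfolding mem_dual by (simp add: dual_op_def)
  then show ?thesis using dual_Omega minor_closed_Omega[OF assms] unfolding minor_closed_def by blast
qed

lemma comp_closed_dual:
  assumes "comp_closed C" shows "comp_closed (dual C)"
proof -
  have "mem (dual C) m (\<lambda>x. F (\<lambda>i. G i x))" if "mem (dual C) n F" "\<forall>i<n. mem (dual C) m (G i)" for m n F G
    using compI[OF assms, of n "dual_op F" m "\<lambda>i. dual_op (G i)"] that unfolding mem_dual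
    by (simp add: dual_op_def)
  then show ?thesis unfolding comp_closed_def by blast
qed

lemma countable_interval_dual:
  assumes "minor_closed C1" "minor_closed C2" "countable (class_interval C1 C2)"
  shows "countable (class_interval (dual C1) (dual C2))"
proof (rule countable_subset)
  show "countable (dual ` class_interval C1 C2)" using assms(3) by simp
  show "class_interval (dual C1) (dual C2) \<subseteq> dual ` class_interval C1 C2"
  proof
    fix K assume "K \<in> class_interval (dual C1) (dual C2)"
    then have K: "minor_closed K" "dual C1 \<subseteq> K" "K \<subseteq> dual C2" by (auto simp: class_interval_iff)
    then have "C1 \<subseteq> dual K" "dual K \<subseteq> C2"
      using dual_mono[of "dual C1" K] dual_mono[of K "dual C2"] assms(1,2) minor_closed_Omega dual_dual by auto
    then have "dual K \<in> class_interval C1 C2" using minor_closed_dual K(1) by (simp add: class_interval_iff)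
    moreover have "K = dual (dual K)" using dual_dual minor_closed_Omega K(1) by simp
    ultimately show "K \<in> dual ` class_interval C1 C2" by blast
  qed
qed

lemma dual_op_eq_iff: "dual_op F = G \<longleftrightarrow> F = dual_op G"
  by (metis dual_op_dual_op)

lemma mem_Lambda_dual_op: "mem Lambda_class n (dual_op F) \<longleftrightarrow> mem V_class n F"
proof -
  have "(\<exists>c. dual_op F = (\<lambda>x. c)) \<longleftrightarrow> (\<exists>c. F = (\<lambda>x. c))"
    unfolding dual_op_eq_iff by (auto simp: dual_op_def intro: exI[of _ "\<not> _"])
  moreover have "dual_op F = (\<lambda>x. \<forall>i\<in>I. x i) \<longleftrightarrow> F = (\<lambda>x. \<exists>i\<in>I. x i)" for I
    unfolding dual_op_eq_iff by (simp add: dual_op_def)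
  ultimately show ?thesis unfolding mem_V_class mem_Lambda_class by simp
qed

lemma dual_subset_Lambda_iff: "C \<subseteq> Omega \<Longrightarrow> dual C \<subseteq> Lambda_class \<longleftrightarrow> C \<subseteq> V_class"
  by (simp add: dual_subset_iff mem_Lambda_dual_op subset_iff_mem)

lemma dual_subset_V_iff: "C \<subseteq> Omega \<Longrightarrow> dual C \<subseteq> V_class \<longleftrightarrow> C \<subseteq> Lambda_class"
  using dual_subset_Lambda_iff[of "dual C"] dual_dual dual_Omega by simp

lemma mem_M_dual_op: "mem M_class n (dual_op F) \<longleftrightarrow> mem M_class n F"
proof -
  have "mem M_class n (dual_op F)" if "mem M_class n F" for F
  proof -
    have "dual_op F x \<longrightarrow> dual_op F y" if "\<forall>i. x i \<longrightarrow> y i" for x y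
    proof -
      have "F (\<lambda>i. \<not> y i) \<longrightarrow> F (\<lambda>i. \<not> x i)"
        using \<open>mem M_class n F\<close> that unfolding mem_M_class
        by (elim conjE allE[of _ "\<lambda>i. \<not> y i"] allE[of _ "\<lambda>i. \<not> x i"]) blast
      then show ?thesis by (auto simp: dual_op_def)
    qed
    then show ?thesis using that unfolding mem_M_class by simp
  qed
  from this[of F] this[of "dual_op F"] show ?thesis by auto
qed

lemma mem_Mc_dual_op: "mem Mc_class n (dual_op F) \<longleftrightarrow> mem Mc_class n F"
  unfolding mem_Mc_class mem_M_dual_op mem_Tc_class supported_dual_op by (auto simp: dual_op_def)

lemma mem_separating_dual_op:
  "mem (separating_of_rank c k) n (dual_op F) \<longleftrightarrow> mem (separating_of_rank (\<not> c) k) n F"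
proof -
  have "mem (separating_of_rank c k) n (dual_op F)" if F: "mem (separating_of_rank (\<not> c) k) n F" for c F
    unfolding mem_separating
  proof (intro conjI allI impI)
    show "1 \<le> n" "supported n (dual_op F)" using F by (auto simp: mem_separating)
    fix S :: "(nat \<Rightarrow> bool) set" assume S: "finite S" "card S \<le> k" "\<forall>x\<in>S. dual_op F x = c"
    let ?S = "(\<lambda>x i. \<not> x i) ` S"
    have "card ?S \<le> k" using card_image_le[OF S(1)] S(2) le_trans by blast
    moreover have "\<forall>x\<in>?S. F x = (\<not> c)" using S(3) by (auto simp: dual_op_def)
    ultimately have "\<exists>i<n. \<forall>x\<in>?S. x i = (\<not> c)" using F S(1) unfolding mem_separating by blast
    then show "\<exists>i<n. \<forall>x\<in>S. x i = c" by auto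
  qed
  from this[where F = F and c = c] this[where F = "dual_op F" and c = "\<not> c"] show ?thesis by auto
qed

section \<open>Countable intervals\<close>

lemma countable_down_sets: "countable {S :: nat set. \<forall>k. Suc k \<in> S \<longrightarrow> k \<in> S}"
proof (rule countable_subset)
  show "{S :: nat set. \<forall>k. Suc k \<in> S \<longrightarrow> k \<in> S} \<subseteq> insert UNIV (range lessThan)"
  proof
    fix S :: "nat set" assume "S \<in> {S. \<forall>k. Suc k \<in> S \<longrightarrow> k \<in> S}"
    then have S: "Suc k \<in> S \<Longrightarrow> k \<in> S" for k by auto
    have down: "j \<in> S" if "k \<in> S" "j \<le> k" for j k
      using that(2,1) by (induction rule: dec_induct) (auto dest: S)
    show "S \<in> insert UNIV (range lessThan)"
    proof (cases "S = UNIV")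
      case False
      then obtain k where k: "k \<notin> S" by auto
      define m where "m = (LEAST k. k \<notin> S)"
      have m: "m \<notin> S" unfolding m_def by (rule LeastI[of "\<lambda>k. k \<notin> S", OF k])
      have lt: "j \<in> S" if "j < m" for j using not_less_Least[OF that[unfolded m_def]] by simp
      have "j < m" if "j \<in> S" for j using down[OF that, of m] m by (cases "m \<le> j") auto
      then have "S = {..<m}" using lt by (intro equalityI subsetI) simp_all
      then show ?thesis by blast
    qed simp
  qed
qed simp

text \<open>Even and odd elements are treated separately; halving them turns the step 2 into the
  step 1.\<close>

lemma countable_down2_sets: "countable {S :: nat set. \<forall>k. k + 2 \<in> S \<longrightarrow> k \<in> S}"
proof (rule countable_subset)
  let ?D = "{S :: nat set. \<forall>k. Suc k \<in> S \<longrightarrow> k \<in> S}"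
  let ?f = "\<lambda>(A, B). {k :: nat. if even k then k div 2 \<in> A else k div 2 \<in> B}"
  show "countable (?f ` (?D \<times> ?D))" using countable_down_sets by (intro countable_image countable_SIGMA) auto
  show "{S :: nat set. \<forall>k. k + 2 \<in> S \<longrightarrow> k \<in> S} \<subseteq> ?f ` (?D \<times> ?D)"
  proof
    fix S :: "nat set" assume "S \<in> {S. \<forall>k. k + 2 \<in> S \<longrightarrow> k \<in> S}"
    then have S: "k + 2 \<in> S \<Longrightarrow> k \<in> S" for k by auto
    let ?A = "{k. 2 * k \<in> S}" and ?B = "{k. 2 * k + 1 \<in> S}"
    have "?A \<in> ?D" "?B \<in> ?D" using S[of "2 * _"] S[of "2 * _ + 1"] by auto
    moreover have "S = ?f (?A, ?B)"
    proof -
      have "k \<in> S \<longleftrightarrow> k \<in> ?f (?A, ?B)" for k by (cases "even k") simp_all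
      then show ?thesis by (rule set_eqI)
    qed
    ultimately show "S \<in> ?f ` (?D \<times> ?D)" by blast
  qed
qed

text \<open>The \<open>E j k\<close> are normal forms: by \<open>rep\<close> each member of
  \<open>C2\<close> and some \<open>E j k\<close> are minors of each other, so a class is determined
  by the normal forms that it contains. Three families serve the two constants and the disjunctions;
  the arity \<open>k + 1\<close> is positive even for \<open>k = 0\<close>.\<close>

lemma countable_interval_by_traces:
  fixes E :: "nat \<Rightarrow> nat \<Rightarrow> (nat \<Rightarrow> bool) \<Rightarrow> bool"
  assumes step: "\<And>j k. \<exists>\<sigma>. (\<forall>l<k + 3. \<sigma> l < k + 1) \<and> E j k = (\<lambda>x. E j (k + 2) (\<lambda>l. x (\<sigma> l)))"
    and rep: "\<And>n F. mem C2 n F \<Longrightarrow> \<exists>j<3. \<exists>k \<sigma> \<tau>. (\<forall>l<k + 1. \<sigma> l < n) \<and> (\<forall>l<n. \<tau> l < k + 1) \<and>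
       F = (\<lambda>x. E j k (\<lambda>l. x (\<sigma> l))) \<and> E j k = (\<lambda>x. F (\<lambda>l. x (\<tau> l)))"
  shows "countable (class_interval C1 C2)"
proof -
  define T where "T j K = {k. mem K (k + 1) (E j k)}" for j K
  let ?D = "{S :: nat set. \<forall>k. k + 2 \<in> S \<longrightarrow> k \<in> S}"
  have down: "T j K \<in> ?D" if "K \<in> class_interval C1 C2" for j K
  proof -
    have K: "minor_closed K" using that class_interval_iff by blast
    have "mem K (k + 1) (E j k)" if k: "mem K (k + 3) (E j (k + 2))" for k
    proof -
      obtain \<sigma> where \<sigma>: "\<forall>l<k + 3. \<sigma> l < k + 1" "E j k = (\<lambda>x. E j (k + 2) (\<lambda>l. x (\<sigma> l)))"
        using step by blast
      show ?thesis unfolding \<sigma>(2) by (rule minorI[OF K k]) (use \<sigma>(1) in simp)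
    qed
    then show ?thesis by (simp add: T_def numeral_eq_Suc)
  qed
  have char: "mem K' n F" if "K \<in> class_interval C1 C2" "K' \<in> class_interval C1 C2"
    and T: "\<And>j. j < 3 \<Longrightarrow> T j K = T j K'" and F: "mem K n F" for K K' n F
  proof -
    have K: "minor_closed K" "minor_closed K'" "K \<subseteq> C2" using that(1,2) class_interval_iff by blast+
    obtain j k \<sigma> \<tau> where r: "j < 3" "\<forall>l<k + 1. \<sigma> l < n" "\<forall>l<n. \<tau> l < k + 1"
       "F = (\<lambda>x. E j k (\<lambda>l. x (\<sigma> l)))" "E j k = (\<lambda>x. F (\<lambda>l. x (\<tau> l)))"
      using rep[OF mem_mono[OF K(3) F]] by blast
    have "mem K (k + 1) (E j k)" unfolding r(5) by (rule minorI[OF K(1) F]) (use r(3) in simp)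
    then have "mem K' (k + 1) (E j k)" using T[OF r(1)] by (auto simp: T_def)
    then show ?thesis unfolding r(4) by (rule minorI[OF K(2)]) (use r(2) in simp)
  qed
  have "inj_on (\<lambda>K. (T 0 K, T 1 K, T 2 K)) (class_interval C1 C2)"
  proof (rule inj_onI)
    fix K K' assume K: "K \<in> class_interval C1 C2" "K' \<in> class_interval C1 C2"
      and "(T 0 K, T 1 K, T 2 K) = (T 0 K', T 1 K', T 2 K')"
    then have T: "T j K = T j K'" if "j < 3" for j
      using that by (auto simp: numeral_eq_Suc less_Suc_eq)
    show "K = K'"
    proof
      have O: "K \<subseteq> Omega" "K' \<subseteq> Omega" using K minor_closed_Omega by (auto simp: class_interval_iff)
      show "K \<subseteq> K'" by (rule subset_via_mem[OF O(1)]) (rule char[OF K T])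
      show "K' \<subseteq> K" by (rule subset_via_mem[OF O(2)]) (rule char[OF K(2,1) T[symmetric]])
    qed
  qed
  moreover have "countable ((\<lambda>K. (T 0 K, T 1 K, T 2 K)) ` class_interval C1 C2)"
  proof (rule countable_subset)
    show "countable (?D \<times> ?D \<times> ?D)" using countable_down2_sets by (intro countable_SIGMA) auto
    show "(\<lambda>K. (T 0 K, T 1 K, T 2 K)) ` class_interval C1 C2 \<subseteq> ?D \<times> ?D \<times> ?D"
      using down by blast
  qed
  ultimately show ?thesis using countable_image_inj_on by blast
qed

lemma countable_interval_V:
  assumes "C2 \<subseteq> V_class"
  shows "countable (class_interval C1 C2)"
proof -
  define E :: "nat \<Rightarrow> nat \<Rightarrow> (nat \<Rightarrow> bool) \<Rightarrow> bool" where
    "E j k x = (if j = 0 then False else if j = 1 then True else \<exists>i\<le>k. x i)" for j k x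
  show ?thesis
  proof (rule countable_interval_by_traces[of E])
    fix j k
    have "(\<exists>i\<le>k. x i) = (\<exists>i\<le>k + 2. x (min i k))" for x :: "nat \<Rightarrow> bool"
      by (metis le_add1 min.absorb1 min.cobounded2 order_trans)
    then have "E j k = (\<lambda>x. E j (k + 2) (\<lambda>l. x (min l k)))" by (auto simp: E_def fun_eq_iff)
    then show "\<exists>\<sigma>. (\<forall>l<k + 3. \<sigma> l < k + 1) \<and> E j k = (\<lambda>x. E j (k + 2) (\<lambda>l. x (\<sigma> l)))"
      by (intro exI[of _ "\<lambda>l. min l k"]) auto
  next
    fix n F assume "mem C2 n F"
    then have "mem V_class n F" using assms mem_mono by blast
    then have n: "1 \<le> n" and F: "(\<exists>c. F = (\<lambda>x. c)) \<or>
       (\<exists>I. I \<subseteq> {..<n} \<and> I \<noteq> {} \<and> F = (\<lambda>x. \<exists>i\<in>I. x i))" unfolding mem_V_class by blast+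
    show "\<exists>j<3. \<exists>k \<sigma> \<tau>. (\<forall>l<k + 1. \<sigma> l < n) \<and> (\<forall>l<n. \<tau> l < k + 1) \<and>
       F = (\<lambda>x. E j k (\<lambda>l. x (\<sigma> l))) \<and> E j k = (\<lambda>x. F (\<lambda>l. x (\<tau> l)))"
      using F
    proof
      assume "\<exists>c. F = (\<lambda>x. c)"
      then obtain c where F: "F = (\<lambda>x. c)" by blast
      show ?thesis unfolding F
        by (rule exI[of _ "if c then 1 else 0"], intro conjI exI[of _ "0 :: nat"] exI[of _ "\<lambda>l :: nat. 0 :: nat"])
          (use n in \<open>auto simp: E_def fun_eq_iff\<close>)
    next
      assume "\<exists>I. I \<subseteq> {..<n} \<and> I \<noteq> {} \<and> F = (\<lambda>x. \<exists>i\<in>I. x i)"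
      then obtain I where I: "I \<subseteq> {..<n}" "I \<noteq> {}" and F: "F = (\<lambda>x. \<exists>i\<in>I. x i)" by blast
      have fin: "finite I" using I(1) finite_subset by blast
      obtain h where h: "bij_betw h {0..<card I} I" using ex_bij_betw_nat_finite[OF fin] by blast
      have c: "card I > 0" using fin I(2) by (simp add: card_gt_0_iff)
      \<comment> \<open>Renaming along \<open>h\<close> and back along its inverse \<open>g\<close>
        makes \<open>F\<close> and the normal form minors of each other. Variables outside
        \<open>I\<close> are inessential and may all go to 0.\<close>
      define g where "g = inv_into {0..<card I} h"
      have g: "bij_betw g I {0..<card I}" using h bij_betw_inv_into g_def by blast
      let ?k = "card I - 1"
      have lt: "l \<le> ?k \<longleftrightarrow> l \<in> {0..<card I}" for l using c by auto
      have "(\<exists>l\<le>?k. x (h l)) = (\<exists>i\<in>I. x i)" for x :: "nat \<Rightarrow> bool"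
      proof -
        have "(\<exists>l\<le>?k. x (h l)) = (\<exists>i\<in>h ` {0..<card I}. x i)" unfolding lt by auto
        then show ?thesis using h by (simp only: bij_betw_def)
      qed
      moreover have "(\<exists>i\<in>I. x (if i \<in> I then g i else 0)) = (\<exists>l\<le>?k. x l)" for x :: "nat \<Rightarrow> bool"
      proof -
        have "(\<exists>i\<in>I. x (if i \<in> I then g i else 0)) = (\<exists>l\<in>g ` I. x l)" by auto
        also have "\<dots> = (\<exists>l\<in>{0..<card I}. x l)" using g by (simp only: bij_betw_def)
        finally show ?thesis unfolding lt by auto
      qed
      moreover have "h l < n" if "l < ?k + 1" for l
      proof -
        have "l \<in> {0..<card I}" using that c by auto
        then show ?thesis using h I(1) by (auto simp: bij_betw_def)
      qed
      moreover have "(if l \<in> I then g l else 0) < ?k + 1" if "l < n" for l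
      proof (cases "l \<in> I")
        case True
        then have "g l \<in> {0..<card I}" using g by (auto simp: bij_betw_def)
        then show ?thesis using True by simp
      qed simp
      ultimately show ?thesis unfolding F
        by (intro exI[of _ "2 :: nat"], intro conjI exI[of _ ?k] exI[of _ h] exI[of _ "\<lambda>i. if i \<in> I then g i else 0"])
          (auto simp: E_def fun_eq_iff)
    qed
  qed
qed

lemma countable_interval_Lambda:
  assumes "minor_closed C1" "minor_closed C2" "C2 \<subseteq> Lambda_class"
  shows "countable (class_interval C1 C2)"
proof -
  have O: "C1 \<subseteq> Omega" "C2 \<subseteq> Omega" using assms minor_closed_Omega by auto
  have "countable (class_interval (dual C1) (dual C2))"
    by (rule countable_interval_V) (simp add: assms(3) dual_subset_V_iff[OF O(2)])
  then show ?thesis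
    using countable_interval_dual[OF minor_closed_dual[OF assms(1)] minor_closed_dual[OF assms(2)]]
      dual_dual[OF O(1)] dual_dual[OF O(2)] by simp
qed

lemma countable_interval_L:
  assumes "C2 \<subseteq> L_class"
  shows "countable (class_interval C1 C2)"
proof -
  define E :: "nat \<Rightarrow> nat \<Rightarrow> (nat \<Rightarrow> bool) \<Rightarrow> bool" where
    "E j k x = ((j \<noteq> 0) \<noteq> odd (card {i. i < k \<and> x i}))" for j k x
  show ?thesis
  proof (rule countable_interval_by_traces[of E])
    fix j k
    \<comment> \<open>\<open>E j k\<close> has \<open>k\<close> essential variables and the spare
      variable \<open>k\<close>. Sending the variables \<open>k\<close> and \<open>k + 1\<close> of
      \<open>E j (k + 2)\<close> to the spare one cancels them mod 2.\<close>
    define \<sigma> where "\<sigma> l = (if l < k then l else k)" for l :: nat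
    have "odd (card {i. i < k \<and> x i}) = odd (card {i. i < k + 2 \<and> x (\<sigma> i)})" for x :: "nat \<Rightarrow> bool"
    proof -
      have "{i. i < k + 2 \<and> x (\<sigma> i)} = {i. i < k \<and> x i} \<union> (if x k then {k, k + 1} else {})"
        by (auto simp: \<sigma>_def less_Suc_eq)
      moreover have "card ({i. i < k \<and> x i} \<union> {k, k + 1}) = card {i. i < k \<and> x i} + card {k, k + 1}"
        by (rule card_Un_disjoint) auto
      ultimately show ?thesis by auto
    qed
    then have "E j k = (\<lambda>x. E j (k + 2) (\<lambda>l. x (\<sigma> l)))" by (simp add: E_def fun_eq_iff)
    moreover have "\<forall>l<k + 3. \<sigma> l < k + 1" by (simp add: \<sigma>_def)
    ultimately show "\<exists>\<sigma>. (\<forall>l<k + 3. \<sigma> l < k + 1) \<and> E j k = (\<lambda>x. E j (k + 2) (\<lambda>l. x (\<sigma> l)))" by blast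
  next
    fix n F assume "mem C2 n F"
    then have "mem L_class n F" using assms mem_mono by blast
    then obtain c I where n: "1 \<le> n" and I: "I \<subseteq> {..<n}" and F: "F = (\<lambda>x. c \<noteq> odd (card {i \<in> I. x i}))"
      unfolding mem_L_class by blast
    have fin: "finite I" using I finite_subset by blast
    obtain h where h: "bij_betw h {0..<card I} I" using ex_bij_betw_nat_finite[OF fin] by blast
    define g where "g = inv_into {0..<card I} h"
    have g: "bij_betw g I {0..<card I}" using h bij_betw_inv_into g_def by blast
    let ?k = "card I"
    define \<sigma> where "\<sigma> l = (if l < ?k then h l else 0)" for l
    define \<tau> where "\<tau> i = (if i \<in> I then g i else 0)" for i
    have c1: "card {i \<in> I. x i} = card {l. l < ?k \<and> x (\<sigma> l)}" for x :: "nat \<Rightarrow> bool"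
    proof -
      have "{i \<in> h ` {0..<?k}. x i} = h ` {l. l < ?k \<and> x (\<sigma> l)}" by (auto simp: \<sigma>_def)
      then have "{i \<in> I. x i} = h ` {l. l < ?k \<and> x (\<sigma> l)}" using h by (simp only: bij_betw_def)
      moreover have "inj_on h {l. l < ?k \<and> x (\<sigma> l)}" using h by (auto simp: bij_betw_def inj_on_def)
      ultimately show ?thesis by (simp add: card_image)
    qed
    have c2: "card {l. l < ?k \<and> x l} = card {i \<in> I. x (\<tau> i)}" for x :: "nat \<Rightarrow> bool"
    proof -
      have gi: "g ` I = {0..<?k}" using g by (simp add: bij_betw_def)
      have "{l. l < ?k \<and> x l} = g ` {i \<in> I. x (\<tau> i)}"
      proof
        show "{l. l < ?k \<and> x l} \<subseteq> g ` {i \<in> I. x (\<tau> i)}"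
        proof
          fix l assume l: "l \<in> {l. l < ?k \<and> x l}"
          then have "l \<in> g ` I" unfolding gi by simp
          then obtain i where "i \<in> I" "l = g i" by blast
          then show "l \<in> g ` {i \<in> I. x (\<tau> i)}" using l by (auto simp: \<tau>_def)
        qed
        have "g i < ?k" if "i \<in> I" for i
        proof -
          have "g i \<in> {0..<?k}" using that unfolding gi[symmetric] by blast
          then show ?thesis by simp
        qed
        then show "g ` {i \<in> I. x (\<tau> i)} \<subseteq> {l. l < ?k \<and> x l}" by (auto simp: \<tau>_def)
      qed
      moreover have "inj_on g {i \<in> I. x (\<tau> i)}" using g by (auto simp: bij_betw_def inj_on_def)
      ultimately show ?thesis by (simp add: card_image)
    qed
    have s: "\<sigma> l < n" if "l < ?k + 1" for l
    proof (cases "l < ?k")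
      case True
      then have "h l \<in> I" using bij_betwE[OF h] by auto
      then show ?thesis using I True by (auto simp: \<sigma>_def)
    qed (use n in \<open>simp add: \<sigma>_def\<close>)
    have t: "\<tau> l < ?k + 1" if "l < n" for l
    proof (cases "l \<in> I")
      case True
      then have "g l \<in> {0..<?k}" using bij_betwE[OF g] by blast
      then show ?thesis using True by (simp add: \<tau>_def)
    qed (simp add: \<tau>_def)
    define j :: nat where "j = (if c then 1 else 0)"
    have j: "j < 3" "(j \<noteq> 0) = c" by (simp_all add: j_def)
    have "F = (\<lambda>x. E j ?k (\<lambda>l. x (\<sigma> l)))" unfolding E_def F j(2) c1 ..
    moreover have "E j ?k = (\<lambda>x. F (\<lambda>l. x (\<tau> l)))" unfolding F c2[symmetric] by (simp only: E_def fun_eq_iff j(2)) simp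
    ultimately show "\<exists>j<3. \<exists>k \<sigma> \<tau>. (\<forall>l<k + 1. \<sigma> l < n) \<and> (\<forall>l<n. \<tau> l < k + 1) \<and>
       F = (\<lambda>x. E j k (\<lambda>l. x (\<sigma> l))) \<and> E j k = (\<lambda>x. F (\<lambda>l. x (\<tau> l)))"
      using j(1) s t by (intro exI[of _ j] conjI exI[of _ ?k] exI[of _ \<sigma>] exI[of _ \<tau>]) simp_all
  qed
qed

text \<open>A monotone function outside \<open>Tc_class\<close> is constant, so a class in the
  interval is fixed by which of the two constants it contains: there are at most four.\<close>

lemma countable_interval_between_M:
  assumes "C \<inter> Mc_class \<subseteq> C1" "C2 \<subseteq> C \<inter> M_class"
  shows "countable (class_interval C1 C2)"
proof -
  let ?t = "\<lambda>K. (mem K 1 (\<lambda>x. False), mem K 1 (\<lambda>x. True))"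
  have char: "mem K' n F" if "K \<in> class_interval C1 C2" "K' \<in> class_interval C1 C2"
    and T: "?t K = ?t K'" and F: "mem K n F" for K K' n F
  proof -
    have K: "minor_closed K" "minor_closed K'" "K \<subseteq> C2" "C1 \<subseteq> K'" using that(1,2) class_interval_iff by blast+
    have CM: "mem C n F" "mem M_class n F" using mem_mono[OF subset_trans[OF K(3) assms(2)] F] by (auto simp: mem_Int)
    show ?thesis
    proof (cases "mem Tc_class n F")
      case True
      then have "mem (C \<inter> Mc_class) n F" using CM by (simp add: mem_Int mem_Mc_class)
      then show ?thesis using mem_mono subset_trans[OF assms(1) K(4)] by blast
    next
      case False
      have n: "1 \<le> n" and mono: "\<And>x y. (\<forall>i. x i \<longrightarrow> y i) \<Longrightarrow> F x \<Longrightarrow> F y" 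
        using CM(2) unfolding mem_M_class by blast+
      have "F (\<lambda>i. False) \<or> \<not> F (\<lambda>i. True)" using False CM(2) mem_Tc_class mem_M_class by blast
      then have "\<exists>c. F = (\<lambda>x. c)"
      proof
        assume "F (\<lambda>i. False)"
        then have "F = (\<lambda>x. True)" using mono[of "\<lambda>i. False"] by auto
        then show ?thesis by blast
      next
        assume "\<not> F (\<lambda>i. True)"
        then have "F = (\<lambda>x. False)" using mono[of _ "\<lambda>i. True"] by auto
        then show ?thesis by blast
      qed
      then obtain c where c: "F = (\<lambda>x. c)" by blast
      have "mem K 1 (\<lambda>x. c)" using mem_const_diag[OF K(1) F, of c 1] c by simp
      then have "mem K' 1 (\<lambda>x. c)" using T by (cases c) auto
      then show ?thesis unfolding c using mem_const_diag[OF K(2), of 1 "\<lambda>x. c" c n] n by simp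
    qed
  qed
  have "inj_on ?t (class_interval C1 C2)"
  proof (rule inj_onI)
    fix K K' assume K: "K \<in> class_interval C1 C2" "K' \<in> class_interval C1 C2" and T: "?t K = ?t K'"
    show "K = K'"
    proof
      have O: "K \<subseteq> Omega" "K' \<subseteq> Omega" using K minor_closed_Omega by (auto simp: class_interval_iff)
      show "K \<subseteq> K'" by (rule subset_via_mem[OF O(1)]) (rule char[OF K T])
      show "K' \<subseteq> K" by (rule subset_via_mem[OF O(2)]) (rule char[OF K(2,1) T[symmetric]])
    qed
  qed
  moreover have "countable (?t ` class_interval C1 C2)"
    by (rule countable_finite) (rule finite_subset[OF subset_UNIV], simp)
  ultimately show ?thesis using countable_image_inj_on by blast
qed

section \<open>Clones outside V, Lambda and L\<close>

definition boolean_clone :: "bfun set \<Rightarrow> bool" where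
  "boolean_clone C \<longleftrightarrow> minor_closed C \<and> comp_closed C \<and> mem C 1 (\<lambda>x. x 0)"

lemma cloneD:
  assumes "boolean_clone C"
  shows "minor_closed C" "comp_closed C" "C \<subseteq> Omega"
  using assms minor_closed_Omega by (auto simp: boolean_clone_def)

lemma clone_proj: "boolean_clone C \<Longrightarrow> i < n \<Longrightarrow> mem C n (\<lambda>x. x i)"
  using mem_diag[of C 1 "\<lambda>x. x 0" i n] by (simp add: boolean_clone_def)

lemma boolean_clone_dual: "boolean_clone C \<Longrightarrow> boolean_clone (dual C)"
  by (simp add: boolean_clone_def minor_closed_dual comp_closed_dual mem_dual dual_op_def)

text \<open>Identifying the variables inside \<open>x\<close>, and likewise those outside, yields a
  binary function whose table consists of the two diagonal values and the values at an antipodal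
  pair.\<close>

lemma binary_minor:
  assumes "minor_closed C" "mem C n F"
  shows "mem C 2 (\<lambda>z. if z 0 then (if z 1 then F (\<lambda>_. True) else F x)
    else (if z 1 then F (\<lambda>i. \<not> x i) else F (\<lambda>_. False)))"
proof -
  have eq: "(\<lambda>z. F (\<lambda>i. if x i then z 0 else z 1)) = (\<lambda>z :: nat \<Rightarrow> bool. if z 0 then (if z 1 then F (\<lambda>_. True) else F x)
    else (if z 1 then F (\<lambda>i. \<not> x i) else F (\<lambda>_. False)))"
    by (rule ext) simp
  show ?thesis by (rule back_subst[of "mem C 2", OF minor2[OF assms] eq])
qed

section \<open>Clones outside L: majority, conjunction or disjunction\<close>

definition additive :: "((nat \<Rightarrow> bool) \<Rightarrow> bool) \<Rightarrow> bool" where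
  "additive F \<longleftrightarrow> (\<forall>x y. F (\<lambda>i. x i \<noteq> y i) = (F x \<noteq> F y))"

text \<open>The coefficients are the values of \<open>A\<close> at the unit vectors.\<close>

lemma additive_mem_L:
  assumes "supported n A" "additive A" "1 \<le> n"
  shows "mem L_class n (\<lambda>x. c \<noteq> A x)"
proof -
  define I where "I = {i. i < n \<and> A (\<lambda>j. j = i)}"
  have add: "A (\<lambda>i. x i \<noteq> y i) = (A x \<noteq> A y)" for x y using assms(2) by (simp add: additive_def)
  have A: "A (\<lambda>i. i \<in> S) = odd (card {i \<in> I. i \<in> S})" if "finite S" "S \<subseteq> {..<n}" for S
    using that
  proof (induction S rule: finite_induct)
    case empty
    show ?case using add[of "\<lambda>_. False" "\<lambda>_. False"] by simp
  next
    case (insert a S)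
    have "(\<lambda>i. i \<in> insert a S) = (\<lambda>i. (i = a) \<noteq> (i \<in> S))" using insert(2) by auto
    then have 1: "A (\<lambda>i. i \<in> insert a S) = (A (\<lambda>i. i = a) \<noteq> odd (card {i \<in> I. i \<in> S}))"
      using add[of "\<lambda>i. i = a" "\<lambda>i. i \<in> S"] insert by simp
    have "{i \<in> I. i \<in> insert a S} = (if A (\<lambda>i. i = a) then insert a {i \<in> I. i \<in> S} else {i \<in> I. i \<in> S})"
      using insert(4) by (auto simp: I_def)
    moreover have "finite {i \<in> I. i \<in> S}" using insert(1) by simp
    ultimately show ?case using 1 insert(2) by auto
  qed
  have 1: "A (\<lambda>i. i \<in> {i. i < n \<and> x i}) = odd (card {i \<in> I. i \<in> {i. i < n \<and> x i}})" for x
    by (rule A) auto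
  have "A x = odd (card {i \<in> I. x i})" for x
  proof -
    have "A x = A (\<lambda>i. i \<in> {i. i < n \<and> x i})" by (rule supportedD[OF assms(1)]) simp
    moreover have "{i \<in> I. i \<in> {i. i < n \<and> x i}} = {i \<in> I. x i}" by (auto simp: I_def)
    ultimately show ?thesis using 1 by simp
  qed
  then have "(\<lambda>x. c \<noteq> A x) = (\<lambda>x. c \<noteq> odd (card {i \<in> I. x i}))" by simp
  moreover have "I \<subseteq> {..<n}" by (auto simp: I_def)
  ultimately show ?thesis unfolding mem_L_class using assms(3) by blast
qed

abbreviation maj3 :: "(nat \<Rightarrow> bool) \<Rightarrow> bool" where
  "maj3 \<equiv> \<lambda>z. (z 0 \<and> z 1) \<or> (z 0 \<and> z 2) \<or> (z 1 \<and> z 2)"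

lemma typed_minor:
  assumes "minor_closed C" "mem C n F" "a < m" "b < m" "c < m" "d < m"
  shows "mem C m (\<lambda>z. F (\<lambda>i. if x i then (if y i then z a else z b) else (if y i then z c else z d)))"
  by (rule minor_renameI[OF assms(1,2), of "\<lambda>i. if x i then (if y i then a else b) else (if y i then c else d)"])
    (use assms(3-) in auto)

text \<open>An idempotent self-dual \<open>p\<close> is given by its values at the three points of
  weight 1. If all are 0, it is majority; if two are 1, it is majority with one argument negated,
  and substituting \<open>p\<close> for that argument restores majority. The odd cases are the
  projections and the sum mod 2.\<close>

lemma self_dual_ternary_odd:
  assumes C: "boolean_clone C" and maj: "\<not> mem C 3 maj3"
    and p: "mem C 3 (\<lambda>z. p (z 0) (z 1) (z 2))"
    and id: "\<not> p False False False" "p True True True"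
    and sd: "\<And>a b c. p (\<not> a) (\<not> b) (\<not> c) = (\<not> p a b c)"
  shows "p True False False \<noteq> (p False True False \<noteq> p False False True)"
proof (rule ccontr)
  assume even: "\<not> ?thesis"
  have sd': "p True True False = (\<not> p False False True)" "p True False True = (\<not> p False True False)"
    "p False True True = (\<not> p True False False)"
    using sd[of False False True] sd[of False True False] sd[of True False False] by simp_all
  have pr: "mem C 3 (\<lambda>z. z 0)" "mem C 3 (\<lambda>z. z 1)" "mem C 3 (\<lambda>z. z 2)" using clone_proj[OF C] by simp_all
  have split: "p a b c = (if a then (if b then (if c then True else p True True False)
       else (if c then p True False True else p True False False))
     else (if b then (if c then p False True True else p False True False)
       else (if c then p False False True else False)))" for a b c
    using id by auto
  consider "\<not> p True False False" "\<not> p False True False" "\<not> p False False True"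
    | "p True False False" "p False True False" "\<not> p False False True"
    | "p True False False" "\<not> p False True False" "p False False True"
    | "\<not> p True False False" "p False True False" "p False False True"
    using even by blast
  then show False
  proof cases
    case 1
    have eq: "(\<lambda>z. p (z 0) (z 1) (z 2)) = maj3"
      by (rule ext) (subst split, simp add: 1 sd')
    show ?thesis using maj p unfolding eq by blast
  next
    case 2
    have eq: "(\<lambda>z. p (z 0) (z 1) (p (z 0) (z 1) (z 2))) = maj3"
      by (rule ext, subst (2) split, subst split) (simp add: 2 sd')
    show ?thesis using maj comp3[OF cloneD(2)[OF C] p pr(1,2) p] unfolding eq by blast
  next
    case 3
    have eq: "(\<lambda>z. p (z 0) (p (z 0) (z 1) (z 2)) (z 2)) = maj3"
      by (rule ext, subst (2) split, subst split) (simp add: 3 sd')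
    show ?thesis using maj comp3[OF cloneD(2)[OF C] p pr(1) p pr(3)] unfolding eq by blast
  next
    case 4
    have eq: "(\<lambda>z. p (p (z 0) (z 1) (z 2)) (z 1) (z 2)) = maj3"
      by (rule ext, subst (2) split, subst split) (simp add: 4 sd')
    show ?thesis using maj comp3[OF cloneD(2)[OF C] p p pr(2,3)] unfolding eq by blast
  qed
qed

text \<open>If all three functions are missing, binary minors make idempotent members self-dual, and
  ternary minors make them additive. Other members are reduced to idempotent ones: by negation, or,
  when constant on the diagonal, by adding a variable, since their binary minors then supply
  addition or its complement.\<close>

lemma nonlinear_clone:
  assumes C: "boolean_clone C" and L: "\<not> C \<subseteq> L_class"
  shows "mem C 3 maj3 \<or> mem C 2 (\<lambda>z. z 0 \<and> z 1) \<or> mem C 2 (\<lambda>z. z 0 \<or> z 1)"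
proof (rule ccontr)
  assume "\<not> ?thesis"
  then have no: "\<not> mem C 3 maj3" "\<not> mem C 2 (\<lambda>z. z 0 \<and> z 1)" "\<not> mem C 2 (\<lambda>z. z 0 \<or> z 1)" by auto
  note C' = cloneD[OF C]
  have self_dual: "F (\<lambda>i. \<not> x i) = (\<not> F x)" if F: "mem C n F" "\<not> F (\<lambda>_. False)" "F (\<lambda>_. True)" for n F x
  proof (rule ccontr)
    assume "\<not> ?thesis"
    then have "F (\<lambda>i. \<not> x i) = F x" by simp
    then have B: "mem C 2 (\<lambda>z. if z 0 then (if z 1 then True else F x) else (if z 1 then F x else False))"
      by (intro back_subst[of "mem C 2", OF binary_minor[OF C'(1) F(1), of x]]) (use F(2,3) in auto)
    show False
    proof (cases "F x")
      case True
      then have "(\<lambda>z. if z 0 then (if z 1 then True else F x) else (if z 1 then F x else False)) = (\<lambda>z :: nat \<Rightarrow> bool. z 0 \<or> z 1)"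
        by auto
      then show ?thesis using no(3) B by simp
    next
      case False
      then have "(\<lambda>z. if z 0 then (if z 1 then True else F x) else (if z 1 then F x else False)) = (\<lambda>z :: nat \<Rightarrow> bool. z 0 \<and> z 1)"
        by auto
      then show ?thesis using no(2) B by simp
    qed
  qed
  have add: "additive F" if F: "mem C n F" "\<not> F (\<lambda>_. False)" "F (\<lambda>_. True)" for n F
    unfolding additive_def
  proof (intro allI)
    fix x y :: "nat \<Rightarrow> bool"
    \<comment> \<open>The variables fall into four blocks according to the pair
      \<open>(x i, y i)\<close>.\<close>
    define g where "g p q r s = F (\<lambda>i. if x i then (if y i then p else q) else (if y i then r else s))" for p q r s
    have g1: "\<not> g False False False False" "g True True True True" using F(2,3) by (simp_all add: g_def)
    have sd: "g (\<not> p) (\<not> q) (\<not> r) (\<not> s) = (\<not> g p q r s)" for p q r s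
    proof -
      have "g (\<not> p) (\<not> q) (\<not> r) (\<not> s) =
          F (\<lambda>i. \<not> (if x i then (if y i then p else q) else (if y i then r else s)))"
        unfolding g_def by (rule arg_cong[where f = F]) auto
      then show ?thesis using self_dual[OF F] by (simp add: g_def)
    qed
    have gm: "mem C 3 (\<lambda>z. g (z a) (z b) (z c) (z d))" if "a < 3" "b < 3" "c < 3" "d < 3" for a b c d
      unfolding g_def by (rule typed_minor[OF C'(1) F(1) that])
    note odd3 = self_dual_ternary_odd[OF C no(1)]
    \<comment> \<open>Identifying two of the four blocks leaves a self-dual ternary function, to
      which oddness applies. Relations 1, 2 and 4 and self-duality 5 add up mod 2 to additivity at
      \<open>x\<close>, \<open>y\<close>.\<close>
    have 1: "g True True False False \<noteq> (g False False True False \<noteq> g False False False True)"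
      by (rule odd3[of "\<lambda>a b c. g a a b c"]) (use gm[of 0 0 1 2] g1 sd in simp_all)
    have 2: "g True False True False \<noteq> (g False True False False \<noteq> g False False False True)"
      by (rule odd3[of "\<lambda>a b c. g a b a c"]) (use gm[of 0 1 0 2] g1 sd in simp_all)
    have 3: "g False True True False \<noteq> (g True False False False \<noteq> g False False False True)"
      by (rule odd3[of "\<lambda>a b c. g b a a c"]) (use gm[of 1 0 0 2] g1 sd in simp_all)
    have 4: "g True False False True \<noteq> (g False True False False \<noteq> g False False True False)"
      by (rule odd3[of "\<lambda>a b c. g a b c a"]) (use gm[of 0 1 2 0] g1 sd in simp_all)
    have 5: "g True False False True = (\<not> g False True True False)" using sd[of False True True False] by simp
    have "g True True False False = F x" unfolding g_def by (rule arg_cong[where f = F]) auto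
    moreover have "g True False True False = F y" unfolding g_def by (rule arg_cong[where f = F]) auto
    moreover have "g False True True False = F (\<lambda>i. x i \<noteq> y i)" unfolding g_def by (rule arg_cong[where f = F]) auto
    ultimately show "F (\<lambda>i. x i \<noteq> y i) = (F x \<noteq> F y)" using 1 2 3 4 5 by argo
  qed
  have idem_L: "mem L_class n (\<lambda>x. c \<noteq> F x)" if "mem C n F" "\<not> F (\<lambda>_. False)" "F (\<lambda>_. True)" for n F c
    using additive_mem_L[OF mem_supported[OF that(1)] add[OF that] mem_pos[OF C'(3) that(1)]] .
  have shift: "mem L_class n (\<lambda>x. c \<noteq> (F x \<noteq> x 0))" if "mem C n F" "\<not> F (\<lambda>_. False)" "F (\<lambda>_. True)" for n F c
  proof (rule additive_mem_L)
    have n: "1 \<le> n" using mem_pos[OF C'(3) that(1)] .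
    show "additive (\<lambda>x. F x \<noteq> x 0)" using add[OF that] unfolding additive_def by auto
    show "supported n (\<lambda>x. F x \<noteq> x 0)"
      using mem_supported[OF that(1)] n unfolding supported_def by (metis One_nat_def Suc_le_lessD)
  qed (use mem_pos[OF C'(3) that(1)] in simp)
  have const_L: "mem L_class n (\<lambda>x. c)" if "1 \<le> n" for n c
    using additive_mem_L[of n "\<lambda>_. False" c] that by (simp add: additive_def supported_def)
  obtain n F where F: "mem C n F" "\<not> mem L_class n F" using not_subset_mem[OF C'(3) L] .
  have n: "1 \<le> n" using mem_pos[OF C'(3) F(1)] .
  have p0: "mem C n (\<lambda>x. x 0)" using clone_proj[OF C] n by simp
  show False
  proof (cases "F (\<lambda>_. False)"; cases "F (\<lambda>_. True)")
    assume "\<not> F (\<lambda>_. False)" "F (\<lambda>_. True)"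
    then show False using idem_L[OF F(1), of False] F(2) by simp
  next
    assume d: "F (\<lambda>_. False)" "\<not> F (\<lambda>_. True)"
    have eq: "(\<lambda>z. F (\<lambda>_. z 0)) = (\<lambda>z :: nat \<Rightarrow> bool. \<not> z 0)" using d by (auto simp: fun_eq_iff)
    have "mem C 1 (\<lambda>z. \<not> z 0)" by (rule back_subst[of "mem C 1", OF mem_diag[OF C'(1) F(1)] eq]) simp
    from comp1[OF C'(2) this F(1)] have "mem C n (\<lambda>x. \<not> F x)" .
    then show False using idem_L[of n "\<lambda>x. \<not> F x" True] d F(2) by simp
  next
    assume d: "\<not> F (\<lambda>_. False)" "\<not> F (\<lambda>_. True)"
    have "\<exists>x. F x"
    proof (rule ccontr)
      assume "\<nexists>x. F x"
      then have "F = (\<lambda>_. False)" by auto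
      then show False using F(2) const_L[OF n] by simp
    qed
    then obtain x where x: "F x" by blast
    have B: "mem C 2 (\<lambda>z. if z 0 then \<not> z 1 else z 1 \<and> F (\<lambda>i. \<not> x i))"
      by (rule back_subst[of "mem C 2", OF binary_minor[OF C'(1) F(1), of x]]) (use d x in auto)
    show False
    proof (cases "F (\<lambda>i. \<not> x i)")
      case False
      have 1: "mem C 2 (\<lambda>z. z 0 \<and> \<not> z 1)"
        by (rule back_subst[of "mem C 2", OF B]) (use False in auto)
      have "mem C 2 (\<lambda>z. z 0 \<and> \<not> (z 0 \<and> \<not> z 1))"
        using comp2[OF C'(2), of "\<lambda>a b. a \<and> \<not> b", OF 1 clone_proj[OF C] 1, of 0] by simp
      moreover have "(\<lambda>z. z 0 \<and> \<not> (z 0 \<and> \<not> z 1)) = (\<lambda>z :: nat \<Rightarrow> bool. z 0 \<and> z 1)" by auto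
      ultimately show False using no(2) by simp
    next
      case True
      have 1: "mem C 2 (\<lambda>z. z 0 \<noteq> z 1)"
        by (rule back_subst[of "mem C 2", OF B]) (use True in auto)
      \<comment> \<open>Adding \<open>x 0\<close> turns \<open>F\<close>, which is 0 at both
        constant points, into an idempotent function; \<open>shift\<close> removes the summand
        again.\<close>
      have "mem C n (\<lambda>x. F x \<noteq> x 0)"
        using comp2[OF C'(2), of "\<lambda>a b. a \<noteq> b", OF 1 F(1) p0] .
      from shift[OF this, of False] have "mem L_class n (\<lambda>x. False \<noteq> ((F x \<noteq> x 0) \<noteq> x 0))" using d by simp
      moreover have "(\<lambda>x. False \<noteq> ((F x \<noteq> x 0) \<noteq> x 0)) = F" by auto
      ultimately show False using F(2) by simp
    qed
  next
    assume d: "F (\<lambda>_. False)" "F (\<lambda>_. True)"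
    have "\<exists>x. \<not> F x"
    proof (rule ccontr)
      assume "\<nexists>x. \<not> F x"
      then have "F = (\<lambda>_. True)" by auto
      then show False using F(2) const_L[OF n] by simp
    qed
    then obtain x where x: "\<not> F x" by blast
    have B: "mem C 2 (\<lambda>z. if z 0 then z 1 else \<not> z 1 \<or> F (\<lambda>i. \<not> x i))"
      by (rule back_subst[of "mem C 2", OF binary_minor[OF C'(1) F(1), of x]]) (use d x in auto)
    show False
    proof (cases "F (\<lambda>i. \<not> x i)")
      case True
      have 1: "mem C 2 (\<lambda>z. z 0 \<longrightarrow> z 1)"
        by (rule back_subst[of "mem C 2", OF B]) (use True in auto)
      have "mem C 2 (\<lambda>z. (z 0 \<longrightarrow> z 1) \<longrightarrow> z 1)"
        using comp2[OF C'(2), of "\<lambda>a b. a \<longrightarrow> b", OF 1 1 clone_proj[OF C], of 1] by simp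
      moreover have "(\<lambda>z. (z 0 \<longrightarrow> z 1) \<longrightarrow> z 1) = (\<lambda>z :: nat \<Rightarrow> bool. z 0 \<or> z 1)" by auto
      ultimately show False using no(3) by simp
    next
      case False
      have 1: "mem C 2 (\<lambda>z. z 0 = z 1)"
        by (rule back_subst[of "mem C 2", OF B]) (use False in auto)
      have "mem C n (\<lambda>x. F x = x 0)"
        using comp2[OF C'(2), of "\<lambda>a b. a = b", OF 1 F(1) p0] .
      from shift[OF this, of True] have "mem L_class n (\<lambda>x. True \<noteq> ((F x = x 0) \<noteq> x 0))" using d by simp
      moreover have "(\<lambda>x. True \<noteq> ((F x = x 0) \<noteq> x 0)) = F" by auto
      ultimately show False using F(2) by simp
    qed
  qed
qed

section \<open>Clones with conjunction outside Lambda\<close>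

abbreviation and_or3 :: "(nat \<Rightarrow> bool) \<Rightarrow> bool" where
  "and_or3 \<equiv> \<lambda>z. z 0 \<and> (z 1 \<or> z 2)"

lemma and_imp_gives_and_or:
  assumes C: "boolean_clone C" and imp: "mem C 3 (\<lambda>z. z 0 \<and> (z 1 \<longrightarrow> z 2))"
  shows "mem C 3 and_or3"
proof -
  have "mem C 3 (\<lambda>z. z 0 \<and> ((z 0 \<and> (z 1 \<longrightarrow> z 2)) \<longrightarrow> z 2))"
    using comp3[OF cloneD(2)[OF C], of "\<lambda>a b c. a \<and> (b \<longrightarrow> c)", OF imp _ imp, of "\<lambda>z. z 0" "\<lambda>z. z 2"] clone_proj[OF C]
    by simp
  moreover have "(\<lambda>z. z 0 \<and> ((z 0 \<and> (z 1 \<longrightarrow> z 2)) \<longrightarrow> z 2)) = and_or3" by auto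
  ultimately show ?thesis by simp
qed

lemma and_iff_gives_and_or:
  assumes C: "boolean_clone C" and "and": "mem C 2 (\<lambda>z. z 0 \<and> z 1)"
    and iff: "mem C 3 (\<lambda>z. z 0 \<and> (z 1 = z 2))"
  shows "mem C 3 and_or3"
proof (rule and_imp_gives_and_or[OF C])
  have "mem C 3 (\<lambda>z. z 1 \<and> z 2)"
    using comp2[OF cloneD(2)[OF C], of "\<lambda>a b. a \<and> b", OF "and", of 3 "\<lambda>z. z 1" "\<lambda>z. z 2"] clone_proj[OF C] by simp
  then have "mem C 3 (\<lambda>z. z 0 \<and> (z 1 = (z 1 \<and> z 2)))"
    using comp3[OF cloneD(2)[OF C], of "\<lambda>a b c. a \<and> (b = c)", OF iff, of 3 "\<lambda>z. z 0" "\<lambda>z. z 1"] clone_proj[OF C]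
    by simp
  moreover have "(\<lambda>z. z 0 \<and> (z 1 = (z 1 \<and> z 2))) = (\<lambda>z :: nat \<Rightarrow> bool. z 0 \<and> (z 1 \<longrightarrow> z 2))" by auto
  ultimately show "mem C 3 (\<lambda>z. z 0 \<and> (z 1 \<longrightarrow> z 2))" by simp
qed

text \<open>Small minors of a member outside Lambda are conjoined with a variable
  \<open>z 0\<close>. The nonmonotone cases lead to \<open>z 0\<close> and an implication or
  equivalence of \<open>z 1\<close>, \<open>z 2\<close>, from which \<open>and_or3\<close> is
  composed; the monotone case reaches \<open>and_or3\<close> directly.\<close>

lemma nonconjunctive_clone:
  assumes C: "boolean_clone C" and a2: "mem C 2 (\<lambda>z. z 0 \<and> z 1)" and L: "\<not> C \<subseteq> Lambda_class"
  shows "mem C 3 and_or3"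
proof -
  note C' = cloneD[OF C]
  have conj: "mem C n (\<lambda>x. F x \<and> G x)" if "mem C n F" "mem C n G" for n F G
    using comp2[OF C'(2), of "\<lambda>a b. a \<and> b", OF a2 that] .
  have andB: "mem C 3 (\<lambda>z. z 0 \<and> b (z 1) (z 2))" if "mem C 2 (\<lambda>z. b (z 0) (z 1))" for b
    using conj[of 3 "\<lambda>z. z 0" "\<lambda>z. b (z 1) (z 2)"] comp2[OF C'(2) that, of 3 "\<lambda>z. z 1" "\<lambda>z. z 2"] clone_proj[OF C]
    by simp
  obtain n F where F: "mem C n F" "\<not> mem Lambda_class n F" using not_subset_mem[OF C'(3) L] .
  have n: "1 \<le> n" using mem_pos[OF C'(3) F(1)] .
  have sup: "supported n F" using mem_supported[OF F(1)] .
  have nonconst: "\<exists>x. F x = c" for c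
  proof (rule ccontr)
    assume "\<nexists>x. F x = c"
    then have "F = (\<lambda>_. \<not> c)" by auto
    then show False using F(2) n unfolding mem_Lambda_class by blast
  qed
  show ?thesis
  proof (cases "F (\<lambda>_. False)"; cases "F (\<lambda>_. True)")
    assume d: "F (\<lambda>_. False)" "\<not> F (\<lambda>_. True)"
    have eq: "(\<lambda>z. F (\<lambda>_. z 0)) = (\<lambda>z :: nat \<Rightarrow> bool. \<not> z 0)" using d by (auto simp: fun_eq_iff)
    have neg: "mem C 1 (\<lambda>z. \<not> z 0)" by (rule back_subst[of "mem C 1", OF mem_diag[OF C'(1) F(1)] eq]) simp
    have "mem C 2 (\<lambda>z. z 0 \<and> \<not> z 1)"
      using conj[of 2 "\<lambda>z. z 0" "\<lambda>z. \<not> z 1"] comp1[OF C'(2) neg, of 2 "\<lambda>z. z 1"] clone_proj[OF C] by simp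
    from comp1[OF C'(2) neg this] have "mem C 2 (\<lambda>z. z 0 \<longrightarrow> z 1)" by (rule back_subst) auto
    then have "mem C 3 (\<lambda>z. z 0 \<and> (z 1 \<longrightarrow> z 2))" by (rule andB)
    then show ?thesis by (rule and_imp_gives_and_or[OF C])
  next
    assume d: "\<not> F (\<lambda>_. False)" "\<not> F (\<lambda>_. True)"
    obtain x where x: "F x" using nonconst[of True] by auto
    have B: "mem C 2 (\<lambda>z. if z 0 then \<not> z 1 else z 1 \<and> F (\<lambda>i. \<not> x i))"
      by (rule back_subst[of "mem C 2", OF binary_minor[OF C'(1) F(1), of x]]) (use d x in auto)
    have "mem C 2 (\<lambda>z. z 0 \<and> (if z 0 then \<not> z 1 else z 1 \<and> F (\<lambda>i. \<not> x i)))"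
      using conj[OF _ B, of "\<lambda>z. z 0"] clone_proj[OF C] by simp
    then have 1: "mem C 2 (\<lambda>z. z 0 \<and> \<not> z 1)" by (rule back_subst[of "mem C 2"]) auto
    have "mem C 3 (\<lambda>z. z 1 \<and> \<not> z 2)"
      using comp2[OF C'(2), of "\<lambda>a b. a \<and> \<not> b", OF 1, of 3 "\<lambda>z. z 1" "\<lambda>z. z 2"] clone_proj[OF C] by simp
    from comp2[OF C'(2), of "\<lambda>a b. a \<and> \<not> b", OF 1 clone_proj[OF C] this]
    have "mem C 3 (\<lambda>z. z 0 \<and> \<not> (z 1 \<and> \<not> z 2))" by simp
    then have "mem C 3 (\<lambda>z. z 0 \<and> (z 1 \<longrightarrow> z 2))" by (rule back_subst) auto
    then show ?thesis by (rule and_imp_gives_and_or[OF C])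
  next
    assume d: "F (\<lambda>_. False)" "F (\<lambda>_. True)"
    obtain x where x: "\<not> F x" using nonconst[of False] by auto
    have B: "mem C 2 (\<lambda>z. if z 0 then z 1 else \<not> z 1 \<or> F (\<lambda>i. \<not> x i))"
      by (rule back_subst[of "mem C 2", OF binary_minor[OF C'(1) F(1), of x]]) (use d x in auto)
    show ?thesis
    proof (cases "F (\<lambda>i. \<not> x i)")
      case True
      have "mem C 2 (\<lambda>z. z 0 \<longrightarrow> z 1)"
        by (rule back_subst[of "mem C 2", OF B]) (use True in auto)
      then have "mem C 3 (\<lambda>z. z 0 \<and> (z 1 \<longrightarrow> z 2))" by (rule andB)
      then show ?thesis by (rule and_imp_gives_and_or[OF C])
    next
      case False
      have "mem C 2 (\<lambda>z. z 0 = z 1)"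
        by (rule back_subst[of "mem C 2", OF B]) (use False in auto)
      then have "mem C 3 (\<lambda>z. z 0 \<and> (z 1 = z 2))" by (rule andB)
      then show ?thesis by (rule and_iff_gives_and_or[OF C a2])
    qed
  next
    assume d: "\<not> F (\<lambda>_. False)" "F (\<lambda>_. True)"
    show ?thesis
    proof (cases "\<forall>x y. (\<forall>i. x i \<longrightarrow> y i) \<longrightarrow> F x \<longrightarrow> F y")
      case False
      then obtain x y where xy: "\<And>i. x i \<Longrightarrow> y i" "F x" "\<not> F y" by blast
      \<comment> \<open>The blocks are \<open>x\<close>, the rest of \<open>y\<close>, and the
        complement of \<open>y\<close>: \<open>G\<close> drops from 1 to 0 when its second argument
        is raised.\<close>
      define G where "G p q r = F (\<lambda>i. if x i then p else if y i then q else r)" for p q r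
      have G: "mem C 3 (\<lambda>z. G (z 0) (z 1) (z 2))" unfolding G_def by (rule minor3[OF C'(1) F(1)])
      have "G True False False = F x" unfolding G_def by (rule arg_cong[where f = F]) auto
      moreover have "G True True False = F y" unfolding G_def by (rule arg_cong[where f = F]) (use xy in auto)
      moreover have "G True True True" using d by (simp add: G_def)
      ultimately have Gv: "G True False False" "\<not> G True True False" "G True True True" using xy by auto
      have 1: "mem C 3 (\<lambda>z. z 0 \<and> G (z 0) (z 1) (z 2))" using conj[OF _ G, of "\<lambda>z. z 0"] clone_proj[OF C] by simp
      have Gs: "(a \<and> G a b c) = (a \<and> (if b then c else \<not> c \<or> G True False True))" for a b c
        using Gv by (cases a; cases b; cases c) simp_all
      show ?thesis
      proof (cases "G True False True")
        case True
        have "mem C 3 (\<lambda>z. z 0 \<and> (z 1 \<longrightarrow> z 2))" 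
          by (rule back_subst[of "mem C 3", OF 1]) (use True in \<open>auto simp: Gs\<close>)
        then show ?thesis by (rule and_imp_gives_and_or[OF C])
      next
        case False
        have "mem C 3 (\<lambda>z. z 0 \<and> (z 1 = z 2))"
          by (rule back_subst[of "mem C 3", OF 1]) (use False in \<open>auto simp: Gs\<close>)
        then show ?thesis by (rule and_iff_gives_and_or[OF C a2])
      qed
    next
      case mono: True
      \<comment> \<open>The variables that are 1 at every true point. If \<open>F\<close> were their
        conjunction, it would lie in \<open>Lambda_class\<close>.\<close>
      define A where "A = {i. i < n \<and> \<not> F (\<lambda>j. j \<noteq> i)}"
      have necessary: "\<forall>i\<in>A. x i" if "F x" for x
      proof
        fix i assume "i \<in> A"
        then show "x i" using mono[rule_format, of x "\<lambda>j. j \<noteq> i"] that by (auto simp: A_def)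
      qed
      have "\<exists>x. (\<forall>i\<in>A. x i) \<and> \<not> F x"
      proof (rule ccontr)
        assume "\<not> ?thesis"
        then have "F x \<longleftrightarrow> (\<forall>i\<in>A. x i)" for x using necessary[of x] by blast
        then have eq: "F = (\<lambda>x. \<forall>i\<in>A. x i)" by (rule ext)
        then have "A \<noteq> {}" using d by auto
        moreover have "A \<subseteq> {..<n}" by (auto simp: A_def)
        ultimately show False using eq n F(2) unfolding mem_Lambda_class by blast
      qed
      then obtain x0 where x0: "\<forall>i\<in>A. x0 i" "\<not> F x0" by blast
      \<comment> \<open>Take a largest false set \<open>S\<close> containing \<open>A\<close> and
        some \<open>j\<close> outside it. Adding \<open>j\<close> makes \<open>S\<close> true by
        maximality, and the set of all variables except \<open>j\<close> is true because
        \<open>j\<close> is not in \<open>A\<close>. Hence the blocks \<open>S\<close>,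
        \<open>{j}\<close> and the rest give \<open>and_or3\<close> after conjunction with the first
        variable.\<close>
      let ?Q = "\<lambda>S. A \<subseteq> S \<and> S \<subseteq> {..<n} \<and> \<not> F (\<lambda>i. i \<in> S)"
      have "\<not> F (\<lambda>i. i \<in> {i. i < n \<and> x0 i})"
        using x0(2) supportedD[OF sup, of "\<lambda>i. i \<in> {i. i < n \<and> x0 i}" x0] by simp
      then have q: "?Q {i. i < n \<and> x0 i}" using x0(1) by (auto simp: A_def)
      have b: "\<forall>S. ?Q S \<longrightarrow> card S < Suc n" using card_mono[of "{..<n}"] by (auto simp: less_Suc_eq_le)
      obtain S where S': "?Q S \<and> (\<forall>S'. ?Q S' \<longrightarrow> card S' \<le> card S)"
        using ex_has_greatest_nat[where P = ?Q, OF q b] by (rule exE)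
      have S: "?Q S" using S' by (rule conjunct1)
      have max: "card S' \<le> card S" if "?Q S'" for S' using S' that by (blast dest: conjunct2)
      have "\<exists>j<n. j \<notin> S"
      proof (rule ccontr)
        assume "\<not> (\<exists>j<n. j \<notin> S)"
        then have "F (\<lambda>i. i \<in> S) = F (\<lambda>_. True)" by (intro supportedD[OF sup]) auto
        then show False using S d by simp
      qed
      then obtain j where j: "j < n" "j \<notin> S" by blast
      define G where "G p q r = F (\<lambda>i. if i \<in> S then p else if i = j then q else r)" for p q r
      have G: "mem C 3 (\<lambda>z. G (z 0) (z 1) (z 2))" unfolding G_def by (rule minor3[OF C'(1) F(1)])
      have "G True False False = F (\<lambda>i. i \<in> S)" unfolding G_def by (rule arg_cong[where f = F]) auto
      moreover have "G True True False"
      proof -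
        have "finite S" using S finite_subset by blast
        then have "card (insert j S) > card S" using j by simp
        then have "F (\<lambda>i. i \<in> insert j S)" using max[of "insert j S"] S j by force
        moreover have "G True True False = F (\<lambda>i. i \<in> insert j S)" unfolding G_def by (rule arg_cong[where f = F]) auto
        ultimately show ?thesis by simp
      qed
      moreover have "G True False True"
      proof -
        have "G True False True = F (\<lambda>i. i \<noteq> j)" unfolding G_def by (rule arg_cong[where f = F]) (use j in auto)
        moreover have "j \<notin> A" using S j by blast
        ultimately show ?thesis using j by (simp add: A_def)
      qed
      moreover have "G True True True" using d by (simp add: G_def)
      ultimately have Gs: "(a \<and> G a b c) = (a \<and> (b \<or> c))" for a b c
        using S by (cases a; cases b; cases c) simp_all
      have "mem C 3 (\<lambda>z. z 0 \<and> G (z 0) (z 1) (z 2))" using conj[OF _ G, of "\<lambda>z. z 0"] clone_proj[OF C] by simp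
      then show ?thesis by (rule back_subst[of "mem C 3"]) (auto simp: Gs)
    qed
  qed
qed

lemma clone_trichotomy:
  assumes C: "boolean_clone C"
    and "\<not> C \<subseteq> V_class" "\<not> C \<subseteq> Lambda_class" "\<not> C \<subseteq> L_class"
  shows "mem C 3 maj3 \<or> mem C 3 and_or3 \<or> mem (dual C) 3 and_or3"
proof -
  have "mem (dual C) 2 (\<lambda>z. z 0 \<and> z 1)" if "mem C 2 (\<lambda>z. z 0 \<or> z 1)"
    using that by (simp add: mem_dual dual_op_def)
  moreover have "\<not> dual C \<subseteq> Lambda_class"
    using assms(2) dual_subset_Lambda_iff cloneD(3)[OF C] by blast
  ultimately show ?thesis
    using nonlinear_clone[OF C assms(4)] nonconjunctive_clone[OF C] assms(3)
      nonconjunctive_clone[OF boolean_clone_dual[OF C]] by blast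
qed

section \<open>Uncountable intervals below a clone\<close>

definition block_comp :: "((nat \<Rightarrow> bool) \<Rightarrow> bool) \<Rightarrow> ((nat \<Rightarrow> bool) \<Rightarrow> bool) \<Rightarrow> nat \<Rightarrow> (nat \<Rightarrow> bool) \<Rightarrow> bool" where
  "block_comp f g n = (\<lambda>x. f (\<lambda>t. g (\<lambda>l. x (t * (n + 1) + l))))"

definition weight :: "nat \<Rightarrow> (nat \<Rightarrow> bool) \<Rightarrow> nat" where
  "weight n x = card {l. l < n \<and> x l}"

definition steep :: "nat \<Rightarrow> nat \<Rightarrow> ((nat \<Rightarrow> bool) \<Rightarrow> bool) \<Rightarrow> bool" where
  "steep k n g \<longleftrightarrow> supported (n + 1) g \<and> \<not> g (\<lambda>_. False) \<and> g (\<lambda>_. True) \<and>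
     (\<forall>x. x 0 \<longrightarrow> k \<le> weight n (\<lambda>l. x (Suc l)) \<longrightarrow> g x) \<and> (\<forall>x. weight (n + 1) x < k \<longrightarrow> \<not> g x)"

lemma block_index: "t < p \<Longrightarrow> l < n + 1 \<Longrightarrow> t * (n + 1) + l < p * (n + 1)"
  for t p l n :: nat
proof -
  assume "t < p" "l < n + 1"
  then have "t * (n + 1) + l < Suc t * (n + 1)" by simp
  also have "\<dots> \<le> p * (n + 1)" using \<open>t < p\<close> by (intro mult_right_mono) auto
  finally show ?thesis .
qed

lemma mem_block_comp:
  assumes "minor_closed C" "comp_closed C" "mem C p f" "mem C (n + 1) g"
  shows "mem C (p * (n + 1)) (block_comp f g n)"
  unfolding block_comp_def
  by (rule compI[OF assms(2,3)], rule minorI[OF assms(1,4)]) (rule block_index)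

text \<open>\<open>g\<close> is idempotent, so identifying the variables within each block restores
  \<open>f\<close>.\<close>

lemma block_comp_minor:
  assumes "minor_closed C" "supported p f" "steep k n g" "mem C (p * (n + 1)) (block_comp f g n)"
  shows "mem C p f"
proof -
  have "mem C p (\<lambda>x. block_comp f g n (\<lambda>j. x (j div (n + 1))))"
    by (rule minorI[OF assms(1,4)]) (simp add: div_less_iff_less_mult)
  moreover have "block_comp f g n (\<lambda>j. x (j div (n + 1))) = f x" for x
  proof -
    have "g (\<lambda>l. x ((t * (n + 1) + l) div (n + 1))) = x t" for t
    proof -
      have "g (\<lambda>l. x ((t * (n + 1) + l) div (n + 1))) = g (\<lambda>_. x t)"
      proof (rule supportedD[of "n + 1" g])
        show "supported (n + 1) g" using assms(3) by (simp add: steep_def)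
        fix l assume "l < n + 1"
        then have "(t * (n + 1) + l) div (n + 1) = t" by (simp add: div_mult_self3 del: mult_Suc_right)
        then show "x ((t * (n + 1) + l) div (n + 1)) = x t" by simp
      qed
      also have "\<dots> = x t" using assms(3) by (cases "x t") (simp_all add: steep_def)
      finally show ?thesis .
    qed
    then show ?thesis by (simp add: block_comp_def)
  qed
  ultimately show ?thesis by simp
qed

text \<open>Spread \<open>y\<close> over the blocks and set \<open>A\<close> to 1 in addition: a
  block with \<open>y t\<close> false has fewer than \<open>k\<close> ones, so \<open>g\<close> is
  still 0 there. Both values \<open>f y\<close> and \<open>f y'\<close> survive.\<close>

lemma block_comp_not_forced:
  assumes "steep k n g" "finite A" "card A < k" "f y \<noteq> f y'"
  shows "\<exists>x x'. (\<forall>i\<in>A. x i \<and> x' i) \<and> block_comp f g n x \<noteq> block_comp f g n x'"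
proof -
  define X where "X y j = (y (j div (n + 1)) \<or> j \<in> A)" for y j
  have "block_comp f g n (X y) = f y" for y
  proof -
    have "g (\<lambda>l. X y (t * (n + 1) + l)) = y t" for t
    proof (cases "y t")
      case True
      have "g (\<lambda>l. X y (t * (n + 1) + l)) = g (\<lambda>_. True)"
      proof (rule supportedD[of "n + 1" g])
        show "supported (n + 1) g" using assms(1) by (simp add: steep_def)
        fix l assume "l < n + 1"
        then have "(t * (n + 1) + l) div (n + 1) = t" by (simp add: div_mult_self3 del: mult_Suc_right)
        then show "X y (t * (n + 1) + l) = True" using True by (simp add: X_def)
      qed
      then show ?thesis using True assms(1) by (simp add: steep_def)
    next
      case False
      have "(\<lambda>l. t * (n + 1) + l) ` {l. l < n + 1 \<and> X y (t * (n + 1) + l)} \<subseteq> A"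
      proof clarify
        fix l assume l: "l < n + 1" "X y (t * (n + 1) + l)"
        then have "(t * (n + 1) + l) div (n + 1) = t" by (simp add: div_mult_self3 del: mult_Suc_right)
        then show "t * (n + 1) + l \<in> A" using l(2) False by (simp add: X_def)
      qed
      from card_mono[OF assms(2) this] have "weight (n + 1) (\<lambda>l. X y (t * (n + 1) + l)) \<le> card A"
        unfolding weight_def by (subst (asm) card_image) (auto simp: inj_on_def)
      then show ?thesis using False assms(1,3) by (auto simp: steep_def)
    qed
    then show ?thesis by (simp add: block_comp_def)
  qed
  then have "block_comp f g n (X y) \<noteq> block_comp f g n (X y')" using assms(4) by simp
  moreover have "\<forall>i\<in>A. X y i \<and> X y' i" by (simp add: X_def)
  ultimately show ?thesis by blast
qed

lemma block_comp_forced: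
  assumes "supported p f" "steep k n g"
    and "\<And>t. t < p \<Longrightarrow> x (t * (n + 1))" "\<And>t. t < p \<Longrightarrow> k \<le> weight n (\<lambda>l. x (t * (n + 1) + Suc l))"
  shows "block_comp f g n x = f (\<lambda>_. True)"
  unfolding block_comp_def
proof (rule supportedD[OF assms(1)])
  fix t assume "t < p"
  then show "g (\<lambda>l. x (t * (n + 1) + l)) = True"
    using assms(2) assms(3,4)[of t] unfolding steep_def by (elim conjE allE[of _ "\<lambda>l. x (t * (n + 1) + l)"]) auto
qed

lemma pigeonhole_fibre:
  fixes \<sigma> :: "nat \<Rightarrow> nat"
  assumes "\<And>l. l < n \<Longrightarrow> \<sigma> l < N" "N * k < n"
  shows "\<exists>v<N. k \<le> card {l. l < n \<and> \<sigma> l = v}"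
proof (rule ccontr)
  assume "\<not> ?thesis"
  then have small: "card {l. l < n \<and> \<sigma> l = v} \<le> k" if "v < N" for v using that by (meson not_le_imp_less less_imp_le)
  have "{..<n} = (\<Union>v\<in>{..<N}. {l. l < n \<and> \<sigma> l = v})" using assms(1) by auto
  then have "n = card (\<Union>v\<in>{..<N}. {l. l < n \<and> \<sigma> l = v})" by (metis card_lessThan)
  also have "\<dots> \<le> (\<Sum>v<N. card {l. l < n \<and> \<sigma> l = v})" by (rule card_UN_le) simp
  also have "\<dots> \<le> (\<Sum>v<N. k)" by (rule sum_mono) (use small in simp)
  finally show False using assms(2) by simp
qed

text \<open>For an equation between the i-th function and a minor of the j-th: the third inequality
  excludes j < i, the fourth is the pigeonhole condition for i < j, and the first ensures that the
  two variables per block found there are too few to force the i-th function. The second is the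
  condition under which steep functions are constructed.\<close>

lemma growth_sequences:
  fixes p :: nat
  obtains \<kappa> \<nu> :: "nat \<Rightarrow> nat" where
    "\<And>i. 2 * p < \<kappa> i" "\<And>i. 2 * \<kappa> i \<le> \<nu> i" "\<And>i j. i < j \<Longrightarrow> p * (\<kappa> i + 1) < \<kappa> j"
    "\<And>i j. i < j \<Longrightarrow> p * (\<nu> i + 1) * \<kappa> j < \<nu> j"
proof -
  define s where "s = rec_nat (2 * p + 1, 4 * p + 2)
    (\<lambda>_ (k, n). let k' = p * (k + 1) + k + 1 in (k', 2 * k' + p * (n + 1) * k' + n))"
  define \<kappa> \<nu> where "\<kappa> i = fst (s i)" and "\<nu> i = snd (s i)" for i
  have z: "\<kappa> 0 = 2 * p + 1" "\<nu> 0 = 4 * p + 2" by (simp_all add: \<kappa>_def \<nu>_def s_def)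
  have k: "\<kappa> (Suc i) = p * (\<kappa> i + 1) + \<kappa> i + 1" for i
    by (simp add: \<kappa>_def s_def Let_def split_beta)
  have n: "\<nu> (Suc i) = 2 * \<kappa> (Suc i) + p * (\<nu> i + 1) * \<kappa> (Suc i) + \<nu> i" for i
    unfolding k by (simp add: \<kappa>_def \<nu>_def s_def Let_def split_beta)
  have km: "\<kappa> i \<le> \<kappa> j" if "i \<le> j" for i j
    by (rule lift_Suc_mono_le[OF _ that]) (simp add: k)
  have nm: "\<nu> i \<le> \<nu> j" if "i \<le> j" for i j
    by (rule lift_Suc_mono_le[OF _ that]) (simp add: n)
  have 1: "2 * p < \<kappa> i" for i using km[of 0 i] z by simp
  have 2: "2 * \<kappa> i \<le> \<nu> i" for i by (cases i) (simp_all add: z n)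
  have 3: "p * (\<kappa> i + 1) < \<kappa> j" if "i < j" for i j
    using km[of "Suc i" j] that unfolding k by linarith
  have 4: "p * (\<nu> i + 1) * \<kappa> j < \<nu> j" if ij: "i < j" for i j
  proof -
    obtain j' where j: "j = Suc j'" "i \<le> j'" using ij by (cases j) auto
    have "p * (\<nu> i + 1) * \<kappa> j \<le> p * (\<nu> j' + 1) * \<kappa> j" using nm[OF j(2)] by (intro mult_right_mono mult_left_mono) auto
    also have "\<dots> < \<nu> j" using 1[of j] unfolding j(1) n by linarith
    finally show ?thesis .
  qed
  show thesis by (rule that[OF 1 2 3 4])
qed

text \<open>
  Say that a set of variables forces a function if setting them all to 1 makes it constant.
  A minor with few variables of a steep \<^term>\<open>g\<close> with many variables is forced by two variables, since
  \<^term>\<open>k\<close> of its variables get identified; by contrast, no fewer than \<^term>\<open>k\<close> variables force \<^term>\<open>g\<close>.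
\<close>

lemma uncountable_interval_by_steep:
  assumes C1: "minor_closed C1" and C2: "minor_closed C2" "comp_closed C2" and "C1 \<subseteq> C2"
    and f2: "mem C2 p f" and f1: "\<not> mem C1 p f" and nonconst: "f y \<noteq> f y'"
    and steep: "\<And>k n. 1 \<le> k \<Longrightarrow> 2 * k \<le> n \<Longrightarrow> \<exists>g. mem C2 (n + 1) g \<and> steep k n g"
  shows "\<not> countable (class_interval C1 C2)"
proof -
  obtain \<kappa> \<nu> :: "nat \<Rightarrow> nat" where
    g1: "\<And>i. 2 * p < \<kappa> i" and g2: "\<And>i. 2 * \<kappa> i \<le> \<nu> i" and g3: "\<And>i j. i < j \<Longrightarrow> p * (\<kappa> i + 1) < \<kappa> j"
    and g4: "\<And>i j. i < j \<Longrightarrow> p * (\<nu> i + 1) * \<kappa> j < \<nu> j"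
    by (rule growth_sequences[of p], rule that)
  have sup: "supported p f" using mem_supported[OF f2] .
  have "1 \<le> \<kappa> i" for i using g1[of i] by linarith
  then have "\<forall>i. \<exists>g. mem C2 (\<nu> i + 1) g \<and> steep (\<kappa> i) (\<nu> i) g" using steep g2 by blast
  then obtain g where g: "\<And>i. mem C2 (\<nu> i + 1) (g i)" "\<And>i. steep (\<kappa> i) (\<nu> i) (g i)" by metis
  let ?H = "\<lambda>i. block_comp f (g i) (\<nu> i)"
  let ?N = "\<lambda>i. p * (\<nu> i + 1)"
  have not_forced: False if "finite A" "card A < \<kappa> i" "\<And>x. (\<forall>a\<in>A. x a) \<Longrightarrow> ?H i x = c" for i A c
    using block_comp_not_forced[where f = f and y = y and y' = y', OF g(2)[of i] that(1,2) nonconst] that(3) by metis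
  show ?thesis
  proof (rule antichain_uncountable[OF C1 C2(1) assms(4), where N = ?N and H = ?H])
    show "mem C2 (?N i) (?H i)" for i by (rule mem_block_comp[OF C2 f2 g(1)])
    show "\<not> mem C1 (?N i) (?H i)" for i using block_comp_minor[OF C1 sup g(2)] f1 by blast
    fix i j \<sigma>
    assume ij: "i \<noteq> j" and \<sigma>: "\<And>l. l < ?N j \<Longrightarrow> \<sigma> l < ?N i"
      and H: "?H i = (\<lambda>x. ?H j (\<lambda>l. x (\<sigma> l)))"
    show False
    proof (cases "j < i")
      case True
      \<comment> \<open>The leading variable and the next \<open>\<kappa> j\<close> variables of
        each block force the j-th function; their images are fewer than
        \<open>\<kappa> i\<close>.\<close>
      let ?B = "(\<lambda>(t, l). t * (\<nu> j + 1) + l) ` ({..<p} \<times> {..\<kappa> j})"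
      let ?A = "\<sigma> ` ?B"
      have B: "finite ?B" by simp
      have "card ?B \<le> p * (\<kappa> j + 1)" using card_image_le[of "{..<p} \<times> {..\<kappa> j}"] by (simp add: card_cartesian_product)
      then have "card ?A \<le> p * (\<kappa> j + 1)" using card_image_le[OF B, of \<sigma>] by linarith
      then have "card ?A < \<kappa> i" using g3[OF True] by linarith
      moreover have "?H i x = f (\<lambda>_. True)" if x: "\<forall>a\<in>?A. x a" for x
      proof -
        have "?H j (\<lambda>l. x (\<sigma> l)) = f (\<lambda>_. True)"
        proof (rule block_comp_forced[OF sup g(2)])
          fix t assume t: "t < p"
          have x': "x (\<sigma> (t * (\<nu> j + 1) + l))" if "l \<le> \<kappa> j" for l
          proof -
            have "t * (\<nu> j + 1) + l \<in> ?B" using that t by (intro image_eqI[of _ _ "(t, l)"]) auto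
            then show ?thesis using x by blast
          qed
          show "x (\<sigma> (t * (\<nu> j + 1)))" using x'[of 0] by simp
          have "{..<\<kappa> j} \<subseteq> {l. l < \<nu> j \<and> x (\<sigma> (t * (\<nu> j + 1) + Suc l))}" using x'[of "Suc _"] g2[of j] by auto
          from card_mono[OF _ this] show "\<kappa> j \<le> weight (\<nu> j) (\<lambda>l. x (\<sigma> (t * (\<nu> j + 1) + Suc l)))"
            by (simp add: weight_def)
        qed
        then show ?thesis by (simp add: H)
      qed
      ultimately show False using not_forced[of ?A i "f (\<lambda>_. True)"] B by blast
    next
      case False
      then have ij: "i < j" using ij by simp
      \<comment> \<open>There are only \<open>?N i\<close> target variables, so in each block at
        least \<open>\<kappa> j\<close> variables are sent to the same one. It and the image of the
        leading variable force the block.\<close>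
      have "\<exists>v. \<kappa> j \<le> card {l. l < \<nu> j \<and> \<sigma> (t * (\<nu> j + 1) + Suc l) = v}" if t: "t < p" for t
      proof -
        have "\<sigma> (t * (\<nu> j + 1) + Suc l) < ?N i" if "l < \<nu> j" for l
          by (rule \<sigma>, rule block_index[OF t]) (use that in simp)
        from pigeonhole_fibre[of "\<nu> j" "\<lambda>l. \<sigma> (t * (\<nu> j + 1) + Suc l)", OF this g4[OF ij]]
        show ?thesis by blast
      qed
      then obtain v where v: "\<And>t. t < p \<Longrightarrow> \<kappa> j \<le> card {l. l < \<nu> j \<and> \<sigma> (t * (\<nu> j + 1) + Suc l) = v t}"
        by metis
      let ?A = "v ` {..<p} \<union> (\<lambda>t. \<sigma> (t * (\<nu> j + 1))) ` {..<p}"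
      have "card ?A \<le> card (v ` {..<p}) + card ((\<lambda>t. \<sigma> (t * (\<nu> j + 1))) ` {..<p})" by (rule card_Un_le)
      also have "\<dots> \<le> p + p" by (intro add_mono) (use card_image_le[of "{..<p}"] in simp_all)
      also have "\<dots> < \<kappa> i" using g1[of i] by simp
      finally have "card ?A < \<kappa> i" .
      moreover have "?H i x = f (\<lambda>_. True)" if x: "\<forall>a\<in>?A. x a" for x
      proof -
        have "?H j (\<lambda>l. x (\<sigma> l)) = f (\<lambda>_. True)"
        proof (rule block_comp_forced[OF sup g(2)])
          fix t assume t: "t < p"
          show "x (\<sigma> (t * (\<nu> j + 1)))" using x t by blast
          have "x (v t)" using x t by blast
          then have "{l. l < \<nu> j \<and> \<sigma> (t * (\<nu> j + 1) + Suc l) = v t} \<subseteq> {l. l < \<nu> j \<and> x (\<sigma> (t * (\<nu> j + 1) + Suc l))}"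
            by auto
          from card_mono[OF _ this] show "\<kappa> j \<le> weight (\<nu> j) (\<lambda>l. x (\<sigma> (t * (\<nu> j + 1) + Suc l)))"
            using v[OF t] by (simp add: weight_def)
        qed
        then show ?thesis by (simp add: H)
      qed
      ultimately show False using not_forced[of ?A i "f (\<lambda>_. True)"] by blast
    qed
  qed
qed

section \<open>Steep functions from \<open>and_or3\<close> and from majority\<close>

lemma mem_and_monotone:
  assumes C: "boolean_clone C" and ao: "mem C 3 and_or3" and "i < n" "finite S" "S \<noteq> {}" "\<And>a. a \<in> S \<Longrightarrow> a \<subseteq> {..<n}"
  shows "mem C n (\<lambda>x. x i \<and> (\<exists>a\<in>S. \<forall>j\<in>a. x j))"
proof -
  have pi: "mem C n (\<lambda>x. x i)" using clone_proj[OF C assms(3)] .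
  note ao3 = comp3[OF cloneD(2)[OF C], of "\<lambda>a b c. a \<and> (b \<or> c)", OF ao]
  have conj: "mem C n (\<lambda>x. x i \<and> (\<forall>j\<in>a. x j))" if "finite a" "a \<subseteq> {..<n}" for a
    using that
  proof (induction a rule: finite_induct)
    case empty
    show ?case using pi by simp
  next
    case (insert j a)
    then have "mem C n (\<lambda>x. x i \<and> (\<forall>j\<in>a. x j))" "mem C n (\<lambda>x. x j)" using clone_proj[OF C] by auto
    from ao3[OF this(2) this(1) this(1)] show ?case by (rule back_subst[of "mem C n"]) auto
  qed
  show ?thesis using assms(4-)
  proof (induction S rule: finite_ne_induct)
    case (singleton a)
    then have "finite a" "a \<subseteq> {..<n}" using finite_subset by auto
    then show ?case using conj by simp
  next
    case (insert a S)
    then have "finite a" "a \<subseteq> {..<n}" using finite_subset by auto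
    from conj[OF this] have 1: "mem C n (\<lambda>x. x i \<and> (\<forall>j\<in>a. x j))" .
    have "mem C n (\<lambda>x. x i \<and> (\<exists>a\<in>S. \<forall>j\<in>a. x j))" using insert by simp
    from ao3[OF pi 1 this] show ?case by (rule back_subst[of "mem C n"]) auto
  qed
qed

lemma steep_from_and_or:
  assumes C: "boolean_clone C" and ao: "mem C 3 and_or3" and "1 \<le> k" "2 * k \<le> n"
  shows "\<exists>g. mem C (n + 1) g \<and> steep k n g"
proof -
  define S where "S = {a. a \<subseteq> {1..n} \<and> card a = k}"
  define g where "g = (\<lambda>x :: nat \<Rightarrow> bool. x 0 \<and> (\<exists>a\<in>S. \<forall>j\<in>a. x j))"
  have "finite S" unfolding S_def by (rule finite_subset[of _ "Pow {1..n}"]) auto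
  moreover have "{1..k} \<in> S" using assms(3,4) by (auto simp: S_def)
  moreover have "a \<subseteq> {..<n + 1}" if "a \<in> S" for a using that by (auto simp: S_def)
  ultimately have mem: "mem C (n + 1) g" unfolding g_def by (intro mem_and_monotone[OF C ao]) auto
  have "g x" if x: "x 0" "k \<le> weight n (\<lambda>l. x (Suc l))" for x
  proof -
    obtain b where b: "b \<subseteq> {l. l < n \<and> x (Suc l)}" "card b = k"
      using obtain_subset_with_card_n[OF x(2)[unfolded weight_def]] by blast
    have "Suc ` b \<in> S" using b by (auto simp: S_def card_image)
    moreover have "\<forall>j\<in>Suc ` b. x j" using b by auto
    ultimately show ?thesis using x(1) unfolding g_def by blast
  qed
  moreover have "\<not> g x" if "weight (n + 1) x < k" for x
  proof
    assume "g x"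
    then obtain a where a: "a \<in> S" "\<forall>j\<in>a. x j" by (auto simp: g_def)
    then have "a \<subseteq> {l. l < n + 1 \<and> x l}" by (auto simp: S_def)
    from card_mono[OF _ this] show False using that a(1) by (simp add: weight_def S_def)
  qed
  moreover have "\<not> g (\<lambda>_. False)" "g (\<lambda>_. True)" using \<open>{1..k} \<in> S\<close> by (auto simp: g_def)
  ultimately have "steep k n g" using mem_supported[OF mem] by (simp add: steep_def)
  then show ?thesis using mem by blast
qed

text \<open>Baker-Pixley for majority. Given three points of \<open>S\<close>, take interpolants on
  \<open>S\<close> without each of them: at every point of \<open>S\<close> at most one is wrong,
  and majority corrects it.\<close>

lemma maj_interpolation:
  assumes C: "boolean_clone C" and mj: "mem C 3 maj3" and "supported n F"
    and pair: "\<And>x y. \<exists>t. mem C n t \<and> t x = F x \<and> t y = F y"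
  shows "mem C n F"
proof -
  have mj3: "mem C n (\<lambda>x. (F x \<and> G x) \<or> (F x \<and> H x) \<or> (G x \<and> H x))" if "mem C n F" "mem C n G" "mem C n H" for F G H
    using comp3[OF cloneD(2)[OF C], of "\<lambda>a b c. (a \<and> b) \<or> (a \<and> c) \<or> (b \<and> c)", OF mj that] .
  have "\<exists>t. mem C n t \<and> (\<forall>x\<in>S. t x = F x)" if "finite S" for S
    using that
  proof (induction "card S" arbitrary: S rule: less_induct)
    case less
    show ?case
    proof (cases "\<exists>a b c. {a, b, c} \<subseteq> S \<and> a \<noteq> b \<and> a \<noteq> c \<and> b \<noteq> c")
      case True
      then obtain a b c where abc: "a \<in> S" "b \<in> S" "c \<in> S" "a \<noteq> b" "a \<noteq> c" "b \<noteq> c" by blast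
      have ih: "\<exists>t. mem C n t \<and> (\<forall>x\<in>S - {s}. t x = F x)" if "s \<in> S" for s
        using less(1)[of "S - {s}"] less(2) that by (meson card_Diff1_less finite_Diff)
      obtain ta tb tc where t: "mem C n ta" "mem C n tb" "mem C n tc" "\<forall>x\<in>S - {a}. ta x = F x"
        "\<forall>x\<in>S - {b}. tb x = F x" "\<forall>x\<in>S - {c}. tc x = F x"
        using ih[OF abc(1)] ih[OF abc(2)] ih[OF abc(3)] by blast
      have "((ta x \<and> tb x) \<or> (ta x \<and> tc x) \<or> (tb x \<and> tc x)) = F x" if "x \<in> S" for x
      proof -
        have "x \<noteq> a \<and> x \<noteq> b \<or> x \<noteq> a \<and> x \<noteq> c \<or> x \<noteq> b \<and> x \<noteq> c" using abc by blast
        then show ?thesis using t(4-6) that by auto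
      qed
      then show ?thesis using mj3[OF t(1-3)] by blast
    next
      case False
      have "\<exists>x y. S \<subseteq> {x, y}"
      proof (cases "S = {}")
        case ne: False
        then obtain a where a: "a \<in> S" by blast
        show ?thesis
        proof (cases "S = {a}")
          case False
          then obtain b where "b \<in> S" "b \<noteq> a" using a by blast
          then have "S \<subseteq> {a, b}" using \<open>\<not> (\<exists>a b c. _)\<close> a by blast
          then show ?thesis by blast
        qed blast
      qed blast
      then obtain x y where "S \<subseteq> {x, y}" by blast
      then show ?thesis using pair[of x y] by blast
    qed
  qed
  moreover have "finite ((\<lambda>A i. i \<in> A) ` Pow {..<n} :: (nat \<Rightarrow> bool) set)" by simp
  ultimately obtain t where t: "mem C n t" "\<And>A. A \<subseteq> {..<n} \<Longrightarrow> t (\<lambda>i. i \<in> A) = F (\<lambda>i. i \<in> A)"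
    by (metis PowI image_eqI)
  have "t = F"
  proof
    fix x
    have "t x = t (\<lambda>i. i \<in> {i. i < n \<and> x i})" by (rule supportedD[OF mem_supported[OF t(1)]]) simp
    also have "\<dots> = F (\<lambda>i. i \<in> {i. i < n \<and> x i})" by (rule t(2)) auto
    also have "\<dots> = F x" by (rule supportedD[OF assms(3)]) simp
    finally show "t x = F x" .
  qed
  then show ?thesis using t(1) by simp
qed

lemma weight_cong: "(\<And>l. l < n \<Longrightarrow> x l = y l) \<Longrightarrow> weight n x = weight n y"
  unfolding weight_def by (rule arg_cong[where f = card]) auto

lemma weight_not: "weight n (\<lambda>l. \<not> x l) = n - weight n x"
proof -
  have "{l. l < n \<and> \<not> x l} = {..<n} - {l. l < n \<and> x l}" by auto
  then show ?thesis unfolding weight_def by (simp add: card_Diff_subset subset_iff)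
qed

lemma weight_le: "weight n x \<le> n"
  unfolding weight_def using card_mono[of "{..<n}" "{l. l < n \<and> x l}"] by auto

lemma weight_mono: "(\<And>l. l < n \<Longrightarrow> x l \<Longrightarrow> y l) \<Longrightarrow> weight n x \<le> weight n y"
  unfolding weight_def by (rule card_mono) auto

lemma weight_common:
  assumes "n < weight n x + weight n y"
  shows "\<exists>l<n. x l \<and> y l"
proof (rule ccontr)
  assume "\<not> ?thesis"
  then have "weight n x \<le> weight n (\<lambda>l. \<not> y l)" by (intro weight_mono) auto
  then show False using assms weight_le[of n y] by (simp add: weight_not)
qed

text \<open>
  A conjunction with a threshold function is not self-dual; adding the dual threshold
  makes it so, and majority generates all monotone self-dual functions.
\<close>

lemma steep_from_maj:
  assumes C: "boolean_clone C" and mj: "mem C 3 maj3" and k: "1 \<le> k" "2 * k \<le> n"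
  shows "\<exists>g. mem C (n + 1) g \<and> steep k n g"
proof -
  define w where "w x = weight n (\<lambda>l. x (Suc l))" for x :: "nat \<Rightarrow> bool"
  define g where "g = (\<lambda>x :: nat \<Rightarrow> bool. (x 0 \<and> k \<le> w x) \<or> n + 1 - k \<le> w x)"
  have sup: "supported (n + 1) g"
  proof -
    have "w x = w y" if "\<forall>i<n + 1. x i = y i" for x y
      unfolding w_def by (rule weight_cong) (use that in simp)
    then show ?thesis unfolding supported_def g_def by (metis Suc_eq_plus1 zero_less_Suc)
  qed
  have sd: "g (\<lambda>i. \<not> x i) = (\<not> g x)" for x
  proof -
    have "w (\<lambda>i. \<not> x i) = n - w x" "w x \<le> n" using weight_not weight_le by (simp_all add: w_def)
    then show ?thesis using k unfolding g_def by auto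
  qed
  have mono: "g y" if "g x" "\<And>i. i < n + 1 \<Longrightarrow> x i \<Longrightarrow> y i" for x y
  proof -
    have "w x \<le> w y" unfolding w_def by (rule weight_mono) (use that(2) in simp)
    then show ?thesis using that unfolding g_def by auto
  qed
  have inter: "\<exists>i<n + 1. x i \<and> y i" if "g x" "g y" for x y
  proof (cases "x 0 \<and> y 0")
    case False
    then have "n < w x + w y" using that k unfolding g_def by auto
    then show ?thesis using weight_common[of n "\<lambda>l. x (Suc l)" "\<lambda>l. y (Suc l)"] unfolding w_def by fastforce
  qed auto
  \<comment> \<open>At two points a projection interpolates \<open>g\<close>: if both values are 1,
    the points share a 1; if both are 0, self-duality reduces to that case; if they differ,
    monotonicity gives a coordinate that separates the points in the right direction.\<close>
  have "\<exists>i<n + 1. x i = g x \<and> y i = g y" for x y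
  proof (cases "g x"; cases "g y")
    assume "g x" "g y"
    then show ?thesis using inter by auto
  next
    assume "\<not> g x" "\<not> g y"
    then show ?thesis using inter[of "\<lambda>i. \<not> x i" "\<lambda>i. \<not> y i"] sd by auto
  next
    assume "g x" "\<not> g y"
    then show ?thesis using mono[of x y] by auto
  next
    assume "\<not> g x" "g y"
    then show ?thesis using mono[of y x] by auto
  qed
  then have "\<exists>t. mem C (n + 1) t \<and> t x = g x \<and> t y = g y" for x y
    using clone_proj[OF C] by metis
  then have mem: "mem C (n + 1) g" by (rule maj_interpolation[OF C mj sup])
  have "\<not> g x" if "weight (n + 1) x < k" for x
  proof -
    have "Suc ` {l. l < n \<and> x (Suc l)} \<subseteq> {l. l < n + 1 \<and> x l}" by auto
    from card_mono[OF _ this] have "w x \<le> weight (n + 1) x"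
      unfolding w_def weight_def by (simp add: card_image)
    then show ?thesis using that k by (auto simp: g_def)
  qed
  moreover have "w (\<lambda>_. False) = 0" "w (\<lambda>_. True) = n" by (simp_all add: w_def weight_def)
  ultimately have "steep k n g" using sup k unfolding steep_def by (auto simp: g_def w_def)
  then show ?thesis using mem by blast
qed

lemma uncountable_interval_clone:
  assumes C1: "minor_closed C1" and C: "boolean_clone C2" and "C1 \<subseteq> C2"
    and not: "\<not> C2 \<subseteq> V_class" "\<not> C2 \<subseteq> Lambda_class" "\<not> C2 \<subseteq> L_class"
    and f: "mem C2 p f" "\<not> mem C1 p f" "f y \<noteq> f y'"
  shows "\<not> countable (class_interval C1 C2)"
proof -
  note C' = cloneD[OF C]
  consider "mem C2 3 maj3" | "mem C2 3 and_or3" | "mem (dual C2) 3 and_or3"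
    using clone_trichotomy[OF C not] by blast
  then show ?thesis
  proof cases
    case 1
    show ?thesis
      by (rule uncountable_interval_by_steep[where f = f and y = y and y' = y', OF C1 C'(1,2) assms(3) f]) (rule steep_from_maj[OF C 1])
  next
    case 2
    show ?thesis
      by (rule uncountable_interval_by_steep[where f = f and y = y and y' = y', OF C1 C'(1,2) assms(3) f]) (rule steep_from_and_or[OF C 2])
  next
    case 3
    have d: "boolean_clone (dual C2)" using boolean_clone_dual[OF C] .
    have "\<not> countable (class_interval (dual C1) (dual C2))"
    proof (rule uncountable_interval_by_steep[OF minor_closed_dual[OF C1] cloneD(1,2)[OF d] dual_mono[OF assms(3)]])
      show "mem (dual C2) p (dual_op f)" "\<not> mem (dual C1) p (dual_op f)" using f by (simp_all add: mem_dual)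
      show "dual_op f (\<lambda>i. \<not> y i) \<noteq> dual_op f (\<lambda>i. \<not> y' i)" using f(3) by (simp add: dual_op_def)
    qed (rule steep_from_and_or[OF d 3])
    then show ?thesis using countable_interval_dual[OF C1 C'(1)] by blast
  qed
qed

section \<open>Monotone clones with constants\<close>

lemma supported_eqI:
  assumes "supported n F" "supported n G" "\<And>A. A \<subseteq> {..<n} \<Longrightarrow> F (\<lambda>i. i \<in> A) = G (\<lambda>i. i \<in> A)"
  shows "F = G"
proof
  fix x
  have "F x = F (\<lambda>i. i \<in> {i. i < n \<and> x i})" by (rule supportedD[OF assms(1)]) simp
  also have "\<dots> = G (\<lambda>i. i \<in> {i. i < n \<and> x i})" by (rule assms(3)) auto
  also have "\<dots> = G x" by (rule supportedD[OF assms(2)]) simp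
  finally show "F x = G x" .
qed

lemma finite_true_points: "finite {x. (\<exists>A. A \<subseteq> {..<n :: nat} \<and> x = (\<lambda>i. i \<in> A)) \<and> F x}"
  by (rule finite_subset[of _ "(\<lambda>A i. i \<in> A) ` Pow {..<n :: nat}"]) auto

text \<open>A \<open>t\<close> below \<open>F\<close> that is 1 at all the finitely many true points
  of \<open>F\<close> in the cube is \<open>F\<close>. Asking for one \<open>t\<close> per set of
  points, not per point, avoids closure under disjunction.\<close>

lemma mem_from_below:
  assumes F: "supported n F"
    and below: "\<And>S. finite S \<Longrightarrow> (\<forall>x\<in>S. F x) \<Longrightarrow> \<exists>t. mem C n t \<and> (\<forall>x. t x \<longrightarrow> F x) \<and> (\<forall>x\<in>S. t x)"
  shows "mem C n F"
proof -
  let ?S = "{x. (\<exists>A. A \<subseteq> {..<n} \<and> x = (\<lambda>i. i \<in> A)) \<and> F x}"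
  obtain t where t: "mem C n t" "\<And>x. t x \<Longrightarrow> F x" "\<forall>x\<in>?S. t x"
    using below[OF finite_true_points[of n F]] by blast
  have "t = F"
  proof (rule supported_eqI[OF mem_supported[OF t(1)] F])
    fix A assume "A \<subseteq> {..<n}"
    then show "t (\<lambda>i. i \<in> A) = F (\<lambda>i. i \<in> A)" using t(2) t(3) by blast
  qed
  then show ?thesis using t(1) by simp
qed

text \<open>One-sided Baker-Pixley argument: \<^term>\<open>h\<close> only has to be a near-unanimity function for the value 1.\<close>

lemma mem_by_interpolation_below:
  assumes C: "comp_closed C" and F: "supported n F"
    and h: "mem C (k + 1) h" "\<not> h (\<lambda>_. False)"
    and near: "\<And>z j. j \<le> k \<Longrightarrow> (\<And>i. i \<le> k \<Longrightarrow> i \<noteq> j \<Longrightarrow> z i) \<Longrightarrow> h z"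
    and base: "\<And>S. finite S \<Longrightarrow> card S \<le> k \<Longrightarrow> (\<forall>x\<in>S. F x) \<Longrightarrow>
      \<exists>t. mem C n t \<and> (\<forall>x. t x \<longrightarrow> F x) \<and> (\<forall>x\<in>S. t x)"
  shows "mem C n F"
proof (rule mem_from_below[OF F])
  fix S :: "(nat \<Rightarrow> bool) set" assume "finite S" "\<forall>x\<in>S. F x"
  then show "\<exists>t. mem C n t \<and> (\<forall>x. t x \<longrightarrow> F x) \<and> (\<forall>x\<in>S. t x)"
  proof (induction "card S" arbitrary: S rule: less_induct)
    case less
    show ?case
    proof (cases "card S \<le> k")
      case True
      then show ?thesis using base less by blast
    next
      case False
      then obtain B where B: "B \<subseteq> S" "card B = k + 1"
        using obtain_subset_with_card_n[of "k + 1" S] by auto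
      then obtain s where s: "bij_betw s {0..<k + 1} B"
        using ex_bij_betw_nat_finite[of B] less(2) finite_subset by metis
      \<comment> \<open>The j-th interpolant may fail only at \<open>s j\<close>. Applying
        \<open>h\<close> to all of them stays below \<open>F\<close> because \<open>h\<close> is 0
        at the zero point, and at each point of \<open>S\<close> at most one argument of
        \<open>h\<close> is 0.\<close>
      have "\<exists>t. mem C n t \<and> (\<forall>x. t x \<longrightarrow> F x) \<and> (\<forall>x\<in>S - {s j}. t x)" if "j \<le> k" for j
      proof -
        have "s j \<in> B" using bij_betwE[OF s] that by simp
        then have "s j \<in> S" using B by blast
        then have "card (S - {s j}) < card S" using less(2) by (meson card_Diff1_less)
        then show ?thesis using less by simp
      qed
      then obtain t where t: "\<And>j. j \<le> k \<Longrightarrow> mem C n (t j)" "\<And>j x. j \<le> k \<Longrightarrow> t j x \<Longrightarrow> F x"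
        "\<And>j x. j \<le> k \<Longrightarrow> x \<in> S \<Longrightarrow> x \<noteq> s j \<Longrightarrow> t j x" by (metis DiffI singletonD)
      have 1: "mem C n (\<lambda>x. h (\<lambda>i. t i x))" by (rule compI[OF C h(1)]) (use t(1) in simp)
      have 2: "F x" if hx: "h (\<lambda>i. t i x)" for x
      proof (rule ccontr)
        assume "\<not> F x"
        then have "h (\<lambda>i. t i x) = h (\<lambda>_. False)"
          by (intro supportedD[OF mem_supported[OF h(1)]]) (use t(2)[of _ x] \<open>\<not> F x\<close> in \<open>auto simp: less_Suc_eq_le\<close>)
        then show False using h(2) hx by simp
      qed
      have 3: "h (\<lambda>i. t i x)" if x: "x \<in> S" for x
      proof (cases "\<exists>j\<le>k. x = s j")
        case True
        then obtain j where j: "j \<le> k" "x = s j" by blast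
        show ?thesis
        proof (rule near[OF j(1)])
          fix i assume i: "i \<le> k" "i \<noteq> j"
          then have "s i \<noteq> s j" using s j(1) by (auto simp: bij_betw_def inj_on_def)
          then show "t i x" using t(3)[OF i(1) x] j(2) by simp
        qed
      next
        case False
        then show ?thesis by (intro near[of 0]) (use t(3) x in auto)
      qed
      show ?thesis using 1 2 3 by (intro exI[of _ "\<lambda>x. h (\<lambda>i. t i x)"]) blast
    qed
  qed
qed

lemma interpolant_below:
  assumes C: "boolean_clone C" "mem C 3 and_or3" and F: "mem Mc_class n F"
    and S: "finite S" "\<forall>x\<in>S. F x" and i: "i < n" "\<forall>x\<in>S. x i"
  shows "\<exists>t. mem C n t \<and> (\<forall>x. t x \<longrightarrow> F x) \<and> (\<forall>x\<in>S. t x)"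
proof -
  have sup: "supported n F" and mono: "\<And>x y. (\<forall>i. x i \<longrightarrow> y i) \<Longrightarrow> F x \<Longrightarrow> F y" and top: "F (\<lambda>_. True)"
    using F unfolding mem_Mc_class mem_M_class mem_Tc_class by blast+
  \<comment> \<open>The interpolant is a disjunction over the points of \<open>S\<close> of the
    conjunctions of their true variables, guarded by \<open>x i\<close>. Inserting
    \<open>{..<n}\<close> keeps \<open>A\<close> nonempty if \<open>S\<close> is empty, and is
    harmless since \<open>F\<close> is 1 at the top.\<close>
  define A where "A = insert {..<n} ((\<lambda>x. {j. j < n \<and> x j}) ` S)"
  let ?t = "\<lambda>x. x i \<and> (\<exists>a\<in>A. \<forall>j\<in>a. x j)"
  have "mem C n ?t" by (rule mem_and_monotone[OF C i(1)]) (use S in \<open>auto simp: A_def\<close>)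
  moreover have "F y" if y: "?t y" for y
  proof -
    obtain a where a: "a \<in> A" "\<forall>j\<in>a. y j" using y by blast
    have "\<exists>x. F x \<and> (\<forall>j<n. x j \<longrightarrow> y j)"
      using a(1) unfolding A_def
    proof
      assume "a = {..<n}"
      then show ?thesis using top a(2) by auto
    next
      assume "a \<in> (\<lambda>x. {j. j < n \<and> x j}) ` S"
      then show ?thesis using S(2) a(2) by auto
    qed
    then obtain x where x: "F x" "\<forall>j<n. x j \<longrightarrow> y j" by blast
    have "F (\<lambda>j. x j \<or> y j)" by (rule mono[OF _ x(1)]) simp
    moreover have "F (\<lambda>j. x j \<or> y j) = F y" by (rule supportedD[OF sup]) (use x(2) in auto)
    ultimately show ?thesis by simp
  qed
  moreover have "?t x" if "x \<in> S" for x using that i(2) unfolding A_def by auto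
  ultimately show ?thesis by blast
qed

text \<open>\<open>h\<close> reduces interpolation to at most \<open>k\<close> true points, and
  \<open>interpolant_below\<close> needs a common coordinate of these. Rank \<open>k\<close>
  provides it; for \<open>k = 1\<close> it exists because a single true point is not the zero
  point.\<close>

lemma mem_U_Mc:
  assumes C: "boolean_clone C" "mem C 3 and_or3" and F: "mem Mc_class n F"
    and h: "mem C (k + 1) h" "\<not> h (\<lambda>_. False)"
    and near: "\<And>z j. j \<le> k \<Longrightarrow> (\<And>i. i \<le> k \<Longrightarrow> i \<noteq> j \<Longrightarrow> z i) \<Longrightarrow> h z"
    and k: "1 \<le> k" "2 \<le> k \<Longrightarrow> mem (U_class k) n F"
  shows "mem C n F"
proof (rule mem_by_interpolation_below[OF cloneD(2)[OF C(1)] _ h near])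
  have F': "supported n F" "\<not> F (\<lambda>_. False)" "1 \<le> n" using F unfolding mem_Mc_class mem_Tc_class by blast+
  show "supported n F" by (rule F'(1))
  fix S :: "(nat \<Rightarrow> bool) set" assume S: "finite S" "card S \<le> k" "\<forall>x\<in>S. F x"
  have "\<exists>i<n. \<forall>x\<in>S. x i"
  proof (cases "2 \<le> k")
    case True
    from k(2)[OF this] show ?thesis using S unfolding U_class_def mem_separating by (metis (full_types))
  next
    case False
    then have "card S \<le> Suc 0" using S(2) by linarith
    then have one: "x = y" if "x \<in> S" "y \<in> S" for x y using card_le_Suc0_iff_eq[OF S(1)] that by blast
    show ?thesis
    proof (cases "S = {}")
      case True
      then show ?thesis using F'(3) by (intro exI[of _ 0]) auto
    next
      case False
      then obtain x where x: "x \<in> S" by blast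
      have "\<exists>i<n. x i"
      proof (rule ccontr)
        assume "\<not> ?thesis"
        then have "F x = F (\<lambda>_. False)" by (intro supportedD[OF F'(1)]) simp
        then show False using F'(2) S(3) x by simp
      qed
      then show ?thesis using one x by blast
    qed
  qed
  then show "\<exists>t. mem C n t \<and> (\<forall>x. t x \<longrightarrow> F x) \<and> (\<forall>x\<in>S. t x)"
    using interpolant_below[OF C F S(1,3)] by blast
qed

lemma mem_U_inf: "mem U_inf n F \<longleftrightarrow> (\<forall>k\<ge>2. mem (U_class k) n F)"
proof -
  have "mem (U_class 2) n F \<Longrightarrow> supported n F" by (rule mem_supported)
  then show ?thesis unfolding mem_def U_inf_def by auto
qed

lemma mem_U_inf_Mc:
  assumes C: "boolean_clone C" "mem C 3 and_or3" and F: "mem Mc_class n F" "mem U_inf n F"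
  shows "mem C n F"
proof (rule mem_from_below)
  show "supported n F" using mem_supported F(1) .
  fix S :: "(nat \<Rightarrow> bool) set" assume S: "finite S" "\<forall>x\<in>S. F x"
  \<comment> \<open>Adding 2 keeps the rank at least 2 for small \<open>S\<close>.\<close>
  have "mem (U_class (card S + 2)) n F" using F(2) mem_U_inf by simp
  moreover have "card S \<le> card S + 2" by simp
  ultimately obtain i where "i < n" "\<forall>x\<in>S. x i"
    using S unfolding U_class_def mem_separating by (metis (full_types))
  then show "\<exists>t. mem C n t \<and> (\<forall>x. t x \<longrightarrow> F x) \<and> (\<forall>x\<in>S. t x)"
    using interpolant_below[OF C F(1) S] by blast
qed

text \<open>Assign to every variable one of the separating-free true points at which it is 0, and
  identify variables with the same point. If all arguments except the j-th are 1, the substituted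
  point lies above the j-th true point, so \<open>h\<close> is 1 by monotonicity.\<close>

lemma near_unanimity_from_not_U:
  assumes C: "minor_closed C" and F: "mem C n F" "mem M_class n F" "\<not> F (\<lambda>_. False)"
    and not: "\<not> mem (U_class (k + 1)) n F"
  obtains h where "mem C (k + 1) h" "\<not> h (\<lambda>_. False)"
    "\<And>z j. j \<le> k \<Longrightarrow> (\<And>i. i \<le> k \<Longrightarrow> i \<noteq> j \<Longrightarrow> z i) \<Longrightarrow> h z"
proof -
  have sup: "supported n F" and n: "1 \<le> n" and mono: "\<And>x y. (\<forall>i. x i \<longrightarrow> y i) \<Longrightarrow> F x \<Longrightarrow> F y"
    using F(2) unfolding mem_M_class by blast+
  obtain S where S: "finite S" "card S \<le> k + 1" "\<forall>x\<in>S. F x" "\<not> (\<exists>i<n. \<forall>x\<in>S. x i)"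
    using not sup n unfolding U_class_def mem_separating by auto
  have ne: "card S > 0" using S(1,4) n by (auto simp: card_gt_0_iff)
  obtain e where e: "bij_betw e {0..<card S} S" using ex_bij_betw_nat_finite[OF S(1)] by blast
  \<comment> \<open>\<open>S\<close> may have fewer than \<open>k + 1\<close> points; the list is
    padded with its first point.\<close>
  define s where "s j = e (if j < card S then j else 0)" for j
  have sS: "F (s j)" for j using bij_betwE[OF e] ne S(3) by (auto simp: s_def)
  have "\<exists>j\<le>k. \<not> s j i" if i: "i < n" for i
  proof -
    obtain x where x: "x \<in> S" "\<not> x i" using S(4) i by blast
    then obtain j where "j < card S" "x = e j" using bij_betw_imp_surj_on[OF e] by force
    then show ?thesis using S(2) x by (intro exI[of _ j]) (auto simp: s_def)
  qed
  then obtain J where J: "\<And>i. i < n \<Longrightarrow> J i \<le> k" "\<And>i. i < n \<Longrightarrow> \<not> s (J i) i" by metis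
  show thesis
  proof (rule that[of "\<lambda>z. F (\<lambda>i. z (J i))"])
    show "mem C (k + 1) (\<lambda>z. F (\<lambda>i. z (J i)))" by (rule minorI[OF C F(1)]) (use J(1) in \<open>simp add: less_Suc_eq_le\<close>)
    show "\<not> F (\<lambda>i. False)" by (rule F(3))
    fix z j assume z: "j \<le> k" "\<And>i. i \<le> k \<Longrightarrow> i \<noteq> j \<Longrightarrow> z i"
    have "F (\<lambda>i. s j i \<or> z (J i))" by (rule mono[OF _ sS[of j]]) simp
    moreover have "F (\<lambda>i. s j i \<or> z (J i)) = F (\<lambda>i. z (J i))"
      by (rule supportedD[OF sup]) (use J z(2) in metis)
    ultimately show "F (\<lambda>i. z (J i))" by simp
  qed
qed

text \<open>It suffices to find a nonconstant member of \<open>C2\<close> that is 0 at both constant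
  points: by \<open>gap\<close> it lies in \<open>C1\<close>, and so does its diagonal, the constant
  0. Nonmonotonicity gives a binary \<open>v\<close> with v(1,0) = 1 and v(1,1) = 0. If v(0,0) = 0,
  this is it; otherwise the diagonal of \<open>v\<close> is negation, and the difference of two
  variables can be built.\<close>

lemma clone_constant_gap_monotone:
  assumes C1: "minor_closed C1" and C: "boolean_clone C2"
    and not: "\<not> C2 \<subseteq> V_class" "\<not> C2 \<subseteq> Lambda_class" "\<not> C2 \<subseteq> L_class"
    and gap: "\<And>n F y y'. mem C2 n F \<Longrightarrow> F y \<noteq> F y' \<Longrightarrow> mem C1 n F"
    and zero: "mem C2 m (\<lambda>_. False)" "\<not> mem C1 m (\<lambda>_. False)"
  shows "C2 \<subseteq> M_class"
proof (rule ccontr)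
  assume "\<not> ?thesis"
  note C' = cloneD[OF C]
  have m: "1 \<le> m" using mem_pos[OF C'(3) zero(1)] .
  have z: "mem C2 n (\<lambda>_. False)" if "1 \<le> n" for n
    using mem_const_diag[OF C'(1) zero(1), of False n] that by simp
  obtain n F where F: "mem C2 n F" "\<not> mem M_class n F" using not_subset_mem[OF C'(3) \<open>\<not> C2 \<subseteq> M_class\<close>] .
  then obtain x y where xy: "\<And>i. x i \<Longrightarrow> y i" "F x" "\<not> F y"
    using mem_supported mem_pos[OF C'(3)] unfolding mem_M_class by blast
  define v where "v = (\<lambda>z. F (\<lambda>i. (if x i then \<lambda>z. z 0 else if y i then \<lambda>z. z 1 else (\<lambda>_. False)) (z :: nat \<Rightarrow> bool)))"
  have v: "mem C2 2 v"
    unfolding v_def by (rule compI[OF C'(2) F(1)]) (use clone_proj[OF C] z in auto)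
  have "v (\<lambda>i. i = 0) = F x" unfolding v_def by (rule arg_cong[where f = F]) auto
  then have vx: "v (\<lambda>i. i = 0)" using xy(2) by simp
  have vT: "v (\<lambda>_. True) = F y" unfolding v_def by (rule arg_cong[where f = F]) (use xy in auto)
  have "v (\<lambda>i. i = 0) \<noteq> v (\<lambda>_. True)" using vx xy(3) unfolding vT by simp
  then have v1: "mem C1 2 v" by (rule gap[OF v])
  show False
  proof (cases "v (\<lambda>_. False)")
    case False
    from mem_const_diag[OF C1 v1, of False m] show False using False vT xy m zero(2) by simp
  next
    case True
    have "v (\<lambda>_. b) = (\<not> b)" for b using True vT xy(3) by (cases b) simp_all
    then have neg: "mem C2 1 (\<lambda>z. \<not> z 0)" using mem_diag[OF C'(1) v, of 0 1] by simp
    have neg1: "mem C2 2 (\<lambda>z. \<not> z 1)" using comp1[OF C'(2) neg clone_proj[OF C]] by simp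
    have p0: "mem C2 2 (\<lambda>z. z 0)" using clone_proj[OF C] by simp
    have z2: "mem C2 2 (\<lambda>_. False)" using z by simp
    have "mem C2 2 (\<lambda>z. z 0 \<and> \<not> z 1)"
    proof -
      consider "mem C2 3 maj3" | "mem C2 3 and_or3" | "mem (dual C2) 3 and_or3"
        using clone_trichotomy[OF C not] by blast
      then show ?thesis
      proof cases
        case 1
        from comp3[OF C'(2), of "\<lambda>a b c. (a \<and> b) \<or> (a \<and> c) \<or> (b \<and> c)", OF 1 p0 neg1 z2]
        show ?thesis by simp
      next
        case 2
        from comp3[OF C'(2), of "\<lambda>a b c. a \<and> (b \<or> c)", OF 2 p0 neg1 z2]
        show ?thesis by simp
      next
        case 3
        then have "mem C2 3 (\<lambda>z. z 0 \<or> (z 1 \<and> z 2))" by (simp add: mem_dual dual_op_def)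
        from comp3[OF C'(2), of "\<lambda>a b c. a \<or> (b \<and> c)", OF this z2 p0 neg1]
        show ?thesis by simp
      qed
    qed
    from gap[OF this, of "\<lambda>i. i = 0" "\<lambda>_. False"] have "mem C1 2 (\<lambda>z. z 0 \<and> \<not> z 1)" by simp
    from mem_const_diag[OF C1 this, of False m] show False using m zero(2) by simp
  qed
qed

text \<open>With the constant 0 each alternative of \<open>clone_trichotomy\<close> gives
  conjunction, hence \<open>and_or3\<close>. \<open>D\<close> is \<open>U_inf\<close> if all ranks
  hold on \<open>C2\<close>, \<open>U_class k\<close> if \<open>k + 1\<close> is the first failing
  rank, and \<open>Omega\<close> if rank 2 fails or the constant 1 is present. Interpolation puts
  the members of \<open>D\<close> in \<open>Mc_class\<close> into \<open>C2\<close>; they are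
  nonconstant, so \<open>gap\<close> puts them into \<open>C1\<close>.\<close>

lemma clone_constant_gap:
  assumes C1: "minor_closed C1" and C: "boolean_clone C2"
    and not: "\<not> C2 \<subseteq> V_class" "\<not> C2 \<subseteq> Lambda_class" "\<not> C2 \<subseteq> L_class"
    and gap: "\<And>n F y y'. mem C2 n F \<Longrightarrow> F y \<noteq> F y' \<Longrightarrow> mem C1 n F"
    and zero: "mem C2 m (\<lambda>_. False)" "\<not> mem C1 m (\<lambda>_. False)"
  shows "\<exists>D \<in> {U_class m | m. m \<ge> 2} \<union> {Omega, U_inf}. D \<inter> Mc_class \<subseteq> C1 \<and> C2 \<subseteq> D \<inter> M_class"
proof -
  note C' = cloneD[OF C]
  have M: "C2 \<subseteq> M_class" by (rule clone_constant_gap_monotone[OF C1 C not gap zero])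
  have MO: "D \<inter> Mc_class \<subseteq> Omega" for D using M_class_Omega by (auto simp: Mc_class_def)
  have z: "mem C2 n (\<lambda>_. False)" if "1 \<le> n" for n
    using mem_const_diag[OF C'(1) zero(1), of False n] that by simp
  have p: "mem C2 2 (\<lambda>z. z 0)" "mem C2 2 (\<lambda>z. z 1)" "mem C2 2 (\<lambda>_. False)" using clone_proj[OF C] z by simp_all
  have "mem C2 2 (\<lambda>z. z 0 \<and> z 1)"
  proof -
    consider "mem C2 3 maj3" | "mem C2 3 and_or3" | "mem (dual C2) 3 and_or3"
      using clone_trichotomy[OF C not] by blast
    then show ?thesis
    proof cases
      case 1
      from comp3[OF C'(2), of "\<lambda>a b c. (a \<and> b) \<or> (a \<and> c) \<or> (b \<and> c)", OF 1 p]
      show ?thesis by simp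
    next
      case 2
      from comp3[OF C'(2), of "\<lambda>a b c. a \<and> (b \<or> c)", OF 2 p]
      show ?thesis by simp
    next
      case 3
      then have "mem C2 3 (\<lambda>z. z 0 \<or> (z 1 \<and> z 2))" by (simp add: mem_dual dual_op_def)
      from comp3[OF C'(2), of "\<lambda>a b c. a \<or> (b \<and> c)", OF this p(3,1,2)]
      show ?thesis by simp
    qed
  qed
  then have ao: "mem C2 3 and_or3" by (rule nonconjunctive_clone[OF C _ not(2)])
  have sub: "D \<inter> Mc_class \<subseteq> C1" if D: "\<And>n F. mem D n F \<Longrightarrow> mem Mc_class n F \<Longrightarrow> mem C2 n F" for D
  proof (rule subset_via_mem[OF MO])
    fix n F assume "mem (D \<inter> Mc_class) n F"
    then have F: "mem D n F" "mem Mc_class n F" by (auto simp: mem_Int)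
    then have "F (\<lambda>_. True) \<noteq> F (\<lambda>_. False)" by (simp add: mem_Mc_class mem_Tc_class)
    from gap[OF D[OF F] this] show "mem C1 n F" .
  qed
  \<comment> \<open>The case \<open>k = 1\<close> of the interpolation: a binary \<open>h\<close>
    that is 1 as soon as one argument is 1.\<close>
  have Om: "?thesis" if h: "mem C2 (1 + 1) h" "\<not> h (\<lambda>_. False)"
    "\<And>z j. j \<le> 1 \<Longrightarrow> (\<And>i. i \<le> 1 \<Longrightarrow> i \<noteq> j \<Longrightarrow> z i) \<Longrightarrow> h z" for h
  proof -
    have "Omega \<inter> Mc_class \<subseteq> C1"
      by (rule sub) (rule mem_U_Mc[OF C ao _ h], simp_all)
    moreover have "C2 \<subseteq> Omega \<inter> M_class" using M C'(3) by blast
    ultimately show ?thesis by blast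
  qed
  show ?thesis
  proof (cases "mem C2 1 (\<lambda>_. True)")
    case True
    have "mem C2 2 (\<lambda>_. True)" using mem_const_diag[OF C'(1) True, of True 2] by simp
    from comp3[OF C'(2), of "\<lambda>a b c. a \<and> (b \<or> c)", OF ao this p(1,2)]
    have "mem C2 (1 + 1) (\<lambda>z. z 0 \<or> z 1)" by (simp add: numeral_2_eq_2)
    then show ?thesis
    proof (rule Om)
      fix z :: "nat \<Rightarrow> bool" and j :: nat assume "j \<le> 1" "\<And>i. i \<le> 1 \<Longrightarrow> i \<noteq> j \<Longrightarrow> z i"
      then show "z 0 \<or> z 1" by (cases "j = 0") auto
    qed simp
  next
    case no1: False
    have F0: "\<not> F (\<lambda>_. False)" if F: "mem C2 n F" for n F
    proof
      assume "F (\<lambda>_. False)"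
      moreover have "mem M_class n F" using mem_mono[OF M F] .
      ultimately have "F (\<lambda>_. True)"
        unfolding mem_M_class by (elim conjE allE[of _ "\<lambda>_. False"] allE[of _ "\<lambda>_. True"]) simp
      then show False using no1 mem_const_diag[OF C'(1) F, of True 1] \<open>F (\<lambda>_. False)\<close> by simp
    qed
    show ?thesis
    proof (cases "\<forall>k\<ge>2. C2 \<subseteq> U_class k")
      case True
      then have "C2 \<subseteq> U_inf \<inter> M_class" using M by (auto simp: U_inf_def)
      moreover have "U_inf \<inter> Mc_class \<subseteq> C1" by (rule sub) (rule mem_U_inf_Mc[OF C ao])
      ultimately show ?thesis by blast
    next
      case False
      define l where "l = (LEAST k. k \<ge> 2 \<and> \<not> C2 \<subseteq> U_class k)"
      have l: "l \<ge> 2 \<and> \<not> C2 \<subseteq> U_class l" unfolding l_def by (rule LeastI_ex) (use False in blast)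
      have lmin: "C2 \<subseteq> U_class k" if "k \<ge> 2" "k < l" for k
        using not_less_Least[OF that(2)[unfolded l_def]] that(1) by blast
      obtain k where k: "l = k + 1" "1 \<le> k" using l by (cases l) auto
      obtain n F where F: "mem C2 n F" "\<not> mem (U_class (k + 1)) n F"
        using not_subset_mem[OF C'(3)] l k(1) by metis
      obtain h where h: "mem C2 (k + 1) h" "\<not> h (\<lambda>_. False)"
        "\<And>z j. j \<le> k \<Longrightarrow> (\<And>i. i \<le> k \<Longrightarrow> i \<noteq> j \<Longrightarrow> z i) \<Longrightarrow> h z"
        using near_unanimity_from_not_U[OF C'(1) F(1) mem_mono[OF M F(1)] F0[OF F(1)] F(2)] by blast
      show ?thesis
      proof (cases "2 \<le> k")
        case True
        have "U_class k \<inter> Mc_class \<subseteq> C1"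
          by (rule sub) (rule mem_U_Mc[OF C ao _ h k(2)], simp_all)
        moreover have "C2 \<subseteq> U_class k \<inter> M_class" using M lmin[OF True] k by simp
        ultimately show ?thesis using True by blast
      next
        case False
        then have "k = 1" using k by simp
        then show ?thesis using Om[of h] h by simp
      qed
    qed
  qed
qed

section \<open>Idempotent classes without projections\<close>

lemma mem_L_dual_op: "mem L_class n F \<Longrightarrow> mem L_class n (dual_op F)"
proof -
  assume "mem L_class n F"
  then obtain c I where n: "1 \<le> n" and I: "I \<subseteq> {..<n}" and F: "F = (\<lambda>x. c \<noteq> odd (card {i \<in> I. x i}))"
    unfolding mem_L_class by blast
  have fin: "finite I" using I finite_subset by blast
  have "dual_op F x = ((c = odd (card I)) \<noteq> odd (card {i \<in> I. x i}))" for x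
  proof -
    have "card {i \<in> I. \<not> x i} + card {i \<in> I. x i} = card ({i \<in> I. \<not> x i} \<union> {i \<in> I. x i})"
      by (rule card_Un_disjoint[symmetric]) (use fin in auto)
    also have "{i \<in> I. \<not> x i} \<union> {i \<in> I. x i} = I" by auto
    finally have "odd (card {i \<in> I. \<not> x i} + card {i \<in> I. x i}) = odd (card I)" by (rule arg_cong)
    then have "odd (card I) = (odd (card {i \<in> I. \<not> x i}) \<noteq> odd (card {i \<in> I. x i}))"
      unfolding odd_add by (rule sym)
    then show ?thesis unfolding F dual_op_def by auto
  qed
  then have "dual_op F = (\<lambda>x. (c = odd (card I)) \<noteq> odd (card {i \<in> I. x i}))" by (rule ext)
  then show ?thesis unfolding mem_L_class using n I by blast
qed

text \<open>Shannon expansion in the last variable. \<open>R\<close> is abstract because it will be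
  instantiated with membership relative to a guard.\<close>

lemma boolean_combination:
  assumes "\<And>F. R F \<Longrightarrow> R (\<lambda>x. \<not> F x)" "\<And>F G. R F \<Longrightarrow> R G \<Longrightarrow> R (\<lambda>x. F x \<and> G x)" "R (\<lambda>_. True)"
    and "\<And>i. i < n \<Longrightarrow> R (G i)" "supported n \<Psi>"
  shows "R (\<lambda>x. \<Psi> (\<lambda>i. G i x))"
  using assms(4,5)
proof (induction n arbitrary: \<Psi>)
  case 0
  then have eq: "(\<lambda>x. \<Psi> (\<lambda>i. G i x)) = (\<lambda>_. \<Psi> (\<lambda>_. False))" by (auto simp: supported_def)
  show ?case unfolding eq using assms(3) assms(1)[OF assms(3)] by (cases "\<Psi> (\<lambda>_. False)") simp_all
next
  case (Suc n)
  have "supported n (\<lambda>z. \<Psi> (z(n := b)))" for b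
    using Suc.prems(2) unfolding supported_def by (simp add: less_Suc_eq)
  then have 1: "R (\<lambda>x. \<Psi> ((\<lambda>i. G i x)(n := b)))" for b
    using Suc.IH[of "\<lambda>z. \<Psi> (z(n := b))"] Suc.prems(1) by simp
  have 2: "R (\<lambda>x. F x \<or> G x)" if "R F" "R G" for F G
    using assms(1)[OF assms(2)[OF assms(1)[OF that(1)] assms(1)[OF that(2)]]] by simp
  have "R (\<lambda>x. (G n x \<and> \<Psi> ((\<lambda>i. G i x)(n := True))) \<or> (\<not> G n x \<and> \<Psi> ((\<lambda>i. G i x)(n := False))))"
    by (intro 2 assms(2) 1 assms(1) Suc.prems(1)) simp_all
  moreover have "(G n x \<and> \<Psi> ((\<lambda>i. G i x)(n := True))) \<or> (\<not> G n x \<and> \<Psi> ((\<lambda>i. G i x)(n := False))) \<longleftrightarrow> \<Psi> (\<lambda>i. G i x)" for x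
  proof -
    have "(\<lambda>i. G i x)(n := b) = (\<lambda>i. G i x)" if "G n x = b" for b
      by (rule fun_upd_idem) (rule that)
    then show ?thesis by (cases "G n x") simp_all
  qed
  ultimately show ?case by simp
qed

section \<open>Guarded Pippenger functions\<close>

definition pippenger :: "nat \<Rightarrow> (nat \<Rightarrow> bool) \<Rightarrow> bool" where
  "pippenger n y \<longleftrightarrow> weight n y = 1 \<or> weight n y = n - 1"

text \<open>The binary functions that are 0 at both constant points and 1 at (1,0): difference if
  \<open>c\<close> is false, sum mod 2 if \<open>c\<close> is true. Both return \<open>u\<close>
  when \<open>v\<close> is 0.\<close>

definition twist :: "bool \<Rightarrow> bool \<Rightarrow> bool \<Rightarrow> bool" where
  "twist c u v = (if u then \<not> v else v \<and> c)"

text \<open>In place of the variable \<open>x i\<close> stands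
  \<open>twist c (x i) (x (p + 1))\<close>, with \<open>x (p + 1)\<close> in the role of 0. The
  guard \<open>twist c (x p) (x (p + 1))\<close> plays the role of 1.\<close>

definition guarded :: "bool \<Rightarrow> ((nat \<Rightarrow> bool) \<Rightarrow> bool) \<Rightarrow> nat \<Rightarrow> nat \<Rightarrow> (nat \<Rightarrow> bool) \<Rightarrow> bool" where
  "guarded c f p n x \<longleftrightarrow> f x \<and> \<not> (twist c (x p) (x (p + 1)) \<and>
     pippenger n (\<lambda>i. twist c (x (p + 2 + i)) (x (p + 1))))"

lemma supported_pippenger: "supported n (pippenger n)"
  unfolding supported_def pippenger_def using weight_cong by metis

lemma mem_guarded:
  assumes C: "minor_closed C" "comp_closed C" and f: "mem C p f"
    and tw: "mem C 2 (\<lambda>z. twist c (z 0) (z 1))"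
    and diff: "\<And>n F G. mem C n F \<Longrightarrow> mem C n G \<Longrightarrow> mem C n (\<lambda>x. F x \<and> \<not> G x)"
  shows "mem C (p + 2 + n) (guarded c f p n)"
proof -
  let ?N = "p + 2 + n"
  have f': "mem C ?N f" using minorI[OF C(1) f, of "\<lambda>i. i" ?N] by simp
  have tw': "mem C ?N (\<lambda>x. twist c (x a) (x b))" if "a < ?N" "b < ?N" for a b
    using minorI[OF C(1) tw, of "\<lambda>i. if i = 0 then a else b" ?N] that by simp
  let ?U = "\<lambda>x :: nat \<Rightarrow> bool. twist c (x p) (x (p + 1))"
  have U: "mem C ?N ?U" by (rule tw') simp_all
  \<comment> \<open>Under \<open>?R\<close>, subtraction from the guard \<open>?U\<close> acts as
    negation, so \<open>?R\<close> is closed under all Boolean operations.\<close>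
  let ?R = "\<lambda>F. mem C ?N (\<lambda>x. ?U x \<and> F x)"
  have neg: "?R (\<lambda>x. \<not> F x)" if "?R F" for F
    using diff[OF U that] by (rule back_subst[of "mem C ?N"]) auto
  have "?R (\<lambda>x. pippenger n (\<lambda>i. twist c (x (p + 2 + i)) (x (p + 1))))"
  proof (rule boolean_combination[where R = ?R and n = n and \<Psi> = "pippenger n"
        and G = "\<lambda>i x. twist c (x (p + 2 + i)) (x (p + 1))"])
    show "?R (\<lambda>x. F x \<and> G x)" if "?R F" "?R G" for F G
      using diff[OF that(1) neg[OF that(2)]] by (rule back_subst[of "mem C ?N"]) auto
    show "?R (\<lambda>_. True)" using U by simp
    show "?R (\<lambda>x. twist c (x (p + 2 + i)) (x (p + 1)))" if "i < n" for i
    proof -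
      have "mem C ?N (\<lambda>x. twist c (x (p + 2 + i)) (x (p + 1)))" by (rule tw') (use that in simp_all)
      from diff[OF U diff[OF U this]] show ?thesis by (rule back_subst[of "mem C ?N"]) auto
    qed
  qed (rule neg supported_pippenger, assumption?)+
  from diff[OF f' this] show ?thesis by (rule back_subst[of "mem C ?N"]) (auto simp: guarded_def)
qed

text \<open>Sending all added variables to variable 0 makes the guard \<open>twist c u u\<close>,
  which is 0, so nothing is removed from \<open>f\<close>.\<close>

lemma guarded_minor:
  assumes C: "minor_closed C" and f: "supported p f" "1 \<le> p" and "mem C (p + 2 + n) (guarded c f p n)"
  shows "mem C p f"
proof -
  have "mem C p (\<lambda>x. guarded c f p n (\<lambda>l. x (if l < p then l else 0)))"
    by (rule minorI[OF C assms(4)]) (use f(2) in auto)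
  moreover have "guarded c f p n (\<lambda>l. x (if l < p then l else 0)) = f x" for x
  proof -
    have "f (\<lambda>l. x (if l < p then l else 0)) = f x" by (rule supportedD[OF f(1)]) simp
    then show ?thesis by (simp add: guarded_def twist_def)
  qed
  ultimately show ?thesis by simp
qed

text \<open>\<open>c j\<close> counts the variables identified with the j-th free variable, and
  \<open>o'\<close> is the weight contributed by the fixed ones. If \<open>o' = 0\<close>, a fibre
  of size n - 1 would leave no room for the other m - 1 nonempty ones, so all fibres are singletons
  and the set of size m - 1 yields m = n. If \<open>o'\<close> is at least 2, all fibres have size n
  - 1 - \<open>o'\<close>, which is positive, and four of them exceed the total.\<close>

lemma fibre_arithmetic:
  fixes c :: "nat \<Rightarrow> nat" and m n o' :: nat
  assumes "4 \<le> m" "4 \<le> n" "i0 < m"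
    and tot: "o' + (\<Sum>j<m. c j) \<le> n"
    and 0: "o' \<noteq> 1" "o' \<noteq> n - 1"
    and 1: "\<And>j. j < m \<Longrightarrow> o' + c j = 1 \<or> o' + c j = n - 1"
    and 2: "o' + (\<Sum>j\<in>{..<m} - {i0}. c j) = 1 \<or> o' + (\<Sum>j\<in>{..<m} - {i0}. c j) = n - 1"
  shows "m = n"
proof (cases "o' = 0")
  case True
  have ge: "1 \<le> c j" if "j < m" for j using 1[OF that] assms(2) True by auto
  have one: "c j = 1" if j: "j < m" for j
  proof (rule ccontr)
    assume "c j \<noteq> 1"
    then have cj: "c j = n - 1" using 1[OF j] True by simp
    have "(\<Sum>j<m. c j) = c j + (\<Sum>j\<in>{..<m} - {j}. c j)" using j by (simp add: sum.remove)
    moreover have "(\<Sum>i\<in>{..<m} - {j}. 1) \<le> (\<Sum>j\<in>{..<m} - {j}. c j)" by (rule sum_mono) (use ge in auto)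
    moreover have "(\<Sum>i\<in>{..<m} - {j}. 1 :: nat) = m - 1" using j by simp
    ultimately show False using tot cj assms(1,2) by linarith
  qed
  have "(\<Sum>j\<in>{..<m} - {i0}. c j) = (\<Sum>j\<in>{..<m} - {i0}. 1)" by (rule sum.cong) (use one in auto)
  also have "\<dots> = m - 1" using assms(3) by simp
  finally show ?thesis using 2 True assms(1,2) by auto
next
  case False
  then have o2: "2 \<le> o'" using 0 by simp
  have q: "c j = n - 1 - o'" if "j < m" for j using 1[OF that] o2 by auto
  have "(\<Sum>j<m. c j) = (\<Sum>j<m. n - 1 - o')" by (rule sum.cong) (use q in auto)
  then have s: "(\<Sum>j<m. c j) = m * (n - 1 - o')" by simp
  have "o' + c i0 = n - 1" using 1[OF assms(3)] o2 by auto
  then have "o' < n - 1" using 0(2) by linarith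
  then have q: "1 \<le> n - 1 - o'" "n = o' + 1 + (n - 1 - o')" by linarith+
  have "4 * (n - 1 - o') \<le> m * (n - 1 - o')" using assms(1) by (intro mult_right_mono) auto
  then show ?thesis using tot s q by linarith
qed

lemma weight_fibres:
  fixes \<tau> :: "nat \<Rightarrow> nat"
  assumes "\<And>l. l < n \<Longrightarrow> \<tau> l < q + m" "J \<subseteq> {..<m}"
  shows "weight n (\<lambda>l. if \<tau> l < q then b (\<tau> l) else \<tau> l - q \<in> J) =
    weight n (\<lambda>l. \<tau> l < q \<and> b (\<tau> l)) + (\<Sum>j\<in>J. card {l. l < n \<and> \<tau> l = q + j})"
proof -
  have fin: "finite J" by (rule finite_subset[OF assms(2)]) simp
  have "{l. l < n \<and> (if \<tau> l < q then b (\<tau> l) else \<tau> l - q \<in> J)} =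
      {l. l < n \<and> \<tau> l < q \<and> b (\<tau> l)} \<union> (\<Union>j\<in>J. {l. l < n \<and> \<tau> l = q + j})"
    by (auto split: if_splits)
  moreover have "card ({l. l < n \<and> \<tau> l < q \<and> b (\<tau> l)} \<union> (\<Union>j\<in>J. {l. l < n \<and> \<tau> l = q + j})) =
      card {l. l < n \<and> \<tau> l < q \<and> b (\<tau> l)} + card (\<Union>j\<in>J. {l. l < n \<and> \<tau> l = q + j})"
    by (rule card_Un_disjoint) (use fin in auto)
  moreover have "card (\<Union>j\<in>J. {l. l < n \<and> \<tau> l = q + j}) = (\<Sum>j\<in>J. card {l. l < n \<and> \<tau> l = q + j})"
    by (rule card_UN_disjoint) (use fin in auto)
  ultimately show ?thesis by (simp add: weight_def)
qed

lemma weight_set: "J \<subseteq> {..<m} \<Longrightarrow> weight m (\<lambda>i. i \<in> J) = card J"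
  unfolding weight_def by (rule arg_cong[where f = card]) auto

text \<open>
  Fixing a true point of \<^term>\<open>f\<close> and the two guard variables leaves Pippenger's function of \<^term>\<open>m\<close>
  variables on one side. On the other side, all but at most \<^term>\<open>p + 2\<close> of these variables occur in the
  arguments of Pippenger's function of \<^term>\<open>n\<close> variables only, and this forces \<^term>\<open>m = n\<close>.
\<close>

lemma guarded_antichain:
  assumes f: "supported p f" "f a" and mn: "p + 5 \<le> m" "p + 5 \<le> n"
    and \<sigma>: "\<And>l. l < p + 2 + n \<Longrightarrow> \<sigma> l < p + 2 + m"
    and eq: "guarded c f p m = (\<lambda>x. guarded c f p n (\<lambda>l. x (\<sigma> l)))"
  shows "m = n"
proof -
  \<comment> \<open>The fixed part of the point: a true point of \<open>f\<close>, then 1 and 0 for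
    the two guard variables.\<close>
  define b where "b l = (if l < p then a l else l = p)" for l
  define X where "X J l = (if l < p + 2 then b l else l - (p + 2) \<in> J)" for J l
  define V where "V J = weight n (\<lambda>i. X J (\<sigma> (p + 2 + i)))" for J
  \<comment> \<open>The free variables of the left-hand side that the right-hand side uses also in
    \<open>f\<close> or its guards.\<close>
  define B where "B = {j. \<exists>l<p + 2. \<sigma> l = p + 2 + j}"
  define d where "d j = card {l. l < n \<and> \<sigma> (p + 2 + l) = p + 2 + j}" for j
  define o' where "o' = weight n (\<lambda>l. \<sigma> (p + 2 + l) < p + 2 \<and> b (\<sigma> (p + 2 + l)))"
  have V: "V J = o' + (\<Sum>j\<in>J. d j)" if "J \<subseteq> {..<m}" for J
    unfolding V_def X_def o'_def d_def by (rule weight_fibres[OF _ that]) (use \<sigma> in simp)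
  have left: "guarded c f p m (X J) = (\<not> (card J = 1 \<or> card J = m - 1))" if J: "J \<subseteq> {..<m}" for J
  proof -
    have "f (X J) = f a" by (rule supportedD[OF f(1)]) (simp add: X_def b_def)
    moreover have "X J p" "\<not> X J (p + 1)" by (simp_all add: X_def b_def)
    moreover have "(\<lambda>i. twist c (X J (p + 2 + i)) (X J (p + 1))) = (\<lambda>i. i \<in> J)"
      by (rule ext) (simp add: X_def b_def twist_def)
    ultimately show ?thesis using f(2) weight_set[OF J]
      by (simp add: guarded_def pippenger_def twist_def)
  qed
  \<comment> \<open>If \<open>J\<close> and \<open>J'\<close> agree on \<open>B\<close>, the
    right-hand side can distinguish them only through Pippenger's function. As the left-hand side
    does distinguish them, \<open>f\<close> and the guard must be 1, and then \<open>V J\<close>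
    decides the value at \<open>J\<close>.\<close>
  have key: "(card J = 1 \<or> card J = m - 1) \<longleftrightarrow> (V J = 1 \<or> V J = n - 1)"
    if J: "J \<subseteq> {..<m}" "J' \<subseteq> {..<m}" "J \<inter> B = J' \<inter> B"
      and ne: "(card J = 1 \<or> card J = m - 1) \<noteq> (card J' = 1 \<or> card J' = m - 1)" for J J'
  proof -
    let ?x = "\<lambda>J l. X J (\<sigma> l)"
    have agree: "?x J l = ?x J' l" if "l < p + 2" for l
    proof (cases "\<sigma> l < p + 2")
      case False
      then have "\<sigma> l - (p + 2) \<in> B" using that by (auto simp: B_def intro!: exI[of _ l])
      then show ?thesis using J(3) False by (auto simp: X_def)
    qed (simp add: X_def)
    have fa: "f (?x J) = f (?x J')" by (rule supportedD[OF f(1)]) (use agree in simp)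
    have ap: "?x J p = ?x J' p" "?x J (Suc p) = ?x J' (Suc p)" using agree by simp_all
    let ?P = "\<lambda>J. pippenger n (\<lambda>i. twist c (?x J (p + 2 + i)) (?x J (p + 1)))"
    let ?T = "twist c (?x J p) (?x J (p + 1))"
    have r: "(\<not> (card J = 1 \<or> card J = m - 1)) = (f (?x J) \<and> \<not> (?T \<and> ?P J))"
      using left[OF J(1)] unfolding eq by (simp add: guarded_def)
    have r': "(\<not> (card J' = 1 \<or> card J' = m - 1)) = (f (?x J) \<and> \<not> (?T \<and> ?P J'))"
      using left[OF J(2)] unfolding eq by (simp add: guarded_def fa ap)
    have T: "?T" and PJ: "(card J = 1 \<or> card J = m - 1) = ?P J" using r r' ne by argo+
    have "?P J = (V J = 1 \<or> V J = n - 1)"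
    proof (cases "?x J (p + 1)")
      case False
      then have "(\<lambda>i. twist c (?x J (p + 2 + i)) (?x J (p + 1))) = (\<lambda>i. ?x J (p + 2 + i))"
        by (auto simp: twist_def)
      then show ?thesis by (simp add: pippenger_def V_def)
    next
      \<comment> \<open>The variable meant to be 0 has become 1. The guard then holds only if
        \<open>c\<close> is true, in which case \<open>twist\<close> negates all arguments; this
        exchanges the weights 1 and n - 1.\<close>
      case True
      then have "c" using T by (auto simp: twist_def split: if_splits)
      then have "(\<lambda>i. twist c (?x J (p + 2 + i)) (?x J (p + 1))) = (\<lambda>i. \<not> ?x J (p + 2 + i))"
        using True by (auto simp: twist_def)
      then have "?P J = (n - V J = 1 \<or> n - V J = n - 1)" by (simp add: pippenger_def V_def weight_not)
      moreover have "V J \<le> n" unfolding V_def by (rule weight_le)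
      ultimately show ?thesis using mn by auto
    qed
    then show ?thesis using PJ by simp
  qed
  have "B \<subseteq> (\<lambda>l. \<sigma> l - (p + 2)) ` {..<p + 2}" by (force simp: B_def)
  then have "card B \<le> p + 2" using card_mono[of "(\<lambda>l. \<sigma> l - (p + 2)) ` {..<p + 2}" B]
      card_image_le[of "{..<p + 2}" "\<lambda>l. \<sigma> l - (p + 2)"] by simp
  moreover have "finite B" using \<open>B \<subseteq> _\<close> finite_subset by blast
  ultimately have "\<not> {..<m} \<subseteq> B" using card_mono[of B "{..<m}"] mn by auto
  \<comment> \<open>The bound \<open>p + 5\<close> leaves a variable outside \<open>B\<close>. Each
    use of \<open>key\<close> below compares two sets that differ in one variable outside
    \<open>B\<close>, exactly one of them having size 1 or m - 1.\<close>
  then obtain i0 where i0: "i0 < m" "i0 \<notin> B" by auto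
  show ?thesis
  proof (rule fibre_arithmetic[of m n i0 o' d])
    show "4 \<le> m" "4 \<le> n" "i0 < m" using mn i0 by simp_all
    have "V {..<m} \<le> n" unfolding V_def by (rule weight_le)
    then show "o' + (\<Sum>j<m. d j) \<le> n" by (simp add: V)
    have "(card ({} :: nat set) = 1 \<or> card ({} :: nat set) = m - 1) \<longleftrightarrow> (V {} = 1 \<or> V {} = n - 1)"
      by (rule key[of "{}" "{i0}"]) (use i0 mn in auto)
    then show "o' \<noteq> 1" "o' \<noteq> n - 1" using mn by (auto simp: V)
    show "o' + d j = 1 \<or> o' + d j = n - 1" if j: "j < m" for j
    proof -
      have "(card {j} = 1 \<or> card {j} = m - 1) \<longleftrightarrow> (V {j} = 1 \<or> V {j} = n - 1)"
      proof (cases "j \<in> B")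
        case True
        then have "j \<noteq> i0" using i0 by auto
        then show ?thesis by (intro key[of "{j}" "{j, i0}"]) (use i0 mn j in auto)
      next
        case False
        then show ?thesis by (intro key[of "{j}" "{}"]) (use i0 mn j in auto)
      qed
      then show ?thesis using j by (simp add: V)
    qed
    have "(card ({..<m} - {i0}) = 1 \<or> card ({..<m} - {i0}) = m - 1) \<longleftrightarrow>
        (V ({..<m} - {i0}) = 1 \<or> V ({..<m} - {i0}) = n - 1)"
      by (rule key[of _ "{..<m}"]) (use i0 mn in auto)
    then show "o' + (\<Sum>j\<in>{..<m} - {i0}. d j) = 1 \<or> o' + (\<Sum>j\<in>{..<m} - {i0}. d j) = n - 1"
      using i0 by (simp add: V)
  qed
qed

text \<open>The binary minor of \<open>F0\<close> at \<open>a\<close> is the difference or, if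
  \<open>F0\<close> is also 1 at the opposite point, the sum mod 2. In the latter case conjunction
  is extracted from a nonlinear member, and the difference of \<open>F\<close> and \<open>G\<close>
  is the sum of \<open>F\<close> and their conjunction.\<close>

lemma nonclone_difference:
  assumes C: "minor_closed C" "comp_closed C" and L: "\<not> C \<subseteq> L_class"
    and const: "\<And>n F. mem C n F \<Longrightarrow> F (\<lambda>_. False) = F (\<lambda>_. True)"
    and F0: "mem C n0 F0" "\<not> F0 (\<lambda>_. False)" "F0 a"
  shows "\<exists>c. mem C 2 (\<lambda>z. twist c (z 0) (z 1)) \<and>
    (\<forall>n F G. mem C n F \<longrightarrow> mem C n G \<longrightarrow> mem C n (\<lambda>x. F x \<and> \<not> G x))"
proof -
  have O: "C \<subseteq> Omega" using minor_closed_Omega[OF C(1)] .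
  have zero: "mem C n (\<lambda>_. False)" if "1 \<le> n" for n
    using mem_const_diag[OF C(1) F0(1), of False n] F0(2) const[OF F0(1)] that by simp
  let ?c = "F0 (\<lambda>i. \<not> a i)"
  have tw: "mem C 2 (\<lambda>z. twist ?c (z 0) (z 1))"
    by (rule back_subst[of "mem C 2", OF binary_minor[OF C(1) F0(1), of a]])
      (use F0 const[OF F0(1)] in \<open>auto simp: twist_def\<close>)
  show ?thesis
  proof (cases ?c)
    case False
    have d: "mem C 2 (\<lambda>z. z 0 \<and> \<not> z 1)"
      by (rule back_subst[of "mem C 2", OF tw]) (use False in \<open>auto simp: twist_def\<close>)
    have "mem C n (\<lambda>x. F x \<and> \<not> G x)" if "mem C n F" "mem C n G" for n F G
      using comp2[OF C(2), of "\<lambda>a b. a \<and> \<not> b", OF d that] .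
    then show ?thesis using tw by blast
  next
    case True
    have x: "mem C 2 (\<lambda>z. z 0 \<noteq> z 1)"
      by (rule back_subst[of "mem C 2", OF tw]) (use True in \<open>auto simp: twist_def\<close>)
    have plus: "mem C n (\<lambda>x. F x \<noteq> G x)" if "mem C n F" "mem C n G" for n F G
      using comp2[OF C(2), of "\<lambda>a b. a \<noteq> b", OF x that] .
    obtain n F where F: "mem C n F" "\<not> mem L_class n F" using not_subset_mem[OF O L] .
    have n: "1 \<le> n" using mem_pos[OF O F(1)] .
    define A where "A = (\<lambda>x. F (\<lambda>_. False) \<noteq> F x)"
    have "mem C n (\<lambda>_. F (\<lambda>_. False))"
      by (rule mem_const_diag[OF C(1) F(1) refl const[OF F(1), symmetric] n])
    then have A: "mem C n A" unfolding A_def by (rule plus[OF _ F(1)])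
    have "\<not> additive A"
    proof
      assume "additive A"
      then have "mem L_class n (\<lambda>x. F (\<lambda>_. False) \<noteq> A x)" by (rule additive_mem_L[OF mem_supported[OF A] _ n])
      moreover have "(\<lambda>x. F (\<lambda>_. False) \<noteq> A x) = F" by (auto simp: A_def)
      ultimately show False using F(2) by simp
    qed
    then obtain x y where xy: "A (\<lambda>i. x i \<noteq> y i) \<noteq> (A x \<noteq> A y)" by (auto simp: additive_def)
    have andC: "mem C k (\<lambda>z. U z \<and> W z)" if U: "mem C k U" and W: "mem C k W" for k U W
    proof -
      have k: "1 \<le> k" using mem_pos[OF O U] .
      \<comment> \<open>\<open>Q u v\<close> is \<open>A\<close> at the mod 2 combination of
        \<open>x\<close> and \<open>y\<close> with coefficients \<open>u\<close> and
        \<open>v\<close>. As a polynomial it has linear coefficients \<open>A x\<close> and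
        \<open>A y\<close>, and the coefficient of \<open>u v\<close> is 1 because \<open>x\<close>,
        \<open>y\<close> violate additivity.\<close>
      define Q where "Q u v = A (\<lambda>i. if x i then (if y i then u \<noteq> v else u) else (if y i then v else False))" for u v
      have "mem C k (\<lambda>z. A (\<lambda>i. (if x i then (if y i then (\<lambda>z. U z \<noteq> W z) else U)
          else (if y i then W else (\<lambda>_. False))) z))"
        by (rule compI[OF C(2) A]) (use U W plus[OF U W] zero[OF k] in simp)
      also have "(\<lambda>z. A (\<lambda>i. (if x i then (if y i then (\<lambda>z. U z \<noteq> W z) else U)
          else (if y i then W else (\<lambda>_. False))) z)) = (\<lambda>z. Q (U z) (W z))"
        unfolding Q_def by (intro ext arg_cong[where f = A]) simp
      finally have q: "mem C k (\<lambda>z. Q (U z) (W z))" .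
      have "Q False False = False" by (simp add: Q_def A_def)
      moreover have "Q True False = A x" unfolding Q_def by (rule arg_cong[where f = A]) auto
      moreover have "Q False True = A y" unfolding Q_def by (rule arg_cong[where f = A]) auto
      moreover have "Q True True = A (\<lambda>i. x i \<noteq> y i)" unfolding Q_def by (rule arg_cong[where f = A]) auto
      ultimately have Q: "(u \<and> v) = ((Q u v \<noteq> (A x \<and> u)) \<noteq> (A y \<and> v))" for u v
        using xy by (cases u; cases v) auto
      have "mem C k (\<lambda>z. A x \<and> U z)" using U zero[OF k] by (cases "A x") simp_all
      moreover have "mem C k (\<lambda>z. A y \<and> W z)" using W zero[OF k] by (cases "A y") simp_all
      ultimately have "mem C k (\<lambda>z. (Q (U z) (W z) \<noteq> (A x \<and> U z)) \<noteq> (A y \<and> W z))" by (intro plus q)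
      then show ?thesis unfolding Q[symmetric] .
    qed
    have "mem C n (\<lambda>x. F x \<and> \<not> G x)" if FG: "mem C n F" "mem C n G" for n F G
      by (rule back_subst[of "mem C n", OF plus[OF FG(1) andC[OF FG]]]) auto
    then show ?thesis using tw by blast
  qed
qed

lemma uncountable_interval_nonclone_zero:
  assumes C1: "minor_closed C1" and C: "minor_closed C2" "comp_closed C2" and sub: "C1 \<subseteq> C2" "C1 \<noteq> C2"
    and L: "\<not> C2 \<subseteq> L_class"
    and const: "\<And>n F. mem C2 n F \<Longrightarrow> F (\<lambda>_. False) = F (\<lambda>_. True)"
    and F0: "mem C2 n0 F0" "\<not> F0 (\<lambda>_. False)" "F0 a0"
  shows "\<not> countable (class_interval C1 C2)"
proof -
  have O: "C2 \<subseteq> Omega" using minor_closed_Omega[OF C(1)] .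
  obtain c where tw: "mem C2 2 (\<lambda>z. twist c (z 0) (z 1))"
    and diff: "\<And>n F G. mem C2 n F \<Longrightarrow> mem C2 n G \<Longrightarrow> mem C2 n (\<lambda>x. F x \<and> \<not> G x)"
  proof -
    have "\<exists>c. mem C2 2 (\<lambda>z. twist c (z 0) (z 1)) \<and>
      (\<forall>n F G. mem C2 n F \<longrightarrow> mem C2 n G \<longrightarrow> mem C2 n (\<lambda>x. F x \<and> \<not> G x))"
      by (rule nonclone_difference[OF C L _ F0]) (rule const)
    then show thesis by (elim exE conjE) (rule that, simp_all)
  qed
  \<comment> \<open>A true point is needed, since nothing can be removed from the constant 0. If
    \<open>F0\<close> lies in \<open>C1\<close>, so do the constants 0, and every function in
    \<open>C2 - C1\<close> has a true point; otherwise \<open>F0\<close> itself serves.\<close>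
  have "\<exists>p f a. mem C2 p f \<and> \<not> mem C1 p f \<and> f a"
  proof (cases "mem C1 n0 F0")
    case True
    have zero: "mem C1 n (\<lambda>_. False)" if "1 \<le> n" for n
      using mem_const_diag[OF C1 True, of False n] F0(2) const[OF F0(1)] that by simp
    obtain p f where f: "mem C2 p f" "\<not> mem C1 p f" using not_subset_mem[OF O] sub by blast
    have "\<exists>a. f a"
    proof (rule ccontr)
      assume "\<nexists>a. f a"
      then have "f = (\<lambda>_. False)" by auto
      then show False using f(2) zero mem_pos[OF O f(1)] by simp
    qed
    then show ?thesis using f by blast
  qed (use F0 in blast)
  then obtain p f a where f: "mem C2 p f" "\<not> mem C1 p f" "f a" by blast
  note sup = mem_supported[OF f(1)]
  let ?n = "\<lambda>i. p + 5 + i"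
  show ?thesis
  proof (rule antichain_uncountable[OF C1 C(1) sub(1), where N = "\<lambda>i. p + 2 + ?n i" and H = "\<lambda>i. guarded c f p (?n i)"])
    show "mem C2 (p + 2 + ?n i) (guarded c f p (?n i))" for i by (rule mem_guarded[OF C f(1) tw diff])
    show "\<not> mem C1 (p + 2 + ?n i) (guarded c f p (?n i))" for i
      using guarded_minor[OF C1 sup mem_pos[OF O f(1)]] f(2) by blast
    fix i j \<sigma>
    assume "i \<noteq> j" and \<sigma>: "\<And>l. l < p + 2 + ?n j \<Longrightarrow> \<sigma> l < p + 2 + ?n i"
      and "guarded c f p (?n i) = (\<lambda>x. guarded c f p (?n j) (\<lambda>l. x (\<sigma> l)))"
    then have "?n i = ?n j" by (intro guarded_antichain[where f = f and a = a, OF sup f(3) _ _ \<sigma>]) simp_all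
    then show False using \<open>i \<noteq> j\<close> by simp
  qed
qed

text \<open>Without the identity all members are constant on the diagonal, since a unary negation
  composed with itself would be the identity. A member outside V is nonconstant; it or its dual is 0
  on the diagonal and has a true point.\<close>

lemma uncountable_interval_nonclone:
  assumes C1: "minor_closed C1" and C: "minor_closed C2" "comp_closed C2" and sub: "C1 \<subseteq> C2" "C1 \<noteq> C2"
    and no_proj: "\<not> boolean_clone C2" and not: "\<not> C2 \<subseteq> V_class" "\<not> C2 \<subseteq> L_class"
  shows "\<not> countable (class_interval C1 C2)"
proof -
  have O: "C2 \<subseteq> Omega" using minor_closed_Omega[OF C(1)] .
  have np: "\<not> mem C2 1 (\<lambda>x. x 0)" using no_proj C by (simp add: boolean_clone_def)
  have const: "F (\<lambda>_. False) = F (\<lambda>_. True)" if F: "mem C2 n F" for n F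
  proof (rule ccontr)
    assume ne: "\<not> ?thesis"
    have "F (\<lambda>_. b) = (F (\<lambda>_. True) = b)" for b using ne by (cases b) auto
    then have eq: "(\<lambda>z. F (\<lambda>_. z 0)) = (\<lambda>z :: nat \<Rightarrow> bool. F (\<lambda>_. True) = z 0)" by (intro ext)
    have d: "mem C2 1 (\<lambda>z. F (\<lambda>_. True) = z 0)"
      by (rule back_subst[of "mem C2 1", OF mem_diag[OF C(1) F] eq]) simp
    have "mem C2 1 (\<lambda>z. F (\<lambda>_. True) = (F (\<lambda>_. True) = z 0))"
      by (rule comp1[OF C(2) d d])
    then have "mem C2 1 (\<lambda>z. z 0)" by (rule back_subst[of "mem C2 1"]) auto
    then show False using np by simp
  qed
  obtain n F where F: "mem C2 n F" "\<not> mem V_class n F" using not_subset_mem[OF O not(1)] .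
  have nonconst: "\<exists>x. F x = b" for b
  proof (rule ccontr)
    assume "\<nexists>x. F x = b"
    then have "F = (\<lambda>_. \<not> b)" by auto
    then show False using F(2) mem_pos[OF O F(1)] unfolding mem_V_class by blast
  qed
  show ?thesis
  proof (cases "F (\<lambda>_. False)")
    case False
    obtain a where "F a" using nonconst[of True] by auto
    show ?thesis by (rule uncountable_interval_nonclone_zero[OF C1 C sub not(2) const F(1) False \<open>F a\<close>])
  next
    case True
    obtain a where a: "\<not> F a" using nonconst[of False] by auto
    have O1: "C1 \<subseteq> Omega" using sub(1) O by blast
    have "\<not> countable (class_interval (dual C1) (dual C2))"
    proof (rule uncountable_interval_nonclone_zero[OF minor_closed_dual[OF C1] minor_closed_dual[OF C(1)]
          comp_closed_dual[OF C(2)] dual_mono[OF sub(1)]])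
      show "dual C1 \<noteq> dual C2" using sub(2) dual_dual[OF O] dual_dual[OF O1] by metis
      show "\<not> dual C2 \<subseteq> L_class"
        using not(2) dual_subset_iff[OF O] mem_L_dual_op dual_op_dual_op subset_via_mem[OF O] by metis
      show "F (\<lambda>_. False) = F (\<lambda>_. True)" if "mem (dual C2) n F" for n F
        using const[OF that[unfolded mem_dual]] by (auto simp: dual_op_def)
      show "mem (dual C2) n (dual_op F)" using F(1) by (simp add: mem_dual)
      show "\<not> dual_op F (\<lambda>_. False)" using True const[OF F(1)] by (simp add: dual_op_def)
      show "dual_op F (\<lambda>i. \<not> a i)" using a by (simp add: dual_op_def)
    qed
    then show ?thesis using countable_interval_dual[OF C1 C(1)] by blast
  qed
qed

section \<open>The classification\<close>

lemma mem_U_dual_op: "mem (U_class k) n (dual_op F) \<longleftrightarrow> mem (W_class k) n F"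
  by (simp add: U_class_def W_class_def mem_separating_dual_op)

lemma mem_W_inf: "mem W_inf n F \<longleftrightarrow> (\<forall>k\<ge>2. mem (W_class k) n F)"
proof -
  have "mem (W_class 2) n F \<Longrightarrow> supported n F" by (rule mem_supported)
  then show ?thesis unfolding mem_def W_inf_def by auto
qed

lemma between_dual:
  assumes C: "C1 \<subseteq> Omega" "C2 \<subseteq> Omega" and D: "\<And>n F. mem D n (dual_op F) \<longleftrightarrow> mem D' n F"
    and b: "D \<inter> Mc_class \<subseteq> dual C1" "dual C2 \<subseteq> D \<inter> M_class"
  shows "D' \<inter> Mc_class \<subseteq> C1 \<and> C2 \<subseteq> D' \<inter> M_class"
proof
  have "D' \<inter> Mc_class \<subseteq> Omega" using M_class_Omega by (auto simp: Mc_class_def)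
  then show "D' \<inter> Mc_class \<subseteq> C1"
  proof (rule subset_via_mem)
    fix n F assume "mem (D' \<inter> Mc_class) n F"
    then have "mem (D \<inter> Mc_class) n (dual_op F)" by (simp add: mem_Int D mem_Mc_dual_op)
    from mem_mono[OF b(1) this] show "mem C1 n F" by (simp add: mem_dual)
  qed
  show "C2 \<subseteq> D' \<inter> M_class"
  proof (rule subset_via_mem[OF C(2)])
    fix n F assume "mem C2 n F"
    then have "mem (dual C2) n (dual_op F)" by (simp add: mem_dual)
    from mem_mono[OF b(2) this] show "mem (D' \<inter> M_class) n F" by (simp add: mem_Int D mem_M_dual_op)
  qed
qed

text \<open>Countability leaves only constants in \<open>C2 - C1\<close>. The constant 0 is the case
  of \<open>clone_constant_gap\<close>; the constant 1 is its dual, which exchanges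
  \<open>U_class\<close> and \<open>W_class\<close>.\<close>

lemma clone_countable_interval:
  assumes C1: "minor_closed C1" and C: "boolean_clone C2" and sub: "C1 \<subseteq> C2" "C1 \<noteq> C2"
    and not: "\<not> C2 \<subseteq> V_class" "\<not> C2 \<subseteq> Lambda_class" "\<not> C2 \<subseteq> L_class"
    and cnt: "countable (class_interval C1 C2)"
  shows "\<exists>D \<in> {U_class m | m. m \<ge> 2} \<union> {W_class m | m. m \<ge> 2} \<union> {Omega, U_inf, W_inf}.
    D \<inter> Mc_class \<subseteq> C1 \<and> C2 \<subseteq> D \<inter> M_class"
proof -
  note C' = cloneD[OF C]
  have O1: "C1 \<subseteq> Omega" using minor_closed_Omega[OF C1] .
  have gap: "mem C1 n F" if "mem C2 n F" "F y \<noteq> F y'" for n F y y'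
  proof (rule ccontr)
    assume "\<not> mem C1 n F"
    from uncountable_interval_clone[where f = F and y = y and y' = y', OF C1 C sub(1) not that(1) this that(2)]
    show False using cnt by blast
  qed
  obtain m F where F: "mem C2 m F" "\<not> mem C1 m F" using not_subset_mem[OF C'(3)] sub by blast
  have "F x = F (\<lambda>_. False)" for x using gap[OF F(1), of x "\<lambda>_. False"] F(2) by blast
  then have c: "F = (\<lambda>_. F (\<lambda>_. False))" by (rule ext)
  show ?thesis
  proof (cases "F (\<lambda>_. False)")
    case False
    then have c0: "F = (\<lambda>_. False)" using c by simp
    have "\<exists>D \<in> {U_class m | m. m \<ge> 2} \<union> {Omega, U_inf}. D \<inter> Mc_class \<subseteq> C1 \<and> C2 \<subseteq> D \<inter> M_class"
      by (rule clone_constant_gap[OF C1 C not _ F[unfolded c0]]) (rule gap)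
    then show ?thesis by blast
  next
    case True
    then have c1: "F = (\<lambda>_. True)" using c by simp
    have "\<exists>D \<in> {U_class m | m. m \<ge> 2} \<union> {Omega, U_inf}. D \<inter> Mc_class \<subseteq> dual C1 \<and> dual C2 \<subseteq> D \<inter> M_class"
    proof (rule clone_constant_gap[OF minor_closed_dual[OF C1] boolean_clone_dual[OF C]])
      show "\<not> dual C2 \<subseteq> V_class" "\<not> dual C2 \<subseteq> Lambda_class"
        using not dual_subset_V_iff[OF C'(3)] dual_subset_Lambda_iff[OF C'(3)] by auto
      show "\<not> dual C2 \<subseteq> L_class"
        using not(3) dual_subset_iff[OF C'(3)] mem_L_dual_op dual_op_dual_op subset_via_mem[OF C'(3)] by metis
      show "mem (dual C1) n G" if G: "mem (dual C2) n G" "G y \<noteq> G y'" for n G y y'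
        using gap[of n "dual_op G" "\<lambda>i. \<not> y i" "\<lambda>i. \<not> y' i"] G by (simp add: mem_dual) (simp add: dual_op_def)
      show "mem (dual C2) m (\<lambda>_. False)" "\<not> mem (dual C1) m (\<lambda>_. False)"
        using F[unfolded c1] by (simp_all add: mem_dual dual_op_def)
    qed
    then obtain D where D: "D \<in> {U_class m | m. m \<ge> 2} \<union> {Omega, U_inf}"
      "D \<inter> Mc_class \<subseteq> dual C1" "dual C2 \<subseteq> D \<inter> M_class" by blast
    have "\<exists>D'. D' \<in> {W_class m | m. m \<ge> 2} \<union> {Omega, W_inf} \<and> (\<forall>n F. mem D n (dual_op F) \<longleftrightarrow> mem D' n F)"
    proof -
      consider m where "D = U_class m" "m \<ge> 2" | "D = Omega" | "D = U_inf" using D(1) by blast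
      then show ?thesis
      proof cases
        case 1
        then have "W_class m \<in> {W_class m | m. m \<ge> 2} \<union> {Omega, W_inf}" by blast
        moreover have "\<forall>n F. mem D n (dual_op F) \<longleftrightarrow> mem (W_class m) n F" using 1(1) mem_U_dual_op by simp
        ultimately show ?thesis by blast
      next
        case 2
        then show ?thesis by (intro exI[of _ Omega]) (simp add: mem_Omega)
      next
        case 3
        then show ?thesis by (intro exI[of _ W_inf]) (simp add: mem_U_inf mem_W_inf mem_U_dual_op)
      qed
    qed
    then obtain D' where D': "D' \<in> {W_class m | m. m \<ge> 2} \<union> {Omega, W_inf}"
      "\<And>n F. mem D n (dual_op F) \<longleftrightarrow> mem D' n F" by blast
    from between_dual[OF O1 C'(3) D'(2) D(2,3)] show ?thesis using D'(1) by blast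
  qed
qed

text \<open>Distinctness of \<open>C1\<close> and \<open>C2\<close> excludes the one-element
  intervals, which are countable for every \<open>C2\<close>.\<close>

theorem theorem8:
  fixes C1 C2 :: "bfun set"
  assumes "equational_class C1" and "idempotent_class C1"
    and "equational_class C2" and "idempotent_class C2"
    and "C1 \<subseteq> C2" and "C1 \<noteq> C2"
  shows "countable (class_interval C1 C2) \<longleftrightarrow>
      C2 \<subseteq> V_class
    \<or> C2 \<subseteq> Lambda_class
    \<or> C2 \<subseteq> L_class
    \<or> (\<exists>C \<in> {U_class m | m. m \<ge> 2} \<union> {W_class m | m. m \<ge> 2} \<union> {Omega, U_inf, W_inf}.
          C \<inter> Mc_class \<subseteq> C1 \<and> C2 \<subseteq> C \<inter> M_class)"
proof -
  have C1: "minor_closed C1" and C2: "minor_closed C2" using assms by (simp_all add: equational_class_iff)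
  have C2': "comp_closed C2" using idempotent_comp_closed[OF minor_closed_Omega[OF C2] assms(4)] .
  show ?thesis
  proof
    assume cnt: "countable (class_interval C1 C2)"
    show "C2 \<subseteq> V_class \<or> C2 \<subseteq> Lambda_class \<or> C2 \<subseteq> L_class
      \<or> (\<exists>C \<in> {U_class m | m. m \<ge> 2} \<union> {W_class m | m. m \<ge> 2} \<union> {Omega, U_inf, W_inf}.
          C \<inter> Mc_class \<subseteq> C1 \<and> C2 \<subseteq> C \<inter> M_class)"
    proof (cases "boolean_clone C2")
      case True
      from clone_countable_interval[OF C1 True assms(5,6) _ _ _ cnt] show ?thesis by argo
    next
      case False
      then show ?thesis using uncountable_interval_nonclone[OF C1 C2 C2' assms(5,6)] cnt by argo
    qed
  next
    assume "C2 \<subseteq> V_class \<or> C2 \<subseteq> Lambda_class \<or> C2 \<subseteq> L_class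
      \<or> (\<exists>C \<in> {U_class m | m. m \<ge> 2} \<union> {W_class m | m. m \<ge> 2} \<union> {Omega, U_inf, W_inf}.
          C \<inter> Mc_class \<subseteq> C1 \<and> C2 \<subseteq> C \<inter> M_class)"
    then show "countable (class_interval C1 C2)"
      using countable_interval_V countable_interval_Lambda[OF C1 C2] countable_interval_L
        countable_interval_between_M by (elim disjE bexE conjE) simp_all
  qed
qed

end
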